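(* Assume Hypothesis A, and let $\{f(t,x,z)\}_{t\ge0}$ be a collection of probability densities on $\mathbb{R}^6$ satisfying Hypotheses (B0)–(B3). Let $T>0$ and suppose there exist a stochastic basis $(\Omega,\mathscr F,(\mathscr F_t)_{t\in[0,T]},P)$, a Poisson random measure $N(dv,d\theta,d\phi,dr,ds)$ on $\mathbb{R}^3\times\Xi\times[0,\infty)\times[0,T]$ adapted to the filtration with compensator $m(s,v)\,dv\,Q(d\theta)\,d\phi\,dr\,ds$, and an adapted process $(X_t,Z_t)_{t\in[0,T]}$ with c\`adl\`ag paths in $\mathbb{R}^3\times\mathbb{R}^3$ whose law at each time $t$ has density $f(t,\cdot,\cdot)$, such that a.s. for all $t\in[0,T]$ $$X_t=X_0+\int_0^tZ_s\,ds,\qquad Z_t=Z_0+\int_0^t\int_{\mathbb{R}^3\times\Xi\times[0,\infty)}\alpha(Z_{s-},v,\theta,\phi)\,\mathbf 1_{[0,\sigma(|Z_{s-}-v|)f(s,X_s|v)]}(r)\,N(dv,d\theta,d\phi,dr,ds).$$ Then $\{f(t,\cdot,\cdot)\}_{t\in[0,T]}$ is a weak solution of the Boltzmann equation on $[0,T]$, and hence $(X_t,Z_t)_{t\in[0,T]}$ is a Boltzmann process.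
   Context: Collision geometry: for $w\in\mathbb{R}^3\setminus\{0\}$ fix measurable $I(w),J(w)$ such that $w/|w|,I(w)/|w|,J(w)/|w|$ is an orthonormal basis, and set $\Gamma(w,\phi)=I(w)\cos\phi+J(w)\sin\phi$. For $z,v\in\mathbb{R}^3$, $\theta\in(0,\pi]$, $\phi\in[0,2\pi)$ let $\alpha(z,v,\theta,\phi)=\sin^2(\theta/2)(v-z)+\frac{\sin\theta}{2}\Gamma(v-z,\phi)$, $z^\star=z+\alpha$. Let $\Xi=(0,\pi]\times[0,2\pi)$. Hypothesis A: $Q$ is a $\sigma$-finite measure on $(0,\pi]$, finite outside every neighbourhood of $0$, with $\int_0^\epsilon\theta\,Q(d\theta)<\infty$ for all $\epsilon>0$; $\sigma(r)=c\,r^\gamma$, $c>0$, $\gamma\in(-1,1]$. Marginals: $m(t,v)=\int_{\mathbb{R}^3}f(t,x,v)\,dx$ and $f(t,x|v)=f(t,x,v)/m(t,v)$ (conditional density, so $f(t,x|v)m(t,v)=f(t,x,v)$). Hypotheses B: $t\mapsto f(t,x,v)$ is differentiable for each $(x,v)$ and (B0) $|\partial_tf|$ is bounded on every compact subset of $[0,\infty)\times\mathbb{R}^6$; (B1) $\partial_tf(t,\cdot)\in L^1(\mathbb{R}^6)$ for all $t\ge0$; (B2) $t\mapsto\sup_{x\in\mathbb{R}^3}\int_{\mathbb{R}^3}|z|^{1+\gamma}f(t,x,z)\,dz$ belongs to $C([0,T])$ for all $T>0$; (B3) $t\mapsto\sup_{x\in\mathbb{R}^3}\int_{\mathbb{R}^3}|z|^{1+\gamma}\partial_tf(t,x,z)\,dz$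 belongs to $L^1([0,T])$ for all $T>0$. Operator: $L_{f(t)}\psi(x,z)=\int_{\mathbb{R}^3\times\Xi}\{\psi(x,z^\star)-\psi(x,z)\}f(t,x,v)\sigma(|z-v|)\,dv\,Q(d\theta)\,d\phi$. Weak solution of the Boltzmann equation on $[0,T]$: a collection of probability densities $\{f(t,\cdot,\cdot)\}_{t\in[0,T]}$ such that for all $t\in[0,T]$ and all $\psi\in C^2_0(\mathbb{R}^6)$ (twice differentiable with compact support): $\int\psi f(t)\,dx\,dz=\int\psi f(0)\,dx\,dz+\int_0^t\int f(s,x,z)(z\cdot\nabla_x\psi(x,z))\,dx\,dz\,ds+\int_0^t\int f(s,x,z)L_{f(s)}\psi(x,z)\,dx\,dz\,ds$. Boltzmann process: a process $(X_t,Z_t)_{t\in[0,T]}$ with c\`adl\`ag paths whose time-marginal densities $\{f(t,\cdot,\cdot)\}_{t\in[0,T]}$ form a weak solution of the Boltzmann equation on $[0,T]$. *)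

theory Defs
  imports "HOL-Probability.Probability"
begin

type_synonym R3 = "real^3"
type_synonym ev = "R3 \<times> real \<times> real \<times> real \<times> real"  (* (v, theta, phi, r, s) *)

definition collision_frame :: "(R3 \<Rightarrow> R3) \<Rightarrow> (R3 \<Rightarrow> R3) \<Rightarrow> bool" where
  "collision_frame I J \<longleftrightarrow> I \<in> borel_measurable borel \<and> J \<in> borel_measurable borel \<and>
     (\<forall>w. w \<noteq> 0 \<longrightarrow>
        (let e1 = w /\<^sub>R norm w; e2 = I w /\<^sub>R norm w; e3 = J w /\<^sub>R norm w in
         e1 \<bullet> e1 = 1 \<and> e2 \<bullet> e2 = 1 \<and> e3 \<bullet> e3 = 1 \<and>
         e1 \<bullet> e2 = 0 \<and> e1 \<bullet> e3 = 0 \<and> e2 \<bullet> e3 = 0))"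

definition Gamma :: "(R3 \<Rightarrow> R3) \<Rightarrow> (R3 \<Rightarrow> R3) \<Rightarrow> R3 \<Rightarrow> real \<Rightarrow> R3" where
  "Gamma I J w \<phi> = cos \<phi> *\<^sub>R I w + sin \<phi> *\<^sub>R J w"

definition alpha :: "(R3 \<Rightarrow> R3) \<Rightarrow> (R3 \<Rightarrow> R3) \<Rightarrow> R3 \<Rightarrow> R3 \<Rightarrow> real \<Rightarrow> real \<Rightarrow> R3" where
  "alpha I J z v \<theta> \<phi> = (sin (\<theta>/2))\<^sup>2 *\<^sub>R (v - z) + (sin \<theta> / 2) *\<^sub>R Gamma I J (v - z) \<phi>"

definition zstar :: "(R3 \<Rightarrow> R3) \<Rightarrow> (R3 \<Rightarrow> R3) \<Rightarrow> R3 \<Rightarrow> R3 \<Rightarrow> real \<Rightarrow> real \<Rightarrow> R3" where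
  "zstar I J z v \<theta> \<phi> = z + alpha I J z v \<theta> \<phi>"

definition Xi :: "(real \<times> real) set" where
  "Xi = {0<..pi} \<times> {0..<2*pi}"

definition hypA :: "real measure \<Rightarrow> real \<Rightarrow> real \<Rightarrow> bool" where
  "hypA Q c \<gamma> \<longleftrightarrow>
     sets Q = sets borel \<and> sigma_finite_measure Q \<and> emeasure Q (- {0<..pi}) = 0 \<and>
     (\<forall>\<epsilon>>0. emeasure Q {\<epsilon>..} < \<infinity>) \<and>
     (\<forall>\<epsilon>>0. (\<integral>\<^sup>+ \<theta>. ennreal \<theta> * indicator {0<..\<epsilon>} \<theta> \<partial>Q) < \<infinity>) \<and>
     c > 0 \<and> -1 < \<gamma> \<and> \<gamma> \<le> 1"

definition sigma_cs :: "real \<Rightarrow> real \<Rightarrow> real \<Rightarrow> real" where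
  "sigma_cs c \<gamma> r = c * r powr \<gamma>"

abbreviation P6 :: "(R3 \<times> R3) measure" where
  "P6 \<equiv> lborel \<Otimes>\<^sub>M lborel"

definition prob_density6 :: "(R3 \<Rightarrow> R3 \<Rightarrow> real) \<Rightarrow> bool" where
  "prob_density6 g \<longleftrightarrow> (\<lambda>(x,z). g x z) \<in> borel_measurable P6 \<and> (\<forall>x z. 0 \<le> g x z) \<and>
     (\<integral>\<^sup>+ (x,z). ennreal (g x z) \<partial>P6) = 1"

definition marg :: "(real \<Rightarrow> R3 \<Rightarrow> R3 \<Rightarrow> real) \<Rightarrow> real \<Rightarrow> R3 \<Rightarrow> real" where
  "marg f t v = (\<integral> x. f t x v \<partial>lborel)"

definition cond :: "(real \<Rightarrow> R3 \<Rightarrow> R3 \<Rightarrow> real) \<Rightarrow> real \<Rightarrow> R3 \<Rightarrow> R3 \<Rightarrow> real" where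
  "cond f t x v = f t x v / marg f t v"

definition moment_sup :: "(real \<Rightarrow> R3 \<Rightarrow> R3 \<Rightarrow> real) \<Rightarrow> real \<Rightarrow> real \<Rightarrow> ennreal" where
  "moment_sup f \<gamma> t = (SUP x. \<integral>\<^sup>+ z. ennreal (norm z powr (1 + \<gamma>) * f t x z) \<partial>lborel)"

definition dmoment_sup :: "(real \<Rightarrow> R3 \<Rightarrow> R3 \<Rightarrow> real) \<Rightarrow> real \<Rightarrow> real \<Rightarrow> ereal" where
  "dmoment_sup df \<gamma> t = (SUP x. ereal (\<integral> z. norm z powr (1 + \<gamma>) * df t x z \<partial>lborel))"

definition hypB :: "(real \<Rightarrow> R3 \<Rightarrow> R3 \<Rightarrow> real) \<Rightarrow> (real \<Rightarrow> R3 \<Rightarrow> R3 \<Rightarrow> real) \<Rightarrow> real \<Rightarrow> bool" where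
  "hypB f df \<gamma> \<longleftrightarrow>
     (\<forall>x v t. 0 \<le> t \<longrightarrow> ((\<lambda>s. f s x v) has_real_derivative df t x v) (at t within {0..})) \<and>
     (\<forall>K. compact K \<and> K \<subseteq> {0..} \<times> UNIV \<longrightarrow> (\<exists>B. \<forall>(t,x,v)\<in>K. \<bar>df t x v\<bar> \<le> B)) \<and>
     (\<forall>t\<ge>0. integrable P6 (\<lambda>(x,z). df t x z)) \<and>
     (\<forall>T>0. (\<forall>t\<in>{0..T}. moment_sup f \<gamma> t < \<infinity>) \<and>
            continuous_on {0..T} (\<lambda>t. enn2real (moment_sup f \<gamma> t))) \<and>
     (\<forall>t\<ge>0. \<forall>x. integrable lborel (\<lambda>z. norm z powr (1 + \<gamma>) * df t x z)) \<and>
     (\<forall>T>0. (AE t in lborel. t \<in> {0..T} \<longrightarrow> \<bar>dmoment_sup df \<gamma> t\<bar> \<noteq> \<infinity>) \<and>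
            set_integrable lborel {0..T} (\<lambda>t. real_of_ereal (dmoment_sup df \<gamma> t)))"

definition C2c :: "(R3 \<times> R3 \<Rightarrow> real) \<Rightarrow> bool" where
  "C2c \<psi> \<longleftrightarrow> (\<forall>p. \<psi> differentiable (at p)) \<and>
     (\<forall>u p. (\<lambda>q. frechet_derivative \<psi> (at q) u) differentiable (at p)) \<and>
     compact (closure {p. \<psi> p \<noteq> 0})"

definition L_op :: "(R3 \<Rightarrow> R3) \<Rightarrow> (R3 \<Rightarrow> R3) \<Rightarrow> real measure \<Rightarrow> real \<Rightarrow> real \<Rightarrow>
    (R3 \<Rightarrow> R3 \<Rightarrow> real) \<Rightarrow> (R3 \<times> R3 \<Rightarrow> real) \<Rightarrow> R3 \<Rightarrow> R3 \<Rightarrow> real" where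
  "L_op I J Q c \<gamma> g \<psi> x z =
     (\<integral> (v,\<theta>,\<phi>). indicator (UNIV \<times> Xi) (v,\<theta>,\<phi>) *
         ((\<psi> (x, zstar I J z v \<theta> \<phi>) - \<psi> (x, z)) * g x v * sigma_cs c \<gamma> (norm (z - v)))
       \<partial>(lborel \<Otimes>\<^sub>M (Q \<Otimes>\<^sub>M lborel)))"

definition weak_solution :: "(R3 \<Rightarrow> R3) \<Rightarrow> (R3 \<Rightarrow> R3) \<Rightarrow> real measure \<Rightarrow> real \<Rightarrow> real \<Rightarrow>
    (real \<Rightarrow> R3 \<Rightarrow> R3 \<Rightarrow> real) \<Rightarrow> real \<Rightarrow> bool" where
  "weak_solution I J Q c \<gamma> f T \<longleftrightarrow>
     (\<forall>t\<in>{0..T}. prob_density6 (f t)) \<and>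
     (\<forall>t\<in>{0..T}. \<forall>\<psi>. C2c \<psi> \<longrightarrow>
        (\<integral> (x,z). \<psi> (x,z) * f t x z \<partial>P6) =
          (\<integral> (x,z). \<psi> (x,z) * f 0 x z \<partial>P6)
        + set_lebesgue_integral lborel {0..t}
            (\<lambda>s. \<integral> (x,z). f s x z * frechet_derivative \<psi> (at (x,z)) (z, 0) \<partial>P6)
        + set_lebesgue_integral lborel {0..t}
            (\<lambda>s. \<integral> (x,z). f s x z * L_op I J Q c \<gamma> (f s) \<psi> x z \<partial>P6))"

definition cadlag_on :: "real \<Rightarrow> (real \<Rightarrow> 'b::topological_space) \<Rightarrow> bool" where
  "cadlag_on T g \<longleftrightarrow> (\<forall>t\<in>{0..<T}. (g \<longlongrightarrow> g t) (at_right t)) \<and>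
                      (\<forall>t\<in>{0<..T}. \<exists>l. (g \<longlongrightarrow> l) (at_left t))"

definition left_lim :: "(real \<Rightarrow> 'b::t2_space) \<Rightarrow> real \<Rightarrow> 'b" where
  "left_lim g s = Lim (at_left s) g"

definition boltzmann_process :: "(R3 \<Rightarrow> R3) \<Rightarrow> (R3 \<Rightarrow> R3) \<Rightarrow> real measure \<Rightarrow> real \<Rightarrow> real \<Rightarrow>
    'a measure \<Rightarrow> (real \<Rightarrow> 'a \<Rightarrow> R3) \<Rightarrow> (real \<Rightarrow> 'a \<Rightarrow> R3) \<Rightarrow> (real \<Rightarrow> R3 \<Rightarrow> R3 \<Rightarrow> real) \<Rightarrow> real \<Rightarrow> bool" where
  "boltzmann_process I J Q c \<gamma> M X Z f T \<longleftrightarrow>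
     (\<forall>\<omega>\<in>space M. cadlag_on T (\<lambda>t. (X t \<omega>, Z t \<omega>))) \<and>
     (\<forall>t\<in>{0..T}. distr M P6 (\<lambda>\<omega>. (X t \<omega>, Z t \<omega>)) = density P6 (\<lambda>(x,z). ennreal (f t x z))) \<and>
     weak_solution I J Q c \<gamma> f T"

definition stochastic_basis :: "'a measure \<Rightarrow> (real \<Rightarrow> 'a measure) \<Rightarrow> real \<Rightarrow> bool" where
  "stochastic_basis M F T \<longleftrightarrow> prob_space M \<and> (\<forall>t\<in>{0..T}. subalgebra M (F t)) \<and>
     (\<forall>s t. 0 \<le> s \<longrightarrow> s \<le> t \<longrightarrow> t \<le> T \<longrightarrow> sets (F s) \<subseteq> sets (F t))"

definition ev_time :: "ev \<Rightarrow> real" where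
  "ev_time e = snd (snd (snd (snd e)))"

definition PRM_base :: "real measure \<Rightarrow> ev measure" where
  "PRM_base Q = lborel \<Otimes>\<^sub>M (Q \<Otimes>\<^sub>M (lborel \<Otimes>\<^sub>M (lborel \<Otimes>\<^sub>M lborel)))"

definition PRM_region :: "real \<Rightarrow> ev set" where
  "PRM_region T = UNIV \<times> {0<..pi} \<times> {0..<2*pi} \<times> {0..} \<times> {0..T}"

definition intensity :: "real measure \<Rightarrow> (real \<Rightarrow> R3 \<Rightarrow> R3 \<Rightarrow> real) \<Rightarrow> real \<Rightarrow> ev measure" where
  "intensity Q f T = density (PRM_base Q)
      (\<lambda>e. ennreal (marg f (ev_time e) (fst e)) * indicator (PRM_region T) e)"

definition poisson_random_measure :: "'a measure \<Rightarrow> (real \<Rightarrow> 'a measure) \<Rightarrow> real \<Rightarrow> ev measure \<Rightarrow>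
    ('a \<Rightarrow> ev measure) \<Rightarrow> bool" where
  "poisson_random_measure M F T \<mu> N \<longleftrightarrow>
     (\<forall>\<omega>\<in>space M. sets (N \<omega>) = sets \<mu>) \<and>
     (\<forall>A\<in>sets \<mu>. (\<lambda>\<omega>. emeasure (N \<omega>) A) \<in> borel_measurable M) \<and>
     (\<forall>A\<in>sets \<mu>. emeasure \<mu> A < \<infinity> \<longrightarrow> (\<forall>k::nat.
        measure M {\<omega>\<in>space M. emeasure (N \<omega>) A = of_nat k} =
          exp (- enn2real (emeasure \<mu> A)) * enn2real (emeasure \<mu> A) ^ k / fact k)) \<and>
     (\<forall>A::nat \<Rightarrow> ev set. range A \<subseteq> sets \<mu> \<longrightarrow> disjoint_family A \<longrightarrow>
        prob_space.indep_vars M (\<lambda>_. borel) (\<lambda>i \<omega>. emeasure (N \<omega>) (A i)) UNIV) \<and>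
     (\<forall>t\<in>{0..T}. \<forall>A\<in>sets \<mu>. A \<subseteq> {e. ev_time e \<le> t} \<longrightarrow>
        (\<lambda>\<omega>. emeasure (N \<omega>) A) \<in> borel_measurable (F t)) \<and>
     (\<forall>t\<in>{0..T}. prob_space.indep_set M (sets (F t))
        (sigma_sets (space M) {{\<omega>\<in>space M. emeasure (N \<omega>) A \<in> B} | A B.
            A \<in> sets \<mu> \<and> A \<subseteq> {e. t < ev_time e} \<and> B \<in> sets (borel :: ennreal measure)}))"

definition jump_integrand :: "(R3 \<Rightarrow> R3) \<Rightarrow> (R3 \<Rightarrow> R3) \<Rightarrow> real \<Rightarrow> real \<Rightarrow>
    (real \<Rightarrow> R3 \<Rightarrow> R3 \<Rightarrow> real) \<Rightarrow> (real \<Rightarrow> 'a \<Rightarrow> R3) \<Rightarrow> (real \<Rightarrow> 'a \<Rightarrow> R3) \<Rightarrow> 'a \<Rightarrow> real \<Rightarrow> ev \<Rightarrow> R3" where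
  "jump_integrand I J c \<gamma> f X Z \<omega> t e = (case e of (v, \<theta>, \<phi>, r, s) \<Rightarrow>
     (indicator (UNIV \<times> {0<..pi} \<times> {0..<2*pi} \<times> {0..} \<times> {0<..t}) (v, \<theta>, \<phi>, r, s) *
      indicator {0 .. sigma_cs c \<gamma> (norm (left_lim (\<lambda>u. Z u \<omega>) s - v)) * cond f s (X s \<omega>) v} r)
     *\<^sub>R alpha I J (left_lim (\<lambda>u. Z u \<omega>) s) v \<theta> \<phi>)"

end

theory Submission
  imports Defs
begin

text \<open>Write the process as \<open>Z t = Z 0 + \<integral> \<beta> dN\<close>. On an increasing sequence of mark sets of finite intensity
  almost surely some arbitrarily fine time grids carry at most one point of \<open>N\<close> per cell, so the
  increments of \<open>\<psi> (X, Z)\<close> along such a grid split exactly into a drift part and an integral against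
  \<open>N\<close>; dominated convergence, first in the grid and then in the mark sets, gives Ito's formula
  pathwise. Taking expectations, the jump part is compensated: \<open>N\<close> may be replaced by its intensity
  for predictable integrands, because this holds on predictable rectangles by independence. Integrating
  out the acceptance variable \<open>r\<close> turns \<open>m(s,v) f(s,X|v)\<close> into \<open>f(s,X,v)\<close>, and the law of the process
  turns the expectation into the collision operator tested against \<open>f\<close>. Integrability comes
  from \<open>\<bar>\<alpha>\<bar> \<le> 2 \<theta> \<bar>z - v\<bar>\<close> and hypothesis (B2).\<close>

section \<open>Time grids and point measures\<close>

text \<open>The noise is given only as Borel measures with Poisson counts, not as sums of point
  masses, and its total mass is in general infinite because r ranges over [0,\<infinity>). So the
  jumps cannot be enumerated in time, and the grids replace such an enumeration. The probability of
  a bad grid tends to zero without a rate, so good grids are only shown to occur infinitely often;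
  this is enough because the increment of \<psi> over [0,t] does not depend on the grid.
  Compensation holds for predictable integrands, hence every jump coefficient is read at left
  limits. The resulting predictable version \<open>pre\<close> of the process agrees with it almost
  surely at each single time, since the intensity charges no fixed time; this brings the density f
  back into the formula. Bochner integrals have the default value 0 for integrands that are not
  integrable. Identities are therefore proved for integrands with values in [0,\<infinity>], and
  positive and negative parts are subtracted only after finiteness is known.\<close>

definition gridpt :: "real \<Rightarrow> nat \<Rightarrow> nat \<Rightarrow> real" where
  "gridpt t m k = t * real k / real (Suc m)"

text \<open>Cells are open on the left and closed on the right. For s in (0,t] the left endpoint of
  the cell of s lies strictly before s and samples left limits, while the right endpoint lies at or
  after s and samples right-continuous paths. The ceiling minus one gives this convention.\<close>

definition cell :: "real \<Rightarrow> nat \<Rightarrow> real \<Rightarrow> nat" where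
  "cell t m s = nat (\<lceil>real (Suc m) * s / t\<rceil> - 1)"

lemma gridpt_0 [simp]: "gridpt t m 0 = 0"
  by (simp add: gridpt_def)

lemma gridpt_last [simp]: "gridpt t m (Suc m) = t"
  by (simp add: gridpt_def del: of_nat_Suc)

lemma gridpt_mono: "0 \<le> t \<Longrightarrow> j \<le> k \<Longrightarrow> gridpt t m j \<le> gridpt t m k"
  by (auto simp: gridpt_def intro!: divide_right_mono mult_left_mono)

lemma gridpt_nonneg: "0 \<le> t \<Longrightarrow> 0 \<le> gridpt t m k"
  by (simp add: gridpt_def)

lemma gridpt_le: "0 \<le> t \<Longrightarrow> k \<le> Suc m \<Longrightarrow> gridpt t m k \<le> t"
  using gridpt_mono[of t k "Suc m" m] by simp

lemma gridpt_Suc: "gridpt t m (Suc k) = gridpt t m k + t / real (Suc m)"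
  by (simp add: gridpt_def field_simps del: of_nat_Suc) (simp add: field_simps)

lemma cell_unique:
  assumes "0 < t" "gridpt t m k < s" "s \<le> gridpt t m (Suc k)"
  shows "cell t m s = k"
proof -
  have "real k < real (Suc m) * s / t" "real (Suc m) * s / t \<le> real (Suc k)"
    using assms by (auto simp: gridpt_def field_simps simp del: of_nat_Suc)
  then have "\<lceil>real (Suc m) * s / t\<rceil> = int (Suc k)"
    by (intro ceiling_unique) auto
  then show ?thesis by (simp add: cell_def)
qed

lemma cell_bounds:
  assumes "0 < s" "s \<le> t"
  shows "cell t m s < Suc m" "gridpt t m (cell t m s) < s" "s \<le> gridpt t m (Suc (cell t m s))"
proof -
  let ?y = "real (Suc m) * s / t"
  have t: "0 < t" using assms by simp
  have y: "0 < ?y" "?y \<le> real (Suc m)"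
    using assms by (auto simp: field_simps simp del: of_nat_Suc)
  then have "0 < \<lceil>?y\<rceil>" "\<lceil>?y\<rceil> \<le> int (Suc m)"
    by (simp, subst ceiling_le_iff, simp)
  then have c: "int (cell t m s) = \<lceil>?y\<rceil> - 1" by (simp add: cell_def)
  then show "cell t m s < Suc m" using \<open>\<lceil>?y\<rceil> \<le> int (Suc m)\<close> by linarith
  have "real (cell t m s) = of_int \<lceil>?y\<rceil> - 1" using c by linarith
  then have "real (cell t m s) < ?y" "?y \<le> real (Suc (cell t m s))"
    using ceiling_correct[of ?y] by auto
  then show "gridpt t m (cell t m s) < s" "s \<le> gridpt t m (Suc (cell t m s))"
    using t by (auto simp: gridpt_def field_simps simp del: of_nat_Suc)
qed

text \<open>The sum is the form that is visibly measurable and can be integrated term by term; the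
  form through \<open>cell\<close> is the one that has pointwise limits. Step approximations are
  handled by passing between the two.\<close>

lemma sum_cells:
  fixes h :: "nat \<Rightarrow> 'b::real_vector"
  assumes "0 < t"
  shows "(\<Sum>k<Suc m. indicator {gridpt t m k<..gridpt t m (Suc k)} s *\<^sub>R h k)
         = indicator {0<..t} s *\<^sub>R h (cell t m s)"
proof (cases "0 < s \<and> s \<le> t")
  case True
  then have s: "0 < s" "s \<le> t" by auto
  have "(\<Sum>k<Suc m. indicator {gridpt t m k<..gridpt t m (Suc k)} s *\<^sub>R h k)
      = (\<Sum>k<Suc m. if k = cell t m s then h k else 0)"
    using cell_bounds[OF s] cell_unique[OF assms] by (intro sum.cong) (auto simp: indicator_def)
  also have "\<dots> = h (cell t m s)" using cell_bounds(1)[OF s, of m] by (subst sum.delta) auto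
  finally show ?thesis using s by simp
next
  case False
  have "indicator {gridpt t m k<..gridpt t m (Suc k)} s *\<^sub>R h k = 0" if "k < Suc m" for k
    using False gridpt_nonneg[of t m k] gridpt_le[of t "Suc k" m] assms that
    by (auto simp: indicator_def)
  then have "(\<Sum>k<Suc m. indicator {gridpt t m k<..gridpt t m (Suc k)} s *\<^sub>R h k) = 0"
    by (intro sum.neutral) auto
  then show ?thesis using False by (auto simp: indicator_def)
qed

lemma gridpt_cell_tendsto:
  assumes "0 < s" "s \<le> t"
  shows "(\<lambda>m. gridpt t m (cell t m s)) \<longlonglongrightarrow> s" "(\<lambda>m. gridpt t m (Suc (cell t m s))) \<longlonglongrightarrow> s"
proof -
  have lim: "(\<lambda>m. t / real (Suc m)) \<longlonglongrightarrow> 0"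
    using LIMSEQ_Suc[OF lim_const_over_n] by simp
  show "(\<lambda>m. gridpt t m (cell t m s)) \<longlonglongrightarrow> s"
  proof (rule tendsto_sandwich[of "\<lambda>m. s - t / real (Suc m)" _ _ "\<lambda>_. s"])
    show "\<forall>\<^sub>F m in sequentially. s - t / real (Suc m) \<le> gridpt t m (cell t m s)"
      using cell_bounds(3)[OF assms] by (intro always_eventually allI) (simp add: gridpt_Suc diff_le_eq)
    show "\<forall>\<^sub>F m in sequentially. gridpt t m (cell t m s) \<le> s"
      using cell_bounds(2)[OF assms] by (intro always_eventually allI less_imp_le)
  qed (use tendsto_diff[OF tendsto_const lim, of s] in auto)
  show "(\<lambda>m. gridpt t m (Suc (cell t m s))) \<longlonglongrightarrow> s"
  proof (rule tendsto_sandwich[of "\<lambda>m. s" _ _ "\<lambda>m. s + t / real (Suc m)"])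
    show "\<forall>\<^sub>F m in sequentially. gridpt t m (Suc (cell t m s)) \<le> s + t / real (Suc m)"
      using cell_bounds(2)[OF assms] by (intro always_eventually allI) (simp add: gridpt_Suc less_imp_le)
    show "\<forall>\<^sub>F m in sequentially. s \<le> gridpt t m (Suc (cell t m s))"
      using cell_bounds(3)[OF assms] by (intro always_eventually allI)
  qed (use tendsto_add[OF tendsto_const lim, of s] in auto)
qed

lemma tendsto_at_left_seq:
  fixes g :: "real \<Rightarrow> 'b::topological_space"
  assumes "(g \<longlongrightarrow> l) (at_left s)" "a \<longlonglongrightarrow> s" "\<And>m. a m < s"
  shows "(\<lambda>m. g (a m)) \<longlonglongrightarrow> l"
proof -
  have "filterlim a (at_left s) sequentially"
    using assms(2,3) by (auto simp: filterlim_at less_imp_neq intro!: always_eventually)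
  then show ?thesis using assms(1) filterlim_compose by blast
qed

text \<open>Unlike on the left, the sequence may hit s itself, because the limit is the value
  \<open>g s\<close>.\<close>

lemma tendsto_at_right_seq:
  fixes g :: "real \<Rightarrow> 'b::topological_space"
  assumes "(g \<longlongrightarrow> g s) (at_right s)" "a \<longlonglongrightarrow> s" "\<And>m. s \<le> a m"
  shows "(\<lambda>m. g (a m)) \<longlonglongrightarrow> g s"
proof -
  have "(g \<longlongrightarrow> g s) (at s within {s..})"
    using assms(1) by (metis at_within_Ici_at_right greaterThan_def atLeast_def tendsto_within_subset order_refl at_within_Ici_at_right)
  then have "continuous (at s within {s..}) g" by (simp add: continuous_within)
  then show ?thesis
    using assms(2,3) by (auto simp: continuous_within_sequentially comp_def)
qed

text \<open>Nothing represents the measure as a sum of point masses, so a single point is expressed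
  by unit mass together with equality to some e0 almost everywhere on S.\<close>

definition one_point :: "'e measure \<Rightarrow> 'e set \<Rightarrow> bool" where
  "one_point \<nu> S \<longleftrightarrow> emeasure \<nu> S = 0 \<or>
     (emeasure \<nu> S = 1 \<and> (\<exists>e0. AE e in \<nu>. e \<in> S \<longrightarrow> e = e0))"

text \<open>A unit mass concentrated at e0 turns integration into evaluation at e0, so even a
  nonlinear function commutes with the integral; on a null set both sides are 0. This makes the jump
  part of an increment exact instead of approximate.\<close>

lemma one_point_integral:
  fixes \<beta> :: "'e \<Rightarrow> 'b::{banach,second_countable_topology}" and \<phi> :: "'b \<Rightarrow> real"
  assumes "one_point \<nu> S" "S \<in> sets \<nu>" "\<beta> \<in> borel_measurable \<nu>" "\<phi> \<in> borel_measurable borel" "\<phi> 0 = 0"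
  shows "(\<integral>e. indicator S e * \<phi> (\<beta> e) \<partial>\<nu>) = \<phi> (\<integral>e. indicator S e *\<^sub>R \<beta> e \<partial>\<nu>)"
proof -
  note [measurable] = assms(2,3,4)
  consider "emeasure \<nu> S = 0" | e0 where "emeasure \<nu> S = 1" "AE e in \<nu>. e \<in> S \<longrightarrow> e = e0"
    using assms(1) by (auto simp: one_point_def)
  then show ?thesis
  proof cases
    case 1
    then have "AE e in \<nu>. e \<notin> S" using assms(2) by (intro AE_not_in) (auto simp: null_sets_def)
    then have "(\<integral>e. indicator S e * \<phi> (\<beta> e) \<partial>\<nu>) = 0" "(\<integral>e. indicator S e *\<^sub>R \<beta> e \<partial>\<nu>) = 0"
      by (auto intro!: integral_eq_zero_AE)
    then show ?thesis using assms(5) by simp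
  next
    case 2
    have m: "measure \<nu> S = 1" using 2(1) by (simp add: measure_def)
    have "(\<integral>e. indicator S e * \<phi> (\<beta> e) \<partial>\<nu>) = (\<integral>e. indicator S e * \<phi> (\<beta> e0) \<partial>\<nu>)"
      using 2(2) by (intro integral_cong_AE) (auto simp: indicator_def)
    also have "\<dots> = \<phi> (\<beta> e0)" using m 2(1) assms(2) by simp
    finally have a: "(\<integral>e. indicator S e * \<phi> (\<beta> e) \<partial>\<nu>) = \<phi> (\<beta> e0)" .
    have "(\<integral>e. indicator S e *\<^sub>R \<beta> e \<partial>\<nu>) = (\<integral>e. indicator S e *\<^sub>R \<beta> e0 \<partial>\<nu>)"
      using 2(2) by (intro integral_cong_AE) (auto simp: indicator_def)
    also have "\<dots> = \<beta> e0" using m 2(1) assms(2) by simp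
    finally show ?thesis using a by simp
  qed
qed

text \<open>Along each coordinate the distribution function of \<nu> on S is monotone with values 0
  and 1 only, hence jumps once, at the coordinate of the point sought. Rational thresholds suffice,
  so for a random measure only countably many counts have to be controlled almost surely.\<close>

lemma one_point_if_halfspaces_01:
  fixes \<nu> :: "'e::euclidean_space measure"
  assumes sets: "sets \<nu> = sets borel" and S: "S \<in> sets borel"
    and S01: "emeasure \<nu> S = 0 \<or> emeasure \<nu> S = 1"
    and H: "\<And>b q. b \<in> Basis \<Longrightarrow> q \<in> \<rat> \<Longrightarrow>
       emeasure \<nu> (S \<inter> {e. e \<bullet> b \<le> q}) = 0 \<or> emeasure \<nu> (S \<inter> {e. e \<bullet> b \<le> q}) = 1"
  shows "one_point \<nu> S"
proof (cases "emeasure \<nu> S = 0")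
  case True then show ?thesis by (simp add: one_point_def)
next
  case False
  then have S1: "emeasure \<nu> S = 1" using S01 by simp
  note [measurable_cong] = sets note [measurable] = S
  have "\<exists>cb. AE e in \<nu>. e \<in> S \<longrightarrow> e \<bullet> b = cb" if b: "b \<in> Basis" for b :: 'e
  proof -
    define G where "G q = emeasure \<nu> (S \<inter> {e. e \<bullet> b \<le> q})" for q
    have hs[measurable]: "S \<inter> {e. e \<bullet> b \<le> q} \<in> sets \<nu>" for q
      unfolding sets using S by (intro sets.Int) auto
    have mono: "p \<le> q \<Longrightarrow> G p \<le> G q" for p q
      unfolding G_def by (intro emeasure_mono) auto
    have zero_one: "G (of_rat q) = 0 \<or> G (of_rat q) = 1" for q using H[OF b, of "of_rat q"] by (auto simp: G_def)
    \<comment> \<open>The half-spaces exhaust S as q grows, so they cannot all be null; they shrink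
      to the empty set as q decreases, so they cannot all carry the full mass. Hence G takes both
      values.\<close>
    have "\<exists>q::rat. G (of_rat q) \<noteq> 0"
    proof (rule ccontr)
      assume "\<not> ?thesis"
      then have "AE e in \<nu>. \<forall>q::rat. e \<notin> S \<inter> {e. e \<bullet> b \<le> of_rat q}"
        unfolding AE_all_countable by (intro allI AE_not_in) (auto simp: null_sets_def G_def)
      then have "AE e in \<nu>. e \<notin> S"
        by eventually_elim (use of_rat_dense in \<open>metis (mono_tags) IntI less_eq_real_def linordered_field_no_ub mem_Collect_eq\<close>)
      then have "emeasure \<nu> S = 0"
        using S sets by (subst (asm) AE_iff_null_sets[symmetric]) auto
      then show False using S1 by simp
    qed
    then obtain q1 :: rat where q1: "G (of_rat q1) = 1" using zero_one by blast
    have "\<exists>q::rat. G (of_rat q) \<noteq> 1"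
    proof (rule ccontr)
      assume *: "\<not> ?thesis"
      have "AE e in \<nu>. \<forall>q::rat. e \<notin> S - S \<inter> {e. e \<bullet> b \<le> of_rat q}"
        unfolding AE_all_countable
      proof (intro allI AE_not_in)
        fix q :: rat
        have "emeasure \<nu> (S - S \<inter> {e. e \<bullet> b \<le> of_rat q}) = emeasure \<nu> S - G (of_rat q)"
          unfolding G_def using * by (intro emeasure_Diff) (auto simp: G_def)
        then show "S - S \<inter> {e. e \<bullet> b \<le> of_rat q} \<in> null_sets \<nu>"
          using * S1 by (auto simp: null_sets_def)
      qed
      then have "AE e in \<nu>. e \<notin> S"
        by eventually_elim (use of_rat_dense in \<open>metis (mono_tags, lifting) DiffI Int_iff linorder_not_le lt_ex mem_Collect_eq\<close>)
      then have "emeasure \<nu> S = 0"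
        using S sets by (subst (asm) AE_iff_null_sets[symmetric]) auto
      then show False using S1 by simp
    qed
    then obtain q0 :: rat where q0: "G (of_rat q0) = 0" using zero_one by blast
    \<comment> \<open>The threshold at which G switches from 0 to 1 is the common coordinate of
      almost all points of S.\<close>
    define cb :: real where "cb = Inf {of_rat q | q::rat. G (of_rat q) = 1}"
    have lb: "of_rat q0 \<le> (of_rat q :: real)" if "G (of_rat q) = 1" for q
      using mono[of "of_rat q" "of_rat q0"] that q0 by (cases "of_rat q \<le> (of_rat q0 :: real)") auto
    have bdd: "bdd_below {of_rat q :: real | q::rat. G (of_rat q) = (1::ennreal)}"
      by (rule bdd_belowI[of _ "of_rat q0"]) (use lb in auto)
    have up: "G (of_rat q) = 1" if "cb < of_rat q" for q
    proof -
      have "\<exists>x\<in>{of_rat q :: real | q::rat. G (of_rat q) = (1::ennreal)}. x < of_rat q"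
        using that q1 bdd unfolding cb_def by (subst (asm) cInf_less_iff) auto
      then obtain p where "G (of_rat p) = (1::ennreal)" "(of_rat p :: real) < of_rat q" by auto
      then show ?thesis using mono[of "of_rat p" "of_rat q"] zero_one[of q] by auto
    qed
    have low: "G (of_rat q) = 0" if "of_rat q < cb" for q
    proof (rule ccontr)
      assume "G (of_rat q) \<noteq> 0"
      then have "cb \<le> of_rat q" using zero_one bdd unfolding cb_def by (intro cInf_lower) auto
      then show False using that by simp
    qed
    have "AE e in \<nu>. \<forall>q::rat. (of_rat q < cb \<longrightarrow> e \<notin> S \<inter> {e. e \<bullet> b \<le> of_rat q}) \<and>
              (cb < of_rat q \<longrightarrow> e \<notin> S - S \<inter> {e. e \<bullet> b \<le> of_rat q})"
      unfolding AE_all_countable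
    proof (intro allI AE_conjI AE_impI AE_not_in)
      fix q :: rat
      assume "of_rat q < cb"
      then show "S \<inter> {e. e \<bullet> b \<le> of_rat q} \<in> null_sets \<nu>" using low by (auto simp: null_sets_def G_def)
    next
      fix q :: rat
      assume "cb < of_rat q"
      then have *: "G (of_rat q) = 1" using up by simp
      have "emeasure \<nu> (S - S \<inter> {e. e \<bullet> b \<le> of_rat q}) = emeasure \<nu> S - G (of_rat q)"
        unfolding G_def using * by (intro emeasure_Diff) (auto simp: G_def)
      then show "S - S \<inter> {e. e \<bullet> b \<le> of_rat q} \<in> null_sets \<nu>"
        using * S1 by (auto simp: null_sets_def)
    qed
    then have "AE e in \<nu>. e \<in> S \<longrightarrow> e \<bullet> b = cb"
    proof eventually_elim
      case (elim e)
      show ?case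
      proof (intro impI, rule ccontr)
        assume e: "e \<in> S" "e \<bullet> b \<noteq> cb"
        then consider "e \<bullet> b < cb" | "cb < e \<bullet> b" by linarith
        then show False
        proof cases
          case 1 then obtain q where "e \<bullet> b < of_rat q" "of_rat q < cb" using of_rat_dense by blast
          then show False using elim e by auto
        next
          case 2 then obtain q where "cb < of_rat q" "of_rat q < e \<bullet> b" using of_rat_dense by blast
          then show False using elim e by auto
        qed
      qed
    qed
    then show ?thesis by blast
  qed
  then obtain c where c: "\<And>b. b \<in> Basis \<Longrightarrow> AE e in \<nu>. e \<in> S \<longrightarrow> e \<bullet> b = c b" by metis
  have "AE e in \<nu>. \<forall>b\<in>Basis. e \<in> S \<longrightarrow> e \<bullet> b = c b"
    using c by (subst AE_finite_all) auto
  then have "AE e in \<nu>. e \<in> S \<longrightarrow> e = (\<Sum>b\<in>Basis. c b *\<^sub>R b)"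
    by eventually_elim (auto simp: euclidean_eq_iff[where 'a='e] inner_sum_left_Basis)
  then show ?thesis using S1 by (auto simp: one_point_def)
qed

section \<open>A pathwise Ito formula\<close>

lemma mvt_segment:
  fixes \<Psi> :: "'x::real_normed_vector \<Rightarrow> real"
  assumes "\<And>p. (\<Psi> has_derivative D p) (at p)"
  shows "\<exists>\<theta>\<in>{0..1}. \<Psi> (p + h) - \<Psi> p = D (p + \<theta> *\<^sub>R h) h"
proof -
  have "((\<lambda>u. \<Psi> (p + u *\<^sub>R h)) has_derivative (\<lambda>d. D (p + u *\<^sub>R h) (d *\<^sub>R h))) (at u within {0..1})" for u
    by (rule has_derivative_compose[of "\<lambda>u. p + u *\<^sub>R h" _ _ _ \<Psi>]) (auto intro!: derivative_eq_intros assms)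
  then obtain u where "u \<in> {0<..<1}" "\<Psi> (p + 1 *\<^sub>R h) - \<Psi> (p + 0 *\<^sub>R h) = D (p + u *\<^sub>R h) ((1 - 0) *\<^sub>R h)"
    using mvt_simple[of 0 1 "\<lambda>u. \<Psi> (p + u *\<^sub>R h)" "\<lambda>u d. D (p + u *\<^sub>R h) (d *\<^sub>R h)"] by auto
  then show ?thesis by (intro bexI[of _ u]) auto
qed

text \<open>Passes an identity that is known on infinitely many grids only to the limit.\<close>

lemma frequently_eq_limit:
  fixes a :: "nat \<Rightarrow> 'b::t2_space"
  assumes "a \<longlonglongrightarrow> l" "\<exists>\<^sub>F m in sequentially. a m = c"
  shows "c = l"
proof (rule ccontr)
  assume "c \<noteq> l"
  then have "\<forall>\<^sub>F m in sequentially. a m \<noteq> c" by (intro tendsto_imp_eventually_ne[OF assms(1)]) simp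
  then show False using assms(2) by (simp add: frequently_def)
qed

lemma indicator_Ioc_tendsto_right:
  fixes a :: "nat \<Rightarrow> real" and x :: real
  assumes "a \<longlonglongrightarrow> s" "\<And>m. s \<le> a m"
  shows "(\<lambda>m. indicator {0<..a m} x :: real) \<longlonglongrightarrow> indicator {0<..s} x"
proof (cases "x \<le> s")
  case True
  then have "indicator {0<..a m} x = (indicator {0<..s} x :: real)" for m
    using assms(2)[of m] by (auto simp: indicator_def)
  then show ?thesis by simp
next
  case False
  then have "\<forall>\<^sub>F m in sequentially. a m < x" using assms(1) by (simp add: order_tendstoD(2))
  then have "\<forall>\<^sub>F m in sequentially. indicator {0<..a m} x = (indicator {0<..s} x :: real)"
    by eventually_elim (use False in \<open>auto simp: indicator_def\<close>)
  then show ?thesis by (simp add: tendsto_eventually)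
qed

lemma indicator_Ioc_tendsto_left:
  fixes a :: "nat \<Rightarrow> real" and x :: real
  assumes "a \<longlonglongrightarrow> s" "\<And>m. a m < s"
  shows "(\<lambda>m. indicator {0<..a m} x :: real) \<longlonglongrightarrow> indicator {0<..<s} x"
proof (cases "x < s")
  case False
  then have "indicator {0<..a m} x = (indicator {0<..<s} x :: real)" for m
    using assms(2)[of m] by (auto simp: indicator_def)
  then show ?thesis by simp
next
  case True
  then have "\<forall>\<^sub>F m in sequentially. x < a m" using assms(1) by (simp add: order_tendstoD(1))
  then have "\<forall>\<^sub>F m in sequentially. indicator {0<..a m} x = (indicator {0<..<s} x :: real)"
    by eventually_elim (use True in \<open>auto simp: indicator_def\<close>)
  then show ?thesis by (simp add: tendsto_eventually)
qed

text \<open>Mass at time exactly s stays in the limit from the right and drops out in the limit from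
  the left. These limits are the path after and before the jump at s.\<close>

lemma
  fixes \<beta> :: "'e \<Rightarrow> 'z::{banach,second_countable_topology}" and a :: "nat \<Rightarrow> real"
  assumes [measurable]: "\<tau> \<in> borel_measurable \<nu>" and \<beta>: "integrable \<nu> \<beta>" and a: "a \<longlonglongrightarrow> s"
  shows cumulative_tendsto_right: "(\<And>m. s \<le> a m) \<Longrightarrow>
      (\<lambda>m. \<integral>e. indicator {0<..a m} (\<tau> e) *\<^sub>R \<beta> e \<partial>\<nu>) \<longlonglongrightarrow> (\<integral>e. indicator {0<..s} (\<tau> e) *\<^sub>R \<beta> e \<partial>\<nu>)"
    and cumulative_tendsto_left: "(\<And>m. a m < s) \<Longrightarrow>
      (\<lambda>m. \<integral>e. indicator {0<..a m} (\<tau> e) *\<^sub>R \<beta> e \<partial>\<nu>) \<longlonglongrightarrow> (\<integral>e. indicator {0<..<s} (\<tau> e) *\<^sub>R \<beta> e \<partial>\<nu>)"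
proof -
  have [measurable]: "\<beta> \<in> borel_measurable \<nu>" using \<beta> by auto
  show "(\<And>m. s \<le> a m) \<Longrightarrow>
      (\<lambda>m. \<integral>e. indicator {0<..a m} (\<tau> e) *\<^sub>R \<beta> e \<partial>\<nu>) \<longlonglongrightarrow> (\<integral>e. indicator {0<..s} (\<tau> e) *\<^sub>R \<beta> e \<partial>\<nu>)"
    by (intro integral_dominated_convergence[where w="\<lambda>e. norm (\<beta> e)"] AE_I2 tendsto_scaleR tendsto_const
         indicator_Ioc_tendsto_right a)
       (use \<beta> in \<open>auto simp: indicator_def\<close>)
  show "(\<And>m. a m < s) \<Longrightarrow>
      (\<lambda>m. \<integral>e. indicator {0<..a m} (\<tau> e) *\<^sub>R \<beta> e \<partial>\<nu>) \<longlonglongrightarrow> (\<integral>e. indicator {0<..<s} (\<tau> e) *\<^sub>R \<beta> e \<partial>\<nu>)"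
    by (intro integral_dominated_convergence[where w="\<lambda>e. norm (\<beta> e)"] AE_I2 tendsto_scaleR tendsto_const
         indicator_Ioc_tendsto_left a)
       (use \<beta> in \<open>auto simp: indicator_def\<close>)
qed

lemma continuous_on_indefinite_integral:
  fixes U :: "real \<Rightarrow> 'x::euclidean_space"
  assumes U[measurable]: "U \<in> borel_measurable borel" and K: "\<And>s. s \<in> {0<..t} \<Longrightarrow> norm (U s) \<le> K"
    and X: "\<And>a b. 0 \<le> a \<Longrightarrow> a \<le> b \<Longrightarrow> b \<le> t \<Longrightarrow> X b - X a = (\<integral>s. indicator {a<..b} s *\<^sub>R U s \<partial>lborel)"
  shows "continuous_on {0..t} X"
proof -
  have *: "norm (X b - X a) \<le> \<bar>K\<bar> * (b - a)" if ab: "0 \<le> a" "a \<le> b" "b \<le> t" for a b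
  proof -
    have "norm (X b - X a) \<le> (\<integral>s. indicator {a<..b} s * \<bar>K\<bar> \<partial>lborel)"
      unfolding X[OF ab]
    proof (rule order_trans[OF integral_norm_bound integral_mono])
      show "integrable lborel (\<lambda>s. indicator {a<..b} s * \<bar>K\<bar>)" using ab by (intro integrable_mult_left integrable_real_indicator) auto
      have "norm (indicator {a<..b} s *\<^sub>R U s) \<le> indicator {a<..b} s * \<bar>K\<bar>" for s
        using K[of s] ab by (auto simp: indicator_def)
      then show "\<And>s. s \<in> space lborel \<Longrightarrow> norm (indicator {a<..b} s *\<^sub>R U s) \<le> indicator {a<..b} s * \<bar>K\<bar>" by auto
      have "integrable lborel (\<lambda>s. indicator {a<..b} s *\<^sub>R U s)"
        by (rule Bochner_Integration.integrable_bound[OF \<open>integrable lborel (\<lambda>s. indicator {a<..b} s * \<bar>K\<bar>)\<close>])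
           (use \<open>\<And>s. norm (indicator {a<..b} s *\<^sub>R U s) \<le> indicator {a<..b} s * \<bar>K\<bar>\<close> in auto)
      then show "integrable lborel (\<lambda>s. norm (indicator {a<..b} s *\<^sub>R U s))" by (rule integrable_norm)
    qed
    also have "\<dots> = \<bar>K\<bar> * (b - a)" using ab by simp
    finally show ?thesis .
  qed
  have "\<bar>K\<bar>-lipschitz_on {0..t} X"
  proof (rule lipschitz_onI)
    fix x y assume "x \<in> {0..t}" "y \<in> {0..t}"
    then show "dist (X x) (X y) \<le> \<bar>K\<bar> * dist x y"
      using *[of x y] *[of y x] by (cases "x \<le> y") (auto simp: dist_norm norm_minus_commute)
  qed simp
  then show ?thesis by (rule lipschitz_on_continuous_on)
qed

text \<open>Riemann sums over the grid: in a cell carrying at most one point of \<open>\<nu>\<close> the jump part of the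
  increment of \<open>\<Psi>\<close> is exactly an integral against \<open>\<nu>\<close>, and the drift part is handled by the mean
  value theorem, so only dominated convergence is needed.\<close>

lemma ito_finite_part:
  fixes \<nu> :: "'e::topological_space measure" and \<tau> :: "'e \<Rightarrow> real"
    and \<beta> :: "'e \<Rightarrow> 'z::euclidean_space" and U X :: "real \<Rightarrow> 'x::euclidean_space"
    and \<Psi> :: "'x \<times> 'z \<Rightarrow> real" and D :: "'x \<times> 'z \<Rightarrow> 'x \<times> 'z \<Rightarrow> real"
    and V Vm :: "real \<Rightarrow> 'z"
  assumes t: "0 < t"
    and D: "\<And>p. (\<Psi> has_derivative D p) (at p)" and Dc: "\<And>h. continuous_on UNIV (\<lambda>p. D p h)"
    and DL: "\<And>p h. \<bar>D p h\<bar> \<le> L * norm h" and \<Psi>C: "\<And>p. \<bar>\<Psi> p\<bar> \<le> C"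
    and sets: "sets \<nu> = sets borel" and \<tau>[measurable]: "\<tau> \<in> borel_measurable borel"
    and B[measurable]: "B \<in> sets borel" and fin: "emeasure \<nu> B < \<infinity>" and \<beta>: "integrable \<nu> \<beta>"
    and one: "\<exists>\<^sub>F m in sequentially. \<forall>k<Suc m.
        one_point \<nu> (B \<inter> {e. gridpt t m k < \<tau> e \<and> \<tau> e \<le> gridpt t m (Suc k)})"
    and U[measurable]: "U \<in> borel_measurable borel" and UK: "\<And>s. s \<in> {0<..t} \<Longrightarrow> norm (U s) \<le> K"
    and X: "\<And>a b. 0 \<le> a \<Longrightarrow> a \<le> b \<Longrightarrow> b \<le> t \<Longrightarrow> X b - X a = (\<integral>s. indicator {a<..b} s *\<^sub>R U s \<partial>lborel)"
    and V: "\<And>u. V u = z0 + (\<integral>e. indicator {0<..u} (\<tau> e) *\<^sub>R (indicator B e *\<^sub>R \<beta> e) \<partial>\<nu>)"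
    and Vm: "\<And>u. Vm u = z0 + (\<integral>e. indicator {0<..<u} (\<tau> e) *\<^sub>R (indicator B e *\<^sub>R \<beta> e) \<partial>\<nu>)"
  shows "\<Psi> (X t, V t) - \<Psi> (X 0, V 0) =
      (\<integral>s. indicator {0<..t} s *\<^sub>R D (X s, V s) (U s, 0) \<partial>lborel) +
      (\<integral>e. indicator {0<..t} (\<tau> e) *\<^sub>R (indicator B e *
          (\<Psi> (X (\<tau> e), Vm (\<tau> e) + \<beta> e) - \<Psi> (X (\<tau> e), Vm (\<tau> e)))) \<partial>\<nu>)" (is ?ito)
    and "(\<lambda>s. indicator {0<..t} s *\<^sub>R D (X s, V s) (U s, 0)) \<in> borel_measurable lborel" (is ?m1)
    and "(\<lambda>e. indicator {0<..t} (\<tau> e) *\<^sub>R (indicator B e *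
          (\<Psi> (X (\<tau> e), Vm (\<tau> e) + \<beta> e) - \<Psi> (X (\<tau> e), Vm (\<tau> e))))) \<in> borel_measurable \<nu>" (is ?m2)
proof -
  note [measurable_cong] = sets
  have \<beta>m[measurable]: "\<beta> \<in> borel_measurable \<nu>" using \<beta> by auto
  have B\<nu>: "B \<in> sets \<nu>" using B sets by simp
  have \<beta>B: "integrable \<nu> (\<lambda>e. indicator B e *\<^sub>R \<beta> e)"
    using integrable_mult_indicator[OF B\<nu> \<beta>] .
  have \<Psi>c: "continuous_on UNIV \<Psi>"
    using D by (intro continuous_at_imp_continuous_on ballI) (rule has_derivative_continuous)
  then have \<Psi>m[measurable]: "\<Psi> \<in> borel_measurable borel" by (rule borel_measurable_continuous_onI)
  have Xc: "continuous_on {0..t} X" by (rule continuous_on_indefinite_integral[OF U UK X])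
  let ?g = "gridpt t"
  \<comment> \<open>Each cell is traversed in two moves: the jump with X frozen at the left
    endpoint, then the drift with V already at its value at the right endpoint. \<open>q m k\<close>
    is the corner between the moves and \<open>h m k\<close> the displacement of the second.\<close>
  define q where "q m k = (X (?g m k), V (?g m (Suc k)))" for m k
  define h where "h m k = (X (?g m (Suc k)) - X (?g m k), 0::'z)" for m k
  have "\<exists>\<theta>. \<theta> \<in> {0..1} \<and> \<Psi> (q m k + h m k) - \<Psi> (q m k) = D (q m k + \<theta> *\<^sub>R h m k) (h m k)" for m k
    using mvt_segment[OF D] by blast
  then obtain \<theta> where \<theta>: "\<And>m k. \<theta> m k \<in> {0..1}"
    "\<And>m k. \<Psi> (q m k + h m k) - \<Psi> (q m k) = D (q m k + \<theta> m k *\<^sub>R h m k) (h m k)" by metis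
  define P where "P m k = q m k + \<theta> m k *\<^sub>R h m k" for m k
  define G where "G m s = (\<Sum>k<Suc m. indicator {?g m k<..?g m (Suc k)} s *\<^sub>R D (P m k) (U s, 0))" for m s
  define J where "J m e = (\<Sum>k<Suc m. indicator {?g m k<..?g m (Suc k)} (\<tau> e) *\<^sub>R
       (indicator B e * (\<Psi> (X (?g m k), V (?g m k) + \<beta> e) - \<Psi> (X (?g m k), V (?g m k)))))" for m e
  have G: "G m s = indicator {0<..t} s *\<^sub>R D (P m (cell t m s)) (U s, 0)" for m s
    unfolding G_def by (rule sum_cells[OF t])
  have J: "J m e = indicator {0<..t} (\<tau> e) *\<^sub>R (indicator B e *
       (\<Psi> (X (?g m (cell t m (\<tau> e))), V (?g m (cell t m (\<tau> e))) + \<beta> e)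
        - \<Psi> (X (?g m (cell t m (\<tau> e))), V (?g m (cell t m (\<tau> e))))))" for m e
    unfolding J_def by (rule sum_cells[OF t])
  have Dlin: "bounded_linear (\<lambda>u. D p (u, 0))" for p
    by (rule bounded_linear_compose[OF has_derivative_bounded_linear[OF D]])
       (rule bounded_linear_Pair[OF bounded_linear_ident bounded_linear_zero])
  have [measurable]: "(\<lambda>u. D p (u, 0)) \<in> borel_measurable borel" for p
    using Dlin by (rule borel_measurable_continuous_onI[OF linear_continuous_on])
  have Dm: "(\<lambda>s. D p (U s, 0)) \<in> borel_measurable borel" for p
    by measurable
  note [measurable] = Dm
  have Gm[measurable]: "G m \<in> borel_measurable borel" for m unfolding G_def by measurable
  have Jm[measurable]: "J m \<in> borel_measurable \<nu>" for m unfolding J_def by measurable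
  have K0: "integrable lborel (\<lambda>s. indicator {0<..t} s * (\<bar>L\<bar> * \<bar>K\<bar>))"
    using t by (intro integrable_mult_left integrable_real_indicator) auto
  have Dbd: "\<bar>D p (U s, 0)\<bar> \<le> \<bar>L\<bar> * \<bar>K\<bar>" if "s \<in> {0<..t}" for p s
  proof -
    have "\<bar>D p (U s, 0)\<bar> \<le> L * norm (U s)" using DL[of p "(U s, 0)"] by (simp add: norm_Pair)
    also have "\<dots> \<le> \<bar>L\<bar> * \<bar>K\<bar>" using UK[OF that] by (intro mult_mono) auto
    finally show ?thesis .
  qed
  have U_int: "integrable lborel (\<lambda>s. indicator {a<..b} s *\<^sub>R U s)" if "0 \<le> a" "b \<le> t" for a b
  proof (rule Bochner_Integration.integrable_bound)
    show "integrable lborel (\<lambda>s. indicator {0<..t} s * K)"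
      using t by (intro integrable_mult_left integrable_real_indicator) auto
    have "norm (indicator {a<..b} s *\<^sub>R U s) \<le> norm (indicator {0<..t} s * K)" for s
      using UK[of s] that by (auto simp: indicator_def)
    then show "AE s in lborel. norm (indicator {a<..b} s *\<^sub>R U s) \<le> norm (indicator {0<..t} s * K)" by auto
  qed simp
  have gb: "0 \<le> ?g m k" "?g m k \<le> ?g m (Suc k)" "?g m (Suc k) \<le> t" "?g m k \<le> t" if "k < Suc m" for m k
    using t that by (auto intro!: gridpt_nonneg gridpt_mono gridpt_le)
  \<comment> \<open>The mean value point \<open>P m k\<close> depends on the cell and not on s. The
    derivative there is one bounded linear map per cell and can be moved inside the integral that
    represents the increment of X.\<close>
  have drift: "\<Psi> (X (?g m (Suc k)), V (?g m (Suc k))) - \<Psi> (X (?g m k), V (?g m (Suc k)))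
      = (\<integral>s. indicator {?g m k<..?g m (Suc k)} s *\<^sub>R D (P m k) (U s, 0) \<partial>lborel)"
    if k: "k < Suc m" for m k
  proof -
    have "\<Psi> (X (?g m (Suc k)), V (?g m (Suc k))) - \<Psi> (X (?g m k), V (?g m (Suc k))) = D (P m k) (h m k)"
      using \<theta>(2)[of m k] by (simp add: P_def q_def h_def)
    also have "\<dots> = D (P m k) ((\<integral>s. indicator {?g m k<..?g m (Suc k)} s *\<^sub>R U s \<partial>lborel), 0)"
      using X gb[OF k] by (simp add: h_def)
    also have "\<dots> = (\<integral>s. D (P m k) (indicator {?g m k<..?g m (Suc k)} s *\<^sub>R U s, 0) \<partial>lborel)"
      by (rule integral_bounded_linear[OF Dlin, symmetric]) (use U_int gb[OF k] in auto)
    also have "\<dots> = (\<integral>s. indicator {?g m k<..?g m (Suc k)} s *\<^sub>R D (P m k) (U s, 0) \<partial>lborel)"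
      using linear_cmul[OF bounded_linear.linear[OF Dlin[of "P m k"]]] by simp
    finally show ?thesis .
  qed
  have Vinc: "V b = V a + (\<integral>e. indicator (B \<inter> {e. a < \<tau> e \<and> \<tau> e \<le> b}) e *\<^sub>R \<beta> e \<partial>\<nu>)"
    if "0 \<le> a" "a \<le> b" for a b
  proof -
    have i: "integrable \<nu> (\<lambda>e. indicator {u<..v} (\<tau> e) *\<^sub>R (indicator B e *\<^sub>R \<beta> e))" for u v
      by (rule Bochner_Integration.integrable_bound[OF \<beta>]) (auto simp: indicator_def)
    have "V b = z0 + (\<integral>e. indicator {0<..a} (\<tau> e) *\<^sub>R (indicator B e *\<^sub>R \<beta> e)
        + indicator {a<..b} (\<tau> e) *\<^sub>R (indicator B e *\<^sub>R \<beta> e) \<partial>\<nu>)"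
      unfolding V using that by (intro arg_cong2[of _ _ _ _ "(+)"] Bochner_Integration.integral_cong) (auto simp: indicator_def)
    also have "\<dots> = V a + (\<integral>e. indicator {a<..b} (\<tau> e) *\<^sub>R (indicator B e *\<^sub>R \<beta> e) \<partial>\<nu>)"
      unfolding V using i by simp
    also have "(\<integral>e. indicator {a<..b} (\<tau> e) *\<^sub>R (indicator B e *\<^sub>R \<beta> e) \<partial>\<nu>)
        = (\<integral>e. indicator (B \<inter> {e. a < \<tau> e \<and> \<tau> e \<le> b}) e *\<^sub>R \<beta> e \<partial>\<nu>)"
      by (intro Bochner_Integration.integral_cong) (auto simp: indicator_def)
    finally show ?thesis .
  qed
  have jump: "\<Psi> (X (?g m k), V (?g m (Suc k))) - \<Psi> (X (?g m k), V (?g m k))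
      = (\<integral>e. indicator {?g m k<..?g m (Suc k)} (\<tau> e) *\<^sub>R
       (indicator B e * (\<Psi> (X (?g m k), V (?g m k) + \<beta> e) - \<Psi> (X (?g m k), V (?g m k)))) \<partial>\<nu>)"
    if k: "k < Suc m" and o: "one_point \<nu> (B \<inter> {e. ?g m k < \<tau> e \<and> \<tau> e \<le> ?g m (Suc k)})" for m k
  proof -
    let ?S = "B \<inter> {e. ?g m k < \<tau> e \<and> \<tau> e \<le> ?g m (Suc k)}"
    \<comment> \<open>With the base point frozen at the left endpoint the increment is a function of
      the jump alone and vanishes at 0, as \<open>one_point_integral\<close> requires.\<close>
    define \<phi> where "\<phi> b = \<Psi> (X (?g m k), V (?g m k) + b) - \<Psi> (X (?g m k), V (?g m k))" for b
    have "\<phi> (\<integral>e. indicator ?S e *\<^sub>R \<beta> e \<partial>\<nu>) = (\<integral>e. indicator ?S e * \<phi> (\<beta> e) \<partial>\<nu>)"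
      by (rule one_point_integral[OF o, symmetric]) (auto simp: \<phi>_def[abs_def] sets)
    moreover have "\<phi> (\<integral>e. indicator ?S e *\<^sub>R \<beta> e \<partial>\<nu>)
       = \<Psi> (X (?g m k), V (?g m (Suc k))) - \<Psi> (X (?g m k), V (?g m k))"
      unfolding \<phi>_def using Vinc[OF gb(1,2)[OF k]] by simp
    moreover have "(\<integral>e. indicator ?S e * \<phi> (\<beta> e) \<partial>\<nu>) = (\<integral>e. indicator {?g m k<..?g m (Suc k)} (\<tau> e) *\<^sub>R
       (indicator B e * (\<Psi> (X (?g m k), V (?g m k) + \<beta> e) - \<Psi> (X (?g m k), V (?g m k)))) \<partial>\<nu>)"
      by (intro Bochner_Integration.integral_cong) (auto simp: indicator_def \<phi>_def)
    ultimately show ?thesis by simp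
  qed
  have int_G: "integrable lborel (\<lambda>s. indicator {?g m k<..?g m (Suc k)} s *\<^sub>R D (P m k) (U s, 0))"
    if "k < Suc m" for m k
    by (rule Bochner_Integration.integrable_bound[OF K0])
       (use Dbd gb[OF that] in \<open>auto intro!: AE_I2 simp: indicator_def abs_mult\<close>)
  have C0: "0 \<le> C" using \<Psi>C[of undefined] by linarith
  \<comment> \<open>Dominates the jump terms: each is at most \<open>2 * C\<close> and lives on B,
    which has finite mass.\<close>
  have iB: "integrable \<nu> (\<lambda>e. indicator B e * (2 * C))"
    using fin B\<nu> by (intro integrable_real_mult_indicator integrable_mult_left) auto
  have \<Psi>2: "\<bar>\<Psi> p - \<Psi> p'\<bar> \<le> 2 * C" for p p' using \<Psi>C[of p] \<Psi>C[of p'] by linarith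
  have int_J: "integrable \<nu> (\<lambda>e. indicator {?g m k<..?g m (Suc k)} (\<tau> e) *\<^sub>R
       (indicator B e * (\<Psi> (X (?g m k), V (?g m k) + \<beta> e) - \<Psi> (X (?g m k), V (?g m k)))))" for m k
    by (rule Bochner_Integration.integrable_bound[OF iB])
       (use \<Psi>2 C0 in \<open>auto intro!: AE_I2 simp: indicator_def abs_mult\<close>)
  have good: "(\<integral>s. G m s \<partial>lborel) + (\<integral>e. J m e \<partial>\<nu>) = \<Psi> (X t, V t) - \<Psi> (X 0, V 0)"
    if o: "\<forall>k<Suc m. one_point \<nu> (B \<inter> {e. ?g m k < \<tau> e \<and> \<tau> e \<le> ?g m (Suc k)})" for m
  proof -
    have "\<Psi> (X t, V t) - \<Psi> (X 0, V 0) = (\<Sum>k<Suc m. \<Psi> (X (?g m (Suc k)), V (?g m (Suc k))) - \<Psi> (X (?g m k), V (?g m k)))"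
      using sum_lessThan_telescope[of "\<lambda>k. \<Psi> (X (?g m k), V (?g m k))" "Suc m"] by simp
    also have "\<dots> = (\<Sum>k<Suc m. (\<Psi> (X (?g m (Suc k)), V (?g m (Suc k))) - \<Psi> (X (?g m k), V (?g m (Suc k))))
          + (\<Psi> (X (?g m k), V (?g m (Suc k))) - \<Psi> (X (?g m k), V (?g m k))))"
      by simp
    also have "\<dots> = (\<Sum>k<Suc m. (\<integral>s. indicator {?g m k<..?g m (Suc k)} s *\<^sub>R D (P m k) (U s, 0) \<partial>lborel) +
        (\<integral>e. indicator {?g m k<..?g m (Suc k)} (\<tau> e) *\<^sub>R
       (indicator B e * (\<Psi> (X (?g m k), V (?g m k) + \<beta> e) - \<Psi> (X (?g m k), V (?g m k)))) \<partial>\<nu>))"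
      using drift jump o by (intro sum.cong refl) auto
    also have "\<dots> = (\<integral>s. G m s \<partial>lborel) + (\<integral>e. J m e \<partial>\<nu>)"
      unfolding G_def J_def using int_G int_J by (subst (1 2) Bochner_Integration.integral_sum) (auto simp: sum.distrib)
    finally show ?thesis by simp
  qed
  have Vr: "(\<lambda>m. V (a m)) \<longlonglongrightarrow> V s" if "a \<longlonglongrightarrow> s" "\<And>m. s \<le> a m" for a s
    unfolding V by (intro tendsto_add tendsto_const cumulative_tendsto_right[OF _ \<beta>B] that) measurable
  have Vl: "(\<lambda>m. V (a m)) \<longlonglongrightarrow> Vm s" if "a \<longlonglongrightarrow> s" "\<And>m. a m < s" for a s
    unfolding V Vm by (intro tendsto_add tendsto_const cumulative_tendsto_left[OF _ \<beta>B] that) measurable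
  have Xlim: "(\<lambda>m. X (?g m (cell t m s))) \<longlonglongrightarrow> X s" "(\<lambda>m. X (?g m (Suc (cell t m s)))) \<longlonglongrightarrow> X s"
    if "s \<in> {0<..t}" for s
    using that t gb[OF cell_bounds(1)[of s t]] gridpt_nonneg[of t]
    by (auto intro!: continuous_on_tendsto_compose[OF Xc] gridpt_cell_tendsto always_eventually)
  \<comment> \<open>The drift samples V at right endpoints and therefore converges with
    \<open>V s\<close>; the jump part below samples it at left endpoints and converges with
    \<open>Vm\<close>.\<close>
  have G_lim: "(\<lambda>m. G m s) \<longlonglongrightarrow> indicator {0<..t} s *\<^sub>R D (X s, V s) (U s, 0)" for s
  proof (cases "s \<in> {0<..t}")
    case True
    have h0: "(\<lambda>m. h m (cell t m s)) \<longlonglongrightarrow> 0"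
      unfolding h_def using tendsto_Pair[OF tendsto_diff[OF Xlim(2,1)[OF True]] tendsto_const[of 0]]
      by (simp add: zero_prod_def)
    have "(\<lambda>m. \<theta> m (cell t m s) *\<^sub>R h m (cell t m s)) \<longlonglongrightarrow> 0"
      by (rule tendsto_0_le[OF h0, of _ 1]) (use \<theta>(1) in \<open>auto intro!: always_eventually mult_left_le_one_le\<close>)
    moreover have "(\<lambda>m. q m (cell t m s)) \<longlonglongrightarrow> (X s, V s)"
      unfolding q_def
      by (intro tendsto_Pair Xlim(1)[OF True] Vr gridpt_cell_tendsto cell_bounds) (use True in auto)
    ultimately have "(\<lambda>m. P m (cell t m s)) \<longlonglongrightarrow> (X s, V s)"
      unfolding P_def using tendsto_add[of "\<lambda>m. q m (cell t m s)" "(X s, V s)"] by fastforce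
    then have "(\<lambda>m. D (P m (cell t m s)) (U s, 0)) \<longlonglongrightarrow> D (X s, V s) (U s, 0)"
      by (intro continuous_on_tendsto_compose[OF Dc]) auto
    then show ?thesis unfolding G by (intro tendsto_scaleR tendsto_const)
  qed (simp add: G)
  have J_lim: "(\<lambda>m. J m e) \<longlonglongrightarrow> indicator {0<..t} (\<tau> e) *\<^sub>R (indicator B e *
          (\<Psi> (X (\<tau> e), Vm (\<tau> e) + \<beta> e) - \<Psi> (X (\<tau> e), Vm (\<tau> e))))" for e
  proof (cases "\<tau> e \<in> {0<..t}")
    case True
    show ?thesis unfolding J
      by (intro tendsto_scaleR tendsto_mult tendsto_diff tendsto_const continuous_on_tendsto_compose[OF \<Psi>c]
          tendsto_Pair Xlim(1)[OF True] tendsto_add Vl gridpt_cell_tendsto cell_bounds) (use True in auto)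
  qed (simp add: J)
  show m1: ?m1
    by (rule borel_measurable_LIMSEQ_real[OF G_lim]) simp
  show m2: ?m2
    by (rule borel_measurable_LIMSEQ_real[OF J_lim]) simp
  have "(\<lambda>m. \<integral>s. G m s \<partial>lborel) \<longlonglongrightarrow> (\<integral>s. indicator {0<..t} s *\<^sub>R D (X s, V s) (U s, 0) \<partial>lborel)"
  proof (rule integral_dominated_convergence[OF m1 _ K0])
    show "AE s in lborel. norm (G m s) \<le> indicator {0<..t} s * (\<bar>L\<bar> * \<bar>K\<bar>)" for m
      unfolding G using Dbd by (intro AE_I2) (auto simp: indicator_def)
  qed (use G_lim in auto)
  moreover have "(\<lambda>m. \<integral>e. J m e \<partial>\<nu>) \<longlonglongrightarrow> (\<integral>e. indicator {0<..t} (\<tau> e) *\<^sub>R (indicator B e *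
          (\<Psi> (X (\<tau> e), Vm (\<tau> e) + \<beta> e) - \<Psi> (X (\<tau> e), Vm (\<tau> e)))) \<partial>\<nu>)"
  proof (rule integral_dominated_convergence[OF m2 _ iB])
    show "AE e in \<nu>. norm (J m e) \<le> indicator B e * (2 * C)" for m
      unfolding J using \<Psi>2 C0 by (intro AE_I2) (auto simp: indicator_def)
  qed (use J_lim in auto)
  ultimately have "(\<lambda>m. (\<integral>s. G m s \<partial>lborel) + (\<integral>e. J m e \<partial>\<nu>)) \<longlonglongrightarrow>
      (\<integral>s. indicator {0<..t} s *\<^sub>R D (X s, V s) (U s, 0) \<partial>lborel) +
      (\<integral>e. indicator {0<..t} (\<tau> e) *\<^sub>R (indicator B e *
          (\<Psi> (X (\<tau> e), Vm (\<tau> e) + \<beta> e) - \<Psi> (X (\<tau> e), Vm (\<tau> e)))) \<partial>\<nu>)"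
    by (rule tendsto_add)
  \<comment> \<open>The increment of \<Psi> is independent of m and equals the Riemann sum for
    infinitely many m.\<close>
  then show ?ito
    by (rule frequently_eq_limit) (rule frequently_elim1[OF one], rule good)
qed

text \<open>Removes the truncation to sets of finite mass. The bound \<open>2 * C\<close> on a jump
  of \<Psi> need not be integrable over the whole mark space; there the Lipschitz bound
  \<open>\<bar>L\<bar> * norm (\<beta> e)\<close> takes over, which is integrable because \<beta>
  is.\<close>

lemma pathwise_ito:
  fixes \<nu> :: "'e::topological_space measure" and \<tau> :: "'e \<Rightarrow> real"
    and \<beta> :: "'e \<Rightarrow> 'z::euclidean_space" and U X :: "real \<Rightarrow> 'x::euclidean_space"
    and \<Psi> :: "'x \<times> 'z \<Rightarrow> real" and D :: "'x \<times> 'z \<Rightarrow> 'x \<times> 'z \<Rightarrow> real"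
    and V Vm :: "real \<Rightarrow> 'z" and A :: "nat \<Rightarrow> 'e set"
  assumes t: "0 < t"
    and D: "\<And>p. (\<Psi> has_derivative D p) (at p)" and Dc: "\<And>h. continuous_on UNIV (\<lambda>p. D p h)"
    and DL: "\<And>p h. \<bar>D p h\<bar> \<le> L * norm h" and \<Psi>C: "\<And>p. \<bar>\<Psi> p\<bar> \<le> C"
    and \<Psi>L: "\<And>p p'. \<bar>\<Psi> p - \<Psi> p'\<bar> \<le> L * norm (p - p')"
    and sets: "sets \<nu> = sets borel" and \<tau>[measurable]: "\<tau> \<in> borel_measurable borel"
    and \<beta>: "integrable \<nu> \<beta>"
    and A: "\<And>n. A n \<in> sets borel" "incseq A" "(\<Union>n. A n) = UNIV" "\<And>n. emeasure \<nu> (A n) < \<infinity>"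
    and one: "\<And>n. \<exists>\<^sub>F m in sequentially. \<forall>k<Suc m.
        one_point \<nu> (A n \<inter> {e. gridpt t m k < \<tau> e \<and> \<tau> e \<le> gridpt t m (Suc k)})"
    and U[measurable]: "U \<in> borel_measurable borel" and UK: "\<And>s. s \<in> {0<..t} \<Longrightarrow> norm (U s) \<le> K"
    and X: "\<And>a b. 0 \<le> a \<Longrightarrow> a \<le> b \<Longrightarrow> b \<le> t \<Longrightarrow> X b - X a = (\<integral>s. indicator {a<..b} s *\<^sub>R U s \<partial>lborel)"
    and V: "\<And>u. V u = z0 + (\<integral>e. indicator {0<..u} (\<tau> e) *\<^sub>R \<beta> e \<partial>\<nu>)"
    and Vm: "\<And>u. Vm u = z0 + (\<integral>e. indicator {0<..<u} (\<tau> e) *\<^sub>R \<beta> e \<partial>\<nu>)"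
  shows "\<Psi> (X t, V t) - \<Psi> (X 0, V 0) =
      (\<integral>s. indicator {0<..t} s *\<^sub>R D (X s, V s) (U s, 0) \<partial>lborel) +
      (\<integral>e. indicator {0<..t} (\<tau> e) *\<^sub>R
          (\<Psi> (X (\<tau> e), Vm (\<tau> e) + \<beta> e) - \<Psi> (X (\<tau> e), Vm (\<tau> e))) \<partial>\<nu>)"
proof -
  have \<beta>m[measurable]: "\<beta> \<in> borel_measurable \<nu>" using \<beta> by auto
  have A\<nu>[measurable]: "A n \<in> sets \<nu>" for n using A(1) sets by simp
  note [measurable_cong] = sets
  \<comment> \<open>Only V loses its jumps outside \<open>A n\<close>; X and its velocity U remain
    those of the full path. The formula for the finite part allows this, as it does not tie U to
    V.\<close>
  define W where "W n u = z0 + (\<integral>e. indicator {0<..u} (\<tau> e) *\<^sub>R (indicator (A n) e *\<^sub>R \<beta> e) \<partial>\<nu>)" for n u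
  define Wm where "Wm n u = z0 + (\<integral>e. indicator {0<..<u} (\<tau> e) *\<^sub>R (indicator (A n) e *\<^sub>R \<beta> e) \<partial>\<nu>)" for n u
  note ito = ito_finite_part[OF t D Dc DL \<Psi>C sets \<tau> A(1) A(4) \<beta> one U UK X W_def Wm_def]
  have A_lim: "(\<lambda>n. indicator (A n) e :: real) \<longlonglongrightarrow> 1" for e
  proof -
    obtain n where n: "e \<in> A n" using A(3) by blast
    have "\<forall>\<^sub>F k in sequentially. indicator (A k) e = (1::real)"
      using eventually_ge_at_top[of n] by eventually_elim (use n A(2) in \<open>auto simp: incseq_def indicator_def\<close>)
    then show ?thesis by (rule tendsto_eventually)
  qed
  have W: "(\<lambda>n. W n u) \<longlonglongrightarrow> V u" and Wm: "(\<lambda>n. Wm n u) \<longlonglongrightarrow> Vm u" for u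
  proof -
    have *: "(\<lambda>n. \<integral>e. indicator S (\<tau> e) *\<^sub>R (indicator (A n) e *\<^sub>R \<beta> e) \<partial>\<nu>)
        \<longlonglongrightarrow> (\<integral>e. indicator S (\<tau> e) *\<^sub>R \<beta> e \<partial>\<nu>)" if [measurable]: "S \<in> sets borel" for S
    proof (rule integral_dominated_convergence[where w="\<lambda>e. norm (\<beta> e)"])
      show "AE e in \<nu>. (\<lambda>n. indicator S (\<tau> e) *\<^sub>R (indicator (A n) e *\<^sub>R \<beta> e)) \<longlonglongrightarrow> indicator S (\<tau> e) *\<^sub>R \<beta> e"
        using tendsto_scaleR[OF tendsto_const tendsto_scaleR[OF A_lim tendsto_const]] by (intro AE_I2) fastforce
    qed (use \<beta> in \<open>auto simp: indicator_def\<close>)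
    show "(\<lambda>n. W n u) \<longlonglongrightarrow> V u" "(\<lambda>n. Wm n u) \<longlonglongrightarrow> Vm u"
      unfolding W_def Wm_def V Vm by (intro tendsto_add tendsto_const *; simp)+
  qed
  have \<Psi>c: "continuous_on UNIV \<Psi>"
    using D by (intro continuous_at_imp_continuous_on ballI) (rule has_derivative_continuous)
  have \<Psi>lim: "(\<lambda>n. \<Psi> (x, w n)) \<longlonglongrightarrow> \<Psi> (x, v)" if "w \<longlonglongrightarrow> v" for x w v
    using that by (intro continuous_on_tendsto_compose[OF \<Psi>c] tendsto_Pair tendsto_const) auto
  have lhs: "(\<lambda>n. \<Psi> (X t, W n t) - \<Psi> (X 0, W n 0)) \<longlonglongrightarrow> \<Psi> (X t, V t) - \<Psi> (X 0, V 0)"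
    by (intro tendsto_diff \<Psi>lim W)
  have l1: "(\<lambda>n. indicator {0<..t} s *\<^sub>R D (X s, W n s) (U s, 0)) \<longlonglongrightarrow> indicator {0<..t} s *\<^sub>R D (X s, V s) (U s, 0)" for s
    by (intro tendsto_scaleR tendsto_const continuous_on_tendsto_compose[OF Dc] tendsto_Pair W) auto
  have l2: "(\<lambda>n. indicator {0<..t} (\<tau> e) *\<^sub>R (indicator (A n) e *
          (\<Psi> (X (\<tau> e), Wm n (\<tau> e) + \<beta> e) - \<Psi> (X (\<tau> e), Wm n (\<tau> e)))))
      \<longlonglongrightarrow> indicator {0<..t} (\<tau> e) *\<^sub>R (1 * (\<Psi> (X (\<tau> e), Vm (\<tau> e) + \<beta> e) - \<Psi> (X (\<tau> e), Vm (\<tau> e))))" for e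
    by (intro tendsto_scaleR tendsto_const tendsto_mult tendsto_diff \<Psi>lim tendsto_add Wm A_lim)
  have K0: "integrable lborel (\<lambda>s. indicator {0<..t} s * (\<bar>L\<bar> * \<bar>K\<bar>))"
    using t by (intro integrable_mult_left integrable_real_indicator) auto
  have Dbd: "\<bar>D p (U s, 0)\<bar> \<le> \<bar>L\<bar> * \<bar>K\<bar>" if "s \<in> {0<..t}" for p s
  proof -
    have "\<bar>D p (U s, 0)\<bar> \<le> L * norm (U s)" using DL[of p "(U s, 0)"] by (simp add: norm_Pair)
    also have "\<dots> \<le> \<bar>L\<bar> * \<bar>K\<bar>" using UK[OF that] by (intro mult_mono) auto
    finally show ?thesis .
  qed
  have jb: "\<bar>\<Psi> (x, w + b) - \<Psi> (x, w)\<bar> \<le> \<bar>L\<bar> * norm b" for x w b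
  proof -
    have "\<bar>\<Psi> (x, w + b) - \<Psi> (x, w)\<bar> \<le> L * norm b" using \<Psi>L[of "(x, w + b)" "(x, w)"] by (simp add: norm_Pair)
    also have "\<dots> \<le> \<bar>L\<bar> * norm b" by (intro mult_right_mono) auto
    finally show ?thesis .
  qed
  have i1: "(\<lambda>n. \<integral>s. indicator {0<..t} s *\<^sub>R D (X s, W n s) (U s, 0) \<partial>lborel) \<longlonglongrightarrow>
      (\<integral>s. indicator {0<..t} s *\<^sub>R D (X s, V s) (U s, 0) \<partial>lborel)"
    by (rule integral_dominated_convergence[OF borel_measurable_LIMSEQ_real[OF l1] _ K0])
       (use l1 Dbd ito(2) in \<open>auto simp: indicator_def\<close>)
  have i2: "(\<lambda>n. \<integral>e. indicator {0<..t} (\<tau> e) *\<^sub>R (indicator (A n) e *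
          (\<Psi> (X (\<tau> e), Wm n (\<tau> e) + \<beta> e) - \<Psi> (X (\<tau> e), Wm n (\<tau> e)))) \<partial>\<nu>)
      \<longlonglongrightarrow> (\<integral>e. indicator {0<..t} (\<tau> e) *\<^sub>R (1 * (\<Psi> (X (\<tau> e), Vm (\<tau> e) + \<beta> e) - \<Psi> (X (\<tau> e), Vm (\<tau> e)))) \<partial>\<nu>)"
  proof (rule integral_dominated_convergence[where w="\<lambda>e. \<bar>L\<bar> * norm (\<beta> e)"])
    show "AE e in \<nu>. norm (indicator {0<..t} (\<tau> e) *\<^sub>R (indicator (A n) e *
          (\<Psi> (X (\<tau> e), Wm n (\<tau> e) + \<beta> e) - \<Psi> (X (\<tau> e), Wm n (\<tau> e))))) \<le> \<bar>L\<bar> * norm (\<beta> e)" for n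
      using jb by (intro AE_I2) (simp add: indicator_def)
    show "integrable \<nu> (\<lambda>e. \<bar>L\<bar> * norm (\<beta> e))" using \<beta> by simp
    show *: "(\<lambda>e. indicator {0<..t} (\<tau> e) *\<^sub>R (indicator (A n) e *
          (\<Psi> (X (\<tau> e), Wm n (\<tau> e) + \<beta> e) - \<Psi> (X (\<tau> e), Wm n (\<tau> e))))) \<in> borel_measurable \<nu>" for n
      by (rule ito(3))
    show "(\<lambda>e. indicator {0<..t} (\<tau> e) *\<^sub>R (1 * (\<Psi> (X (\<tau> e), Vm (\<tau> e) + \<beta> e) - \<Psi> (X (\<tau> e), Vm (\<tau> e)))))
        \<in> borel_measurable \<nu>"
      by (rule borel_measurable_LIMSEQ_real[OF l2 *])
  qed (use l2 in auto)
  have ito_n: "\<Psi> (X t, W n t) - \<Psi> (X 0, W n 0) = (\<integral>s. indicator {0<..t} s *\<^sub>R D (X s, W n s) (U s, 0) \<partial>lborel) +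
      (\<integral>e. indicator {0<..t} (\<tau> e) *\<^sub>R (indicator (A n) e *
          (\<Psi> (X (\<tau> e), Wm n (\<tau> e) + \<beta> e) - \<Psi> (X (\<tau> e), Wm n (\<tau> e)))) \<partial>\<nu>)" for n
    by (rule ito(1))
  have "(\<lambda>n. \<Psi> (X t, W n t) - \<Psi> (X 0, W n 0)) \<longlonglongrightarrow> (\<integral>s. indicator {0<..t} s *\<^sub>R D (X s, V s) (U s, 0) \<partial>lborel) +
      (\<integral>e. indicator {0<..t} (\<tau> e) *\<^sub>R (1 * (\<Psi> (X (\<tau> e), Vm (\<tau> e) + \<beta> e) - \<Psi> (X (\<tau> e), Vm (\<tau> e)))) \<partial>\<nu>)"
    using tendsto_add[OF i1 i2] by (simp only: ito_n)
  from LIMSEQ_unique[OF lhs this] show ?thesis by simp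
qed

section \<open>Poisson random measures\<close>

lemma sums_poisson_mean:
  fixes x :: real
  shows "(\<lambda>k. real k * (exp (- x) * x ^ k / fact k)) sums x"
proof -
  have "(\<lambda>k. exp (- x) * x * (x ^ k /\<^sub>R fact k)) sums (exp (- x) * x * exp x)"
    by (intro sums_mult exp_converges)
  then have "(\<lambda>k. real (Suc k) * (exp (- x) * x ^ Suc k / fact (Suc k))) sums x"
    by (simp add: field_simps exp_minus del: of_nat_Suc)
  then show ?thesis by (subst (asm) sums_Suc_iff) simp
qed

lemma sums_poisson_total:
  fixes x :: real
  shows "(\<lambda>k. exp (- x) * x ^ k / fact k) sums 1"
proof -
  have "(\<lambda>k. exp (- x) * (x ^ k /\<^sub>R fact k)) sums (exp (- x) * exp x)"
    by (intro sums_mult exp_converges)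
  then show ?thesis by (simp add: exp_minus field_simps)
qed

context prob_space
begin

text \<open>A count has values in [0,\<infinity>]; the Poisson weights sum to one, which leaves no
  probability for infinite or fractional values.\<close>

lemma AE_poisson_nat:
  assumes [measurable]: "Y \<in> borel_measurable M" and "0 \<le> l"
    and P: "\<And>k. prob {\<omega>\<in>space M. Y \<omega> = of_nat k} = exp (- l) * l ^ k / fact k"
  shows "AE \<omega> in M. \<exists>k. Y \<omega> = (of_nat k :: ennreal)"
proof -
  let ?S = "\<lambda>k::nat. {\<omega>\<in>space M. Y \<omega> = of_nat k}"
  have "(\<lambda>k. prob (?S k)) sums prob (\<Union>k. ?S k)"
    by (rule finite_measure_UNION) (auto simp: disjoint_family_on_def)
  then have "prob (\<Union>k. ?S k) = 1" unfolding P using sums_poisson_total[of l] sums_unique2 by blast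
  then have "AE \<omega> in M. \<omega> \<in> (\<Union>k. ?S k)" by (rule AE_prob_1)
  then show ?thesis by eventually_elim auto
qed

text \<open>Almost surely Y is the series of its levels weighted by their indicators, so
  independence of E from the level sets makes each term factor. With E in the past and Y the count
  of a later set, this is the compensation formula on a rectangle.\<close>

lemma nn_integral_poisson:
  assumes [measurable]: "Y \<in> borel_measurable M" and "0 \<le> l"
    and P: "\<And>k. prob {\<omega>\<in>space M. Y \<omega> = of_nat k} = exp (- l) * l ^ k / fact k"
    and E[measurable]: "E \<in> events"
    and PE: "\<And>k. prob (E \<inter> {\<omega>\<in>space M. Y \<omega> = of_nat k}) = prob E * prob {\<omega>\<in>space M. Y \<omega> = of_nat k}"
  shows "(\<integral>\<^sup>+\<omega>. indicator E \<omega> * Y \<omega> \<partial>M) = emeasure M E * ennreal l"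
proof -
  let ?S = "\<lambda>k::nat. E \<inter> {\<omega>\<in>space M. Y \<omega> = of_nat k}"
  have "(\<integral>\<^sup>+\<omega>. indicator E \<omega> * Y \<omega> \<partial>M) = (\<integral>\<^sup>+\<omega>. (\<Sum>k. of_nat k * indicator (?S k) \<omega>) \<partial>M)"
  proof (rule nn_integral_cong_AE)
    show "AE \<omega> in M. indicator E \<omega> * Y \<omega> = (\<Sum>k. of_nat k * indicator (?S k) \<omega>)"
      using AE_poisson_nat[OF assms(1-3)] AE_space
    proof eventually_elim
      case (elim \<omega>)
      then obtain j where j: "Y \<omega> = of_nat j" by blast
      have "(\<Sum>k. of_nat k * indicator (?S k) \<omega> :: ennreal) = (\<Sum>k\<in>{j}. of_nat k * indicator (?S k) \<omega>)"
        by (rule suminf_finite) (auto simp: j indicator_def)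
      then show ?case using j elim by (auto simp: indicator_def)
    qed
  qed
  also have "\<dots> = (\<Sum>k. of_nat k * emeasure M (?S k))"
    by (subst nn_integral_suminf) (auto simp: nn_integral_cmult_indicator)
  also have "\<dots> = (\<Sum>k. ennreal (prob E * (real k * (exp (- l) * l ^ k / fact k))))"
    using \<open>0 \<le> l\<close> PE P
    by (intro suminf_cong) (simp add: emeasure_eq_measure ennreal_of_nat_eq_real_of_nat ennreal_mult'[symmetric] mult_ac)
  also have "\<dots> = ennreal (prob E * l)"
    using \<open>0 \<le> l\<close> by (intro suminf_ennreal_eq sums_mult sums_poisson_mean) auto
  finally show ?thesis using \<open>0 \<le> l\<close> by (simp add: emeasure_eq_measure ennreal_mult)
qed

text \<open>The bound is quadratic because \<open>exp (- l) \<ge> 1 - l\<close> gives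
  \<open>1 - exp (- l) * (1 + l) \<le> 1 - (1 - l) * (1 + l)\<close>. Summed over the cells of a
  grid, whose intensities have a fixed sum, it becomes small together with the heaviest
  cell.\<close>

lemma prob_poisson_ge_2:
  assumes [measurable]: "Y \<in> borel_measurable M" and "0 \<le> l"
    and P: "\<And>k. prob {\<omega>\<in>space M. Y \<omega> = of_nat k} = exp (- l) * l ^ k / fact k"
  shows "prob {\<omega>\<in>space M. Y \<omega> \<noteq> (0::ennreal) \<and> Y \<omega> \<noteq> 1} \<le> l\<^sup>2"
proof -
  have "prob {\<omega>\<in>space M. Y \<omega> \<noteq> 0 \<and> Y \<omega> \<noteq> 1} = 1 - prob ({\<omega>\<in>space M. Y \<omega> = of_nat 0} \<union> {\<omega>\<in>space M. Y \<omega> = of_nat 1})"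
    by (subst prob_compl[symmetric]) (auto intro!: arg_cong[where f=prob])
  also have "\<dots> = 1 - (exp (- l) + exp (- l) * l)"
    by (subst finite_measure_Union) (simp_all add: P[of 0, simplified] P[of 1, simplified] disjoint_iff)
  also have "exp (- l) * (1 + l) \<ge> (1 - l) * (1 + l)"
    using exp_ge_add_one_self[of "- l"] \<open>0 \<le> l\<close> by (intro mult_right_mono) auto
  then have "1 - (exp (- l) + exp (- l) * l) \<le> l\<^sup>2"
    by (simp add: algebra_simps power2_eq_square)
  finally show ?thesis .
qed

end

section \<open>Point counts on fine time grids\<close>

lemma measurable_ev_time[measurable]: "ev_time \<in> borel_measurable borel"
  unfolding ev_time_def by (intro borel_measurable_continuous_onI continuous_intros)

text \<open>The intensity is left abstract. That it charges no fixed time makes the cells of a fine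
  grid uniformly light; the exhausting sets of finite mass serve as truncations wherever infinite
  masses would have to be subtracted.\<close>

locale poisson_setup =
  fixes M :: "'a measure" and F :: "real \<Rightarrow> 'a measure" and T :: real and \<mu> :: "ev measure"
    and N :: "'a \<Rightarrow> ev measure" and A :: "nat \<Rightarrow> ev set"
  assumes basis: "stochastic_basis M F T" and T: "0 < T"
    and prm: "poisson_random_measure M F T \<mu> N"
    and sets_\<mu>[measurable_cong]: "sets \<mu> = sets borel"
    and no_atoms: "\<And>s. emeasure \<mu> {e. ev_time e = s} = 0"
    and A: "\<And>n. A n \<in> sets borel" "incseq A" "(\<Union>n. A n) = UNIV" "\<And>n. emeasure \<mu> (A n) \<noteq> \<infinity>"
begin

sublocale prob_space M using basis by (simp add: stochastic_basis_def)

sublocale \<mu>: sigma_finite_measure \<mu>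
  using A sets_\<mu> sets_eq_imp_space_eq[OF sets_\<mu>] by unfold_locales (auto intro!: exI[of _ "range A"])

declare A(1)[measurable]

lemma F_sub: "t \<in> {0..T} \<Longrightarrow> sets (F t) \<subseteq> events" "t \<in> {0..T} \<Longrightarrow> space (F t) = space M"
  using basis by (auto simp: stochastic_basis_def subalgebra_def)

lemma F_mono: "0 \<le> s \<Longrightarrow> s \<le> t \<Longrightarrow> t \<le> T \<Longrightarrow> sets (F s) \<subseteq> sets (F t)"
  using basis by (auto simp: stochastic_basis_def)

lemma sets_N: "\<omega> \<in> space M \<Longrightarrow> sets (N \<omega>) = sets borel"
  using prm sets_\<mu> by (auto simp: poisson_random_measure_def)

lemma measurable_N: "B \<in> sets borel \<Longrightarrow> (\<lambda>\<omega>. emeasure (N \<omega>) B) \<in> borel_measurable M"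
  using prm sets_\<mu> by (auto simp: poisson_random_measure_def)

lemma prob_N:
  assumes "B \<in> sets borel" "emeasure \<mu> B < \<infinity>"
  shows "prob {\<omega>\<in>space M. emeasure (N \<omega>) B = of_nat k} =
    exp (- enn2real (emeasure \<mu> B)) * enn2real (emeasure \<mu> B) ^ k / fact k"
  using prm sets_\<mu> assms by (auto simp: poisson_random_measure_def)

lemma AE_N_nat:
  assumes "B \<in> sets borel" "emeasure \<mu> B < \<infinity>"
  shows "AE \<omega> in M. \<exists>k. emeasure (N \<omega>) B = of_nat k"
  by (rule AE_poisson_nat[OF measurable_N[OF assms(1)] _ prob_N[OF assms]]) simp

lemma AE_N_null:
  assumes "B \<in> sets borel" "emeasure \<mu> B = 0"
  shows "AE \<omega> in M. emeasure (N \<omega>) B = 0"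
proof -
  have "prob {\<omega>\<in>space M. emeasure (N \<omega>) B = 0} = 1"
    using prob_N[of B 0] assms by simp
  then have "AE \<omega> in M. \<omega> \<in> {\<omega>\<in>space M. emeasure (N \<omega>) B = 0}" by (rule AE_prob_1)
  then show ?thesis by eventually_elim simp
qed

text \<open>The two alternatives for E are the two kinds of rectangle: for the full space this is
  the mean of a Poisson variable, and for a past event it is the independence of later counts from
  the filtration.\<close>

lemma nn_integral_N:
  assumes B: "B \<in> sets borel" "emeasure \<mu> B < \<infinity>"
    and E: "E = space M \<or> (\<exists>a\<in>{0..T}. E \<in> sets (F a) \<and> B \<subseteq> {e. a < ev_time e})"
  shows "(\<integral>\<^sup>+\<omega>. indicator E \<omega> * emeasure (N \<omega>) B \<partial>M) = emeasure M E * emeasure \<mu> B"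
proof -
  have Ev: "E \<in> events" using E F_sub(1) by blast
  have ind: "prob (E \<inter> {\<omega>\<in>space M. emeasure (N \<omega>) B = of_nat k}) =
      prob E * prob {\<omega>\<in>space M. emeasure (N \<omega>) B = of_nat k}" for k
    using E
  proof
    assume "E = space M"
    then have "E \<inter> {\<omega>\<in>space M. emeasure (N \<omega>) B = of_nat k} = {\<omega>\<in>space M. emeasure (N \<omega>) B = of_nat k}"
      by auto
    then show ?thesis using \<open>E = space M\<close> by (simp add: prob_space)
  next
    assume "\<exists>a\<in>{0..T}. E \<in> sets (F a) \<and> B \<subseteq> {e. a < ev_time e}"
    then obtain a where a: "a \<in> {0..T}" "E \<in> sets (F a)" "B \<subseteq> {e. a < ev_time e}" by blast
    let ?G = "{{\<omega>\<in>space M. emeasure (N \<omega>) A \<in> B} | A B.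
            A \<in> sets \<mu> \<and> A \<subseteq> {e. a < ev_time e} \<and> B \<in> sets (borel :: ennreal measure)}"
    have i: "indep_set (sets (F a)) (sigma_sets (space M) ?G)"
      using prm a(1) by (auto simp: poisson_random_measure_def)
    have "{\<omega>\<in>space M. emeasure (N \<omega>) B \<in> {of_nat k}} \<in> ?G"
      using B(1) a(3) by (intro CollectI exI[of _ B] exI[of _ "{of_nat k}"] conjI refl) (simp_all add: sets_\<mu>)
    then have "{\<omega>\<in>space M. emeasure (N \<omega>) B = of_nat k} \<in> sigma_sets (space M) ?G"
      using sigma_sets.Basic by (simp only: singleton_iff)
    then show ?thesis by (rule indep_setD[OF i a(2)])
  qed
  have "ennreal (enn2real (emeasure \<mu> B)) = emeasure \<mu> B" using B(2) by simp
  then show ?thesis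
    using nn_integral_poisson[OF measurable_N[OF B(1)] _ prob_N[OF B] Ev ind] by simp
qed

text \<open>Since the intensity has no atoms in time, the probability that some cell of a fine grid
  carries two points of a set of finite intensity is at most the maximal cell intensity times the
  total intensity.\<close>

lemma AE_frequently_simple:
  assumes B[measurable]: "B \<in> sets borel" and fin: "emeasure \<mu> B < \<infinity>" and t: "0 < t"
  shows "AE \<omega> in M. \<exists>\<^sub>F m in sequentially. \<forall>k<Suc m.
     emeasure (N \<omega>) (B \<inter> {e. gridpt t m k < ev_time e \<and> ev_time e \<le> gridpt t m (Suc k)}) \<in> {0, 1}"
proof -
  let ?S = "\<lambda>m k. B \<inter> {e. gridpt t m k < ev_time e \<and> ev_time e \<le> gridpt t m (Suc k)}"
  have S[measurable]: "?S m k \<in> sets borel" for m k by measurable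
  have finS: "emeasure \<mu> (?S m k) < \<infinity>" for m k
    using B by (intro le_less_trans[OF emeasure_mono[where b=B] fin]) (simp_all add: sets_\<mu>)
  \<comment> \<open>Time marginal of the intensity restricted to B. It has no atoms, so its
    distribution function is continuous and hence uniformly continuous on [0,t], which makes all
    cells of a fine grid light at once.\<close>
  define \<rho> where "\<rho> = distr (density \<mu> (indicator B)) borel ev_time"
  have \<rho>: "emeasure \<rho> C = emeasure \<mu> (B \<inter> ev_time -` C)" if [measurable]: "C \<in> sets borel" for C
  proof -
    have C': "ev_time -` C \<in> sets \<mu>" using measurable_sets_borel[OF measurable_ev_time that] sets_\<mu> by simp
    have B': "B \<in> sets \<mu>" using B sets_\<mu> by simp
    have "emeasure \<rho> C = emeasure (density \<mu> (indicator B)) (ev_time -` C)"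
      unfolding \<rho>_def by (subst emeasure_distr) (simp_all add: sets_eq_imp_space_eq[OF sets_\<mu>] that)
    then show ?thesis using emeasure_restricted[OF B' C'] by simp
  qed
  interpret \<rho>: finite_borel_measure \<rho>
    using fin \<rho>[of UNIV] by (intro finite_borel_measure.intro finite_measureI finite_borel_measure_axioms.intro)
       (auto simp: \<rho>_def)
  have "measure \<rho> {x} = 0" for x
  proof -
    have "emeasure \<mu> (B \<inter> ev_time -` {x}) \<le> emeasure \<mu> {e. ev_time e = x}"
      by (intro emeasure_mono) (auto simp: sets_\<mu>)
    then show ?thesis using \<rho>[of "{x}"] no_atoms[of x] by (simp add: measure_def)
  qed
  then have "continuous_on {0..t} (cdf \<rho>)"
    by (intro continuous_at_imp_continuous_on ballI) (simp add: \<rho>.isCont_cdf)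
  then have uc: "uniformly_continuous_on {0..t} (cdf \<rho>)"
    by (rule compact_uniformly_continuous) simp
  define mS where "mS m k = enn2real (emeasure \<mu> (?S m k))" for m k
  have mS0: "0 \<le> mS m k" for m k by (simp add: mS_def)
  have mS: "mS m k = cdf \<rho> (gridpt t m (Suc k)) - cdf \<rho> (gridpt t m k)" for m k
  proof -
    have "gridpt t m k < gridpt t m (Suc k)" using t by (simp add: gridpt_Suc)
    then have "cdf \<rho> (gridpt t m (Suc k)) - cdf \<rho> (gridpt t m k) = measure \<rho> {gridpt t m k<..gridpt t m (Suc k)}"
      by (rule \<rho>.cdf_diff_eq)
    also have "\<dots> = mS m k"
      unfolding mS_def measure_def by (subst \<rho>) (auto intro!: arg_cong[where f="\<lambda>s. enn2real (emeasure \<mu> s)"])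
    finally show ?thesis by simp
  qed
  define bad where "bad m = {\<omega>\<in>space M. \<exists>k<Suc m. emeasure (N \<omega>) (?S m k) \<noteq> 0 \<and> emeasure (N \<omega>) (?S m k) \<noteq> 1}" for m
  define Y where "Y m k \<omega> = emeasure (N \<omega>) (?S m k)" for m k \<omega>
  have Y[measurable]: "Y m k \<in> borel_measurable M" for m k
    unfolding Y_def by (rule measurable_N[OF S])
  have bad_Y: "bad m = (\<Union>k<Suc m. {\<omega>\<in>space M. Y m k \<omega> \<noteq> 0 \<and> Y m k \<omega> \<noteq> 1})" for m
    by (auto simp: bad_def Y_def)
  have bad: "bad m \<in> events" for m unfolding bad_Y by measurable
  have "(\<lambda>m. prob (bad m)) \<longlonglongrightarrow> 0"
  proof (rule LIMSEQ_I)
    fix r :: real assume r: "0 < r"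
    \<comment> \<open>Mass of B at times in (0,t]. It may be zero, so the tolerance for one cell is
      taken as \<open>r / (c + 1)\<close>.\<close>
    define c where "c = cdf \<rho> t - cdf \<rho> 0"
    have c: "0 \<le> c" unfolding c_def using \<rho>.cdf_nondecreasing[of 0 t] t by simp
    obtain d where d: "0 < d" "\<And>x y. x \<in> {0..t} \<Longrightarrow> y \<in> {0..t} \<Longrightarrow> dist y x < d \<Longrightarrow> dist (cdf \<rho> y) (cdf \<rho> x) < r / (c + 1)"
      using uc r c unfolding uniformly_continuous_on_def by (metis add_nonneg_pos divide_pos_pos zero_less_one)
    obtain n0 where n0: "t / real (Suc n0) < d"
      using LIMSEQ_D[OF LIMSEQ_Suc[OF lim_const_over_n[of t]] d(1)] t by auto
    show "\<exists>no. \<forall>n\<ge>no. norm (prob (bad n) - 0) < r"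
    proof (intro exI allI impI)
      fix m assume m: "n0 \<le> m"
      have "t / real (Suc m) \<le> t / real (Suc n0)" using m t by (intro divide_left_mono) auto
      then have td: "t / real (Suc m) < d" using n0 by simp
      have small: "mS m k \<le> r / (c + 1)" if "k < Suc m" for k
      proof -
        have "dist (gridpt t m (Suc k)) (gridpt t m k) < d" using td t by (simp add: gridpt_Suc dist_real_def)
        then have "dist (cdf \<rho> (gridpt t m (Suc k))) (cdf \<rho> (gridpt t m k)) < r / (c + 1)"
          using t that gridpt_nonneg[of t m] gridpt_le[of t _ m] by (intro d(2)) auto
        then show ?thesis unfolding mS by (simp add: dist_real_def)
      qed
      have "prob (bad m) \<le> (\<Sum>k<Suc m. prob {\<omega>\<in>space M. Y m k \<omega> \<noteq> 0 \<and> Y m k \<omega> \<noteq> 1})"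
        unfolding bad_Y by (intro finite_measure_subadditive_finite) auto
      also have "\<dots> \<le> (\<Sum>k<Suc m. (mS m k)\<^sup>2)"
        unfolding mS_def Y_def
        by (intro sum_mono prob_poisson_ge_2[OF measurable_N[OF S] _ prob_N[OF S finS]]) simp
      also have "\<dots> \<le> (\<Sum>k<Suc m. r / (c + 1) * mS m k)"
        unfolding power2_eq_square using small mS0 by (intro sum_mono mult_right_mono) auto
      also have "\<dots> = r / (c + 1) * (\<Sum>k<Suc m. mS m k)" by (rule sum_distrib_left[symmetric])
      also have "(\<Sum>k<Suc m. mS m k) = c"
        unfolding mS c_def using sum_lessThan_telescope[of "\<lambda>k. cdf \<rho> (gridpt t m k)" "Suc m"] by simp
      also have "r / (c + 1) * c < r" using r c by (simp add: field_simps)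
      finally show "norm (prob (bad m) - 0) < r" by simp
    qed
  qed
  \<comment> \<open>Probabilities that tend to zero without a rate control the intersection of all
    later bad events but not their union; hence good grids occur infinitely often, not necessarily
    eventually.\<close>
  have "AE \<omega> in M. \<exists>m\<ge>m0. \<omega> \<notin> bad m" for m0
  proof -
    let ?I = "\<Inter>m\<in>{m0..}. bad m"
    have "prob ?I \<le> 0"
    proof (rule LIMSEQ_le_const[OF \<open>(\<lambda>m. prob (bad m)) \<longlonglongrightarrow> 0\<close>])
      show "\<exists>n. \<forall>m\<ge>n. prob ?I \<le> prob (bad m)" by (intro exI[of _ m0] allI impI finite_measure_mono) (use bad in auto)
    qed
    then have "?I \<in> null_sets M"
      by (intro null_setsI) (use bad in \<open>auto simp: emeasure_eq_measure measure_le_0_iff\<close>)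
    then have "AE \<omega> in M. \<omega> \<notin> ?I" by (rule AE_not_in)
    then show ?thesis by eventually_elim auto
  qed
  then have "AE \<omega> in M. \<forall>m0. \<exists>m\<ge>m0. \<omega> \<notin> bad m" by (simp add: AE_all_countable)
  then show ?thesis using AE_space
  proof eventually_elim
    case (elim \<omega>)
    then show ?case unfolding frequently_sequentially bad_def by auto
  qed
qed

text \<open>A cell of mass one could still spread that mass. Its pieces in rational half-spaces have
  integer mass almost surely, all at once because there are countably many; being at most one, these
  masses are 0 or 1, so the mass sits at a single point.\<close>

lemma AE_frequently_one_point:
  assumes B[measurable]: "B \<in> sets borel" and fin: "emeasure \<mu> B < \<infinity>" and t: "0 < t"
  shows "AE \<omega> in M. \<exists>\<^sub>F m in sequentially. \<forall>k<Suc m.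
     one_point (N \<omega>) (B \<inter> {e. gridpt t m k < ev_time e \<and> ev_time e \<le> gridpt t m (Suc k)})"
proof -
  let ?S = "\<lambda>m k. B \<inter> {e. gridpt t m k < ev_time e \<and> ev_time e \<le> gridpt t m (Suc k)}"
  have S[measurable]: "?S m k \<in> sets borel" for m k by measurable
  have "AE \<omega> in M. \<forall>m k. \<forall>q::rat. \<forall>b\<in>Basis. \<exists>j. emeasure (N \<omega>) (?S m k \<inter> {e. e \<bullet> b \<le> of_rat q}) = of_nat j"
    unfolding AE_all_countable
  proof (intro allI AE_finite_allI AE_N_nat)
    fix m k and q :: rat and b :: ev
    show "?S m k \<inter> {e. e \<bullet> b \<le> of_rat q} \<in> sets borel" by measurable
    show "emeasure \<mu> (?S m k \<inter> {e. e \<bullet> b \<le> real_of_rat q}) < \<infinity>"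
      using B by (intro le_less_trans[OF emeasure_mono[where b=B] fin]) (auto simp: sets_\<mu>)
  qed simp
  then show ?thesis using AE_frequently_simple[OF assms] AE_space
  proof eventually_elim
    case (elim \<omega>)
    note sN = sets_N[OF elim(3)]
    show ?case
    proof (rule frequently_elim1[OF elim(2)], intro allI impI)
      fix m k assume *: "\<forall>k<Suc m. emeasure (N \<omega>) (?S m k) \<in> {0, 1}" "k < Suc m"
      show "one_point (N \<omega>) (?S m k)"
      proof (rule one_point_if_halfspaces_01[OF sN S])
        show "emeasure (N \<omega>) (?S m k) = 0 \<or> emeasure (N \<omega>) (?S m k) = 1" using * by auto
        fix b :: ev and q :: real assume b: "b \<in> Basis" and "q \<in> \<rat>"
        then obtain q' where q: "q = of_rat q'" by (auto elim: Rats_cases)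
        obtain j where j: "emeasure (N \<omega>) (?S m k \<inter> {e. e \<bullet> b \<le> q}) = of_nat j"
          using elim(1) b q by blast
        have "emeasure (N \<omega>) (?S m k \<inter> {e. e \<bullet> b \<le> q}) \<le> emeasure (N \<omega>) (?S m k)"
          using S sN by (intro emeasure_mono) auto
        also have "\<dots> \<le> 1" using * by auto
        finally have "j \<le> 1" unfolding j by (metis of_nat_1 of_nat_le_iff)
        then show "emeasure (N \<omega>) (?S m k \<inter> {e. e \<bullet> b \<le> q}) = 0 \<or> emeasure (N \<omega>) (?S m k \<inter> {e. e \<bullet> b \<le> q}) = 1"
          unfolding j by (cases j) auto
      qed
    qed
  qed
qed

end

section \<open>Compensation of predictable integrands\<close>

lemma nn_integral_indicator_le:
  assumes "S \<in> sets \<nu>"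
  shows "(\<integral>\<^sup>+e. indicator D (f e) * indicator S e \<partial>\<nu>) \<le> emeasure \<nu> S"
proof -
  have "(\<integral>\<^sup>+e. indicator D (f e) * indicator S e \<partial>\<nu>) \<le> (\<integral>\<^sup>+e. indicator S e \<partial>\<nu>)"
    by (intro nn_integral_mono) (simp split: split_indicator)
  then show ?thesis using assms by simp
qed

text \<open>Rectangles over a past event of \<open>F a\<close> are confined to times strictly after
  a. Rectangles over the full space carry no time restriction, so that functions of the event
  coordinates alone are predictable and times outside (0,T] are covered.\<close>

definition predictable_gen :: "'a measure \<Rightarrow> (real \<Rightarrow> 'a measure) \<Rightarrow> real \<Rightarrow> ('a \<times> ev) set set" where
  "predictable_gen M F T = {E \<times> B | E B. B \<in> sets borel \<and>
     (E = space M \<or> (\<exists>a\<in>{0..T}. E \<in> sets (F a) \<and> B \<subseteq> {e. a < ev_time e}))}"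

definition predictable :: "'a measure \<Rightarrow> (real \<Rightarrow> 'a measure) \<Rightarrow> real \<Rightarrow> ('a \<times> ev) measure" where
  "predictable M F T = sigma (space M \<times> UNIV) (predictable_gen M F T)"

context poisson_setup
begin

abbreviation "\<P> \<equiv> predictable M F T"

lemma predictable_gen_Pow: "predictable_gen M F T \<subseteq> Pow (space M \<times> UNIV)"
proof
  fix D assume "D \<in> predictable_gen M F T"
  then obtain E B where D: "D = E \<times> B" "E = space M \<or> (\<exists>a\<in>{0..T}. E \<in> sets (F a))"
    unfolding predictable_gen_def by blast
  then have "E \<in> events" using F_sub(1) by blast
  then show "D \<in> Pow (space M \<times> UNIV)" using sets.sets_into_space D(1) by blast
qed

lemma space_predictable[simp]: "space \<P> = space M \<times> UNIV"
  by (simp add: predictable_def space_measure_of predictable_gen_Pow)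

lemma sets_predictable: "sets \<P> = sigma_sets (space M \<times> UNIV) (predictable_gen M F T)"
  by (simp add: predictable_def sets_measure_of predictable_gen_Pow)

lemma sets_predictable_subset: "sets \<P> \<subseteq> sets (M \<Otimes>\<^sub>M (borel :: ev measure))"
proof -
  have "predictable_gen M F T \<subseteq> sets (M \<Otimes>\<^sub>M borel)"
  proof
    fix D assume "D \<in> predictable_gen M F T"
    then obtain E B where D: "D = E \<times> B" "B \<in> sets borel" "E = space M \<or> (\<exists>a\<in>{0..T}. E \<in> sets (F a))"
      unfolding predictable_gen_def by blast
    then have "E \<in> events" using F_sub(1) by blast
    then show "D \<in> sets (M \<Otimes>\<^sub>M borel)" using D by (auto intro: pair_measureI)
  qed
  moreover have "space M \<times> UNIV = space (M \<Otimes>\<^sub>M (borel :: ev measure))" by (simp add: space_pair_measure)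
  ultimately show ?thesis unfolding sets_predictable
    by (simp only:) (rule sets.sigma_sets_subset)
qed

lemma measurable_predictableD: "H \<in> measurable \<P> K \<Longrightarrow> H \<in> measurable (M \<Otimes>\<^sub>M (borel :: ev measure)) K"
  using sets_predictable_subset by (auto simp: measurable_def space_pair_measure)

lemma predictable_genI:
  assumes "B \<in> sets borel" "E = space M \<or> (\<exists>a\<in>{0..T}. E \<in> sets (F a) \<and> B \<subseteq> {e. a < ev_time e})"
  shows "E \<times> B \<in> sets \<P>"
  unfolding sets_predictable using assms by (intro sigma_sets.Basic) (auto simp: predictable_gen_def)

lemma measurable_snd_predictable: "snd \<in> measurable \<P> borel"
proof (rule measurableI)
  fix B :: "ev set" assume "B \<in> sets borel"
  then have "space M \<times> B \<in> sets \<P>" by (intro predictable_genI) auto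
  moreover have "snd -` B \<inter> space \<P> = space M \<times> B" by auto
  ultimately show "snd -` B \<inter> space \<P> \<in> sets \<P>" by simp
qed simp

lemma Int_stable_predictable_gen: "Int_stable (predictable_gen M F T)"
proof (rule Int_stableI)
  fix C D assume "C \<in> predictable_gen M F T" "D \<in> predictable_gen M F T"
  then obtain E1 B1 E2 B2 where C: "C = E1 \<times> B1" "B1 \<in> sets borel"
      "E1 = space M \<or> (\<exists>a\<in>{0..T}. E1 \<in> sets (F a) \<and> B1 \<subseteq> {e. a < ev_time e})"
    and D: "D = E2 \<times> B2" "B2 \<in> sets borel"
      "E2 = space M \<or> (\<exists>a\<in>{0..T}. E2 \<in> sets (F a) \<and> B2 \<subseteq> {e. a < ev_time e})"
    unfolding predictable_gen_def by blast
  have sub: "E \<inter> space M = E" "space M \<inter> E = E" if "a \<in> {0..T}" "E \<in> sets (F a)" for a E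
    using that F_sub(1) sets.sets_into_space by blast+
  have "E1 \<inter> E2 = space M \<or> (\<exists>a\<in>{0..T}. E1 \<inter> E2 \<in> sets (F a) \<and> B1 \<inter> B2 \<subseteq> {e. a < ev_time e})"
  proof (cases "E1 = space M \<or> E2 = space M")
    case True
    then have "E1 \<inter> E2 = E2 \<and> E1 = space M \<or> E1 \<inter> E2 = E1 \<and> E2 = space M"
      using C(3) D(3) sub by (metis Int_absorb)
    then show ?thesis using C(3) D(3) by (metis le_infI1 le_infI2)
  next
    case False
    then obtain a b where ab: "a \<in> {0..T}" "E1 \<in> sets (F a)" "B1 \<subseteq> {e. a < ev_time e}"
      "b \<in> {0..T}" "E2 \<in> sets (F b)" "B2 \<subseteq> {e. b < ev_time e}" using C(3) D(3) by blast
    \<comment> \<open>The later of the two times serves both factors, by monotonicity of the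
      filtration.\<close>
    have "E1 \<in> sets (F (max a b))" "E2 \<in> sets (F (max a b))"
      using ab F_mono[of a "max a b"] F_mono[of b "max a b"] by auto
    then show ?thesis using ab by (intro disjI2 bexI[of _ "max a b"]) auto
  qed
  then show "C \<inter> D \<in> predictable_gen M F T"
    unfolding predictable_gen_def C(1) D(1) using C(2) D(2)
    by (intro CollectI exI[of _ "E1 \<inter> E2"] exI[of _ "B1 \<inter> B2"]) auto
qed

lemma A_fin: "emeasure \<mu> (A n) < \<infinity>"
  using A(4)[of n] by (simp add: top.not_eq_extremum)

definition good :: "'a set" where
  "good = {\<omega>\<in>space M. \<forall>n. emeasure (N \<omega>) (A n) < \<infinity>}"

text \<open>The random measure need not be \<open>\<sigma>\<close>-finite on a null set of outcomes, where measurability of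
  integrals against it could fail; there it is replaced by the zero measure.\<close>

definition N0 :: "'a \<Rightarrow> ev measure" where
  "N0 \<omega> = (if \<omega> \<in> good then N \<omega> else null_measure borel)"

lemma good_events: "good \<in> events"
  unfolding good_def using measurable_N[OF A(1)] by measurable

lemma AE_good: "AE \<omega> in M. \<omega> \<in> good"
proof -
  have "AE \<omega> in M. \<forall>n. \<exists>k. emeasure (N \<omega>) (A n) = of_nat k"
    unfolding AE_all_countable by (intro allI AE_N_nat A A_fin)
  then show ?thesis using AE_space
    by eventually_elim (auto simp: good_def, metis ennreal_of_nat_neq_top top.not_eq_extremum of_nat_less_top)
qed

lemma sets_N0: "sets (N0 \<omega>) = sets borel"
  using sets_N by (auto simp: N0_def good_def)

lemma N0_eq: "\<omega> \<in> good \<Longrightarrow> N0 \<omega> = N \<omega>"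
  by (simp add: N0_def)

lemma N0_finite: "emeasure (N0 \<omega>) (A n) < \<infinity>"
  by (simp add: N0_def good_def)

lemma measurable_N0: "B \<in> sets borel \<Longrightarrow> (\<lambda>\<omega>. emeasure (N0 \<omega>) B) \<in> borel_measurable M"
proof -
  assume B: "B \<in> sets borel"
  note [measurable] = good_events measurable_N[OF B]
  have "(\<lambda>\<omega>. emeasure (N0 \<omega>) B) = (\<lambda>\<omega>. if \<omega> \<in> good then emeasure (N \<omega>) B else 0)"
    by (auto simp: N0_def)
  then show ?thesis by simp
qed

text \<open>Measurability of the inner integral is part of the notion because the induction over
  integrands needs it at each stage. Values lie in [0,\<infinity>], so the identity makes sense
  without integrability.\<close>

definition compensated :: "('a \<times> ev \<Rightarrow> ennreal) \<Rightarrow> bool" where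
  "compensated H \<longleftrightarrow> (\<lambda>\<omega>. \<integral>\<^sup>+e. H (\<omega>, e) \<partial>N0 \<omega>) \<in> borel_measurable M \<and>
     (\<integral>\<^sup>+\<omega>. \<integral>\<^sup>+e. H (\<omega>, e) \<partial>N0 \<omega> \<partial>M) = (\<integral>\<^sup>+\<omega>. \<integral>\<^sup>+e. H (\<omega>, e) \<partial>\<mu> \<partial>M)"

lemma section_N0:
  assumes "H \<in> borel_measurable \<P>" "\<omega> \<in> space M"
  shows "(\<lambda>e. H (\<omega>, e)) \<in> borel_measurable (N0 \<omega>)" "(\<lambda>e. H (\<omega>, e)) \<in> borel_measurable \<mu>"
  using measurable_compose[OF measurable_Pair1'[OF assms(2)] measurable_predictableD[OF assms(1)]]
  by (simp_all cong: measurable_cong_sets add: sets_\<mu> sets_N0)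

lemma meas_int_\<mu>:
  fixes H :: "'a \<times> ev \<Rightarrow> ennreal"
  assumes "H \<in> borel_measurable \<P>"
  shows "(\<lambda>\<omega>. \<integral>\<^sup>+e. H (\<omega>, e) \<partial>\<mu>) \<in> borel_measurable M"
proof -
  have "H \<in> borel_measurable (M \<Otimes>\<^sub>M \<mu>)"
    using measurable_predictableD[OF assms] measurable_cong_sets[OF sets_pair_measure_cong[OF refl sets_\<mu>] refl]
    by blast
  then show ?thesis by measurable
qed

lemma measurable_indicator_A:
  "D \<in> sets \<P> \<Longrightarrow> (\<lambda>x. indicator D x * indicator (A n) (snd x) :: ennreal) \<in> borel_measurable \<P>"
  using measurable_compose[OF measurable_snd_predictable borel_measurable_indicator[OF A(1)]]
  by (intro borel_measurable_times_ennreal borel_measurable_indicator)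

text \<open>A Dynkin argument carries the formula from rectangles to all sets they generate. The
  factor \<open>indicator (A n)\<close> is there for complements, where masses are subtracted and
  have to be finite.\<close>

lemma compensated_indicator_A:
  assumes "D \<in> sets \<P>"
  shows "compensated (\<lambda>x. indicator D x * indicator (A n) (snd x))"
  using assms unfolding sets_predictable
proof (induction rule: sigma_sets_induct_disjoint[OF Int_stable_predictable_gen predictable_gen_Pow,
      consumes 1, case_names basic empty compl union])
  case (basic D)
  then obtain E B where D: "D = E \<times> B" "B \<in> sets borel"
    "E = space M \<or> (\<exists>a\<in>{0..T}. E \<in> sets (F a) \<and> B \<subseteq> {e. a < ev_time e})"
    unfolding predictable_gen_def by blast
  have Ev[measurable]: "E \<in> events" using D(3) F_sub(1) by blast
  have BA: "B \<inter> A n \<in> sets borel" using D(2) A(1) by simp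
  note [measurable] = measurable_N0[OF BA]
  have r: "(\<integral>\<^sup>+e. indicator D (\<omega>, e) * indicator (A n) e \<partial>\<nu>) = indicator E \<omega> * emeasure \<nu> (B \<inter> A n)"
    if "sets \<nu> = sets borel" for \<omega> \<nu>
  proof -
    have "(\<integral>\<^sup>+e. indicator D (\<omega>, e) * indicator (A n) e \<partial>\<nu>) = (\<integral>\<^sup>+e. indicator E \<omega> * indicator (B \<inter> A n) e \<partial>\<nu>)"
      by (intro nn_integral_cong) (auto simp: D(1) split: split_indicator)
    then show ?thesis using BA that by (simp add: nn_integral_cmult_indicator)
  qed
  have fin: "emeasure \<mu> (B \<inter> A n) < \<infinity>"
    by (rule le_less_trans[OF emeasure_mono A_fin[of n]]) (simp_all add: sets_\<mu> A(1))
  have "(\<integral>\<^sup>+\<omega>. indicator E \<omega> * emeasure (N0 \<omega>) (B \<inter> A n) \<partial>M) = (\<integral>\<^sup>+\<omega>. indicator E \<omega> * emeasure (N \<omega>) (B \<inter> A n) \<partial>M)"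
    using AE_good by (intro nn_integral_cong_AE) (auto simp: N0_eq)
  also have "\<dots> = emeasure M E * emeasure \<mu> (B \<inter> A n)"
    using D(3) by (intro nn_integral_N BA fin) auto
  finally show ?case
    unfolding compensated_def by (simp add: r sets_N0 sets_\<mu> nn_integral_multc)
next
  case empty
  then show ?case by (simp add: compensated_def)
next
  case (compl D)
  then have D: "D \<in> sets \<P>" by (simp add: sets_predictable)
  let ?h = "\<lambda>D x. indicator D x * indicator (A n) (snd x) :: ennreal"
  note hm = measurable_indicator_A
  have r: "(\<integral>\<^sup>+e. ?h (space M \<times> UNIV - D) (\<omega>, e) \<partial>\<nu>) = emeasure \<nu> (A n) - (\<integral>\<^sup>+e. ?h D (\<omega>, e) \<partial>\<nu>)"
    if \<omega>: "\<omega> \<in> space M" and \<nu>: "sets \<nu> = sets borel" "emeasure \<nu> (A n) < \<infinity>" for \<omega> \<nu>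
  proof -
    have sec: "(\<lambda>e. ?h D (\<omega>, e)) \<in> borel_measurable \<nu>"
      using measurable_compose[OF measurable_Pair1'[OF \<omega>] measurable_predictableD[OF hm[OF D]]]
      by (simp cong: measurable_cong_sets add: \<nu>(1))
    have An: "A n \<in> sets \<nu>" using A(1) \<nu>(1) by simp
    have le: "(\<integral>\<^sup>+e. ?h D (\<omega>, e) \<partial>\<nu>) \<le> emeasure \<nu> (A n)"
      unfolding snd_conv
      by (rule nn_integral_indicator_le[OF An])
    have "(\<integral>\<^sup>+e. ?h (space M \<times> UNIV - D) (\<omega>, e) \<partial>\<nu>) = (\<integral>\<^sup>+e. indicator (A n) e - ?h D (\<omega>, e) \<partial>\<nu>)"
      using \<omega> by (intro nn_integral_cong) (auto split: split_indicator)
    also have "\<dots> = (\<integral>\<^sup>+e. indicator (A n) e \<partial>\<nu>) - (\<integral>\<^sup>+e. ?h D (\<omega>, e) \<partial>\<nu>)"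
      using le \<nu>(2) sec An by (intro nn_integral_diff) (auto split: split_indicator)
    finally show ?thesis using An by simp
  qed
  let ?n = "\<lambda>\<omega>. \<integral>\<^sup>+e. ?h D (\<omega>, e) \<partial>N0 \<omega>" and ?m = "\<lambda>\<omega>. \<integral>\<^sup>+e. ?h D (\<omega>, e) \<partial>\<mu>"
  have IH: "?n \<in> borel_measurable M" "(\<integral>\<^sup>+\<omega>. ?n \<omega> \<partial>M) = (\<integral>\<^sup>+\<omega>. ?m \<omega> \<partial>M)"
    using compl by (auto simp: compensated_def)
  have mm: "?m \<in> borel_measurable M" by (rule meas_int_\<mu>[OF hm[OF D]])
  note A\<mu> = A_fin[of n]
  have nle: "?n \<omega> \<le> emeasure (N0 \<omega>) (A n)" for \<omega>
    unfolding snd_conv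
    using A(1) by (intro nn_integral_indicator_le) (simp add: sets_N0)
  have mle: "?m \<omega> \<le> emeasure \<mu> (A n)" for \<omega>
    unfolding snd_conv
    using A(1) by (intro nn_integral_indicator_le) (simp add: sets_\<mu>)
  have tot: "(\<integral>\<^sup>+\<omega>. emeasure (N0 \<omega>) (A n) \<partial>M) = emeasure \<mu> (A n)"
  proof -
    have "(\<integral>\<^sup>+\<omega>. emeasure (N0 \<omega>) (A n) \<partial>M) = (\<integral>\<^sup>+\<omega>. indicator (space M) \<omega> * emeasure (N \<omega>) (A n) \<partial>M)"
      using AE_good AE_space by (intro nn_integral_cong_AE) (auto simp: N0_eq)
    then show ?thesis using nn_integral_N[OF A(1) A\<mu>, of "space M"] by (simp add: emeasure_space_1)
  qed
  have mfin: "(\<integral>\<^sup>+\<omega>. ?m \<omega> \<partial>M) \<noteq> \<infinity>"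
  proof -
    have "(\<integral>\<^sup>+\<omega>. ?m \<omega> \<partial>M) \<le> (\<integral>\<^sup>+\<omega>. emeasure \<mu> (A n) \<partial>M)" by (intro nn_integral_mono mle)
    also have "\<dots> < \<infinity>" using A\<mu> by (simp add: emeasure_space_1)
    finally show ?thesis by simp
  qed
  have "(\<integral>\<^sup>+\<omega>. emeasure (N0 \<omega>) (A n) - ?n \<omega> \<partial>M) = emeasure \<mu> (A n) - (\<integral>\<^sup>+\<omega>. ?m \<omega> \<partial>M)"
    unfolding IH(2)[symmetric] tot[symmetric]
    using IH mfin nle by (intro nn_integral_diff measurable_N0 A(1)) auto
  also have "\<dots> = (\<integral>\<^sup>+\<omega>. emeasure \<mu> (A n) - ?m \<omega> \<partial>M)"
    using mfin mle mm by (subst nn_integral_diff) (auto simp: emeasure_space_1)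
  finally have eq: "(\<integral>\<^sup>+\<omega>. emeasure (N0 \<omega>) (A n) - ?n \<omega> \<partial>M) = (\<integral>\<^sup>+\<omega>. emeasure \<mu> (A n) - ?m \<omega> \<partial>M)" .
  \<comment> \<open>Finiteness of the mass of \<open>A n\<close> is used here for every outcome and
    not just almost surely; passing to \<open>N0\<close> guarantees it.\<close>
  have N0': "(\<integral>\<^sup>+e. ?h (space M \<times> UNIV - D) (\<omega>, e) \<partial>N0 \<omega>) = emeasure (N0 \<omega>) (A n) - ?n \<omega>" if "\<omega> \<in> space M" for \<omega>
    using r[OF that sets_N0 N0_finite] .
  have \<mu>': "(\<integral>\<^sup>+e. ?h (space M \<times> UNIV - D) (\<omega>, e) \<partial>\<mu>) = emeasure \<mu> (A n) - ?m \<omega>" if "\<omega> \<in> space M" for \<omega>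
    using r[OF that sets_\<mu> A\<mu>] .
  show ?case unfolding compensated_def
  proof
    have "(\<lambda>\<omega>. emeasure (N0 \<omega>) (A n) - ?n \<omega>) \<in> borel_measurable M"
      using IH(1) measurable_N0[OF A(1)] by measurable
    then show "(\<lambda>\<omega>. \<integral>\<^sup>+e. ?h (space M \<times> UNIV - D) (\<omega>, e) \<partial>N0 \<omega>) \<in> borel_measurable M"
      by (subst measurable_cong[OF N0'])
    show "(\<integral>\<^sup>+\<omega>. \<integral>\<^sup>+e. ?h (space M \<times> UNIV - D) (\<omega>, e) \<partial>N0 \<omega> \<partial>M) =
        (\<integral>\<^sup>+\<omega>. \<integral>\<^sup>+e. ?h (space M \<times> UNIV - D) (\<omega>, e) \<partial>\<mu> \<partial>M)"
      by (rule trans[OF nn_integral_cong[OF N0'] trans[OF eq nn_integral_cong[OF \<mu>'[symmetric]]]])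
  qed
next
  case (union D)
  then have D: "D i \<in> sets \<P>" for i by (auto simp: sets_predictable)
  let ?h = "\<lambda>D x. indicator D x * indicator (A n) (snd x) :: ennreal"
  note hm = measurable_indicator_A
  have sm: "?h (\<Union>i. D i) x = (\<Sum>i. ?h (D i) x)" for x
    using suminf_indicator[OF union(1), of x] by simp
  have 1: "(\<integral>\<^sup>+e. ?h (\<Union>i. D i) (\<omega>, e) \<partial>N0 \<omega>) = (\<Sum>i. \<integral>\<^sup>+e. ?h (D i) (\<omega>, e) \<partial>N0 \<omega>)"
    and 2: "(\<integral>\<^sup>+e. ?h (\<Union>i. D i) (\<omega>, e) \<partial>\<mu>) = (\<Sum>i. \<integral>\<^sup>+e. ?h (D i) (\<omega>, e) \<partial>\<mu>)" if "\<omega> \<in> space M" for \<omega>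
    unfolding sm using section_N0[OF hm[OF D] that] by (intro nn_integral_suminf; simp)+
  have IH: "(\<lambda>\<omega>. \<integral>\<^sup>+e. ?h (D i) (\<omega>, e) \<partial>N0 \<omega>) \<in> borel_measurable M"
    "(\<integral>\<^sup>+\<omega>. \<integral>\<^sup>+e. ?h (D i) (\<omega>, e) \<partial>N0 \<omega> \<partial>M) = (\<integral>\<^sup>+\<omega>. \<integral>\<^sup>+e. ?h (D i) (\<omega>, e) \<partial>\<mu> \<partial>M)" for i
    using union(3) by (auto simp: compensated_def)
  show ?case unfolding compensated_def
  proof
    show "(\<lambda>\<omega>. \<integral>\<^sup>+e. ?h (\<Union>i. D i) (\<omega>, e) \<partial>N0 \<omega>) \<in> borel_measurable M"
      using IH(1) by (subst measurable_cong[OF 1]) auto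
    show "(\<integral>\<^sup>+\<omega>. \<integral>\<^sup>+e. ?h (\<Union>i. D i) (\<omega>, e) \<partial>N0 \<omega> \<partial>M) = (\<integral>\<^sup>+\<omega>. \<integral>\<^sup>+e. ?h (\<Union>i. D i) (\<omega>, e) \<partial>\<mu> \<partial>M)"
    proof -
      have "(\<integral>\<^sup>+\<omega>. \<integral>\<^sup>+e. ?h (\<Union>i. D i) (\<omega>, e) \<partial>N0 \<omega> \<partial>M) = (\<integral>\<^sup>+\<omega>. (\<Sum>i. \<integral>\<^sup>+e. ?h (D i) (\<omega>, e) \<partial>N0 \<omega>) \<partial>M)"
        by (rule nn_integral_cong) (rule 1)
      also have "\<dots> = (\<Sum>i. \<integral>\<^sup>+\<omega>. \<integral>\<^sup>+e. ?h (D i) (\<omega>, e) \<partial>\<mu> \<partial>M)"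
        unfolding IH(2)[symmetric] by (rule nn_integral_suminf[OF IH(1)])
      also have "\<dots> = (\<integral>\<^sup>+\<omega>. (\<Sum>i. \<integral>\<^sup>+e. ?h (D i) (\<omega>, e) \<partial>\<mu>) \<partial>M)"
        by (rule nn_integral_suminf[OF meas_int_\<mu>[OF hm[OF D]], symmetric])
      also have "\<dots> = (\<integral>\<^sup>+\<omega>. \<integral>\<^sup>+e. ?h (\<Union>i. D i) (\<omega>, e) \<partial>\<mu> \<partial>M)"
        by (rule nn_integral_cong) (rule 2[symmetric])
      finally show ?thesis .
    qed
  qed
qed

lemma compensated_incseq:
  assumes m: "\<And>i. H i \<in> borel_measurable \<P>" and inc: "incseq H" and c: "\<And>i. compensated (H i)"
  shows "compensated (\<lambda>x. SUP i. H i x)"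
proof -
  have mono: "incseq (\<lambda>i e. H i (\<omega>, e))" for \<omega> using inc by (auto simp: incseq_def le_fun_def)
  have 1: "(\<integral>\<^sup>+e. (SUP i. H i (\<omega>, e)) \<partial>N0 \<omega>) = (SUP i. \<integral>\<^sup>+e. H i (\<omega>, e) \<partial>N0 \<omega>)"
    and 2: "(\<integral>\<^sup>+e. (SUP i. H i (\<omega>, e)) \<partial>\<mu>) = (SUP i. \<integral>\<^sup>+e. H i (\<omega>, e) \<partial>\<mu>)" if "\<omega> \<in> space M" for \<omega>
    using section_N0[OF m that] mono by (intro nn_integral_monotone_convergence_SUP; simp)+
  have IH: "(\<lambda>\<omega>. \<integral>\<^sup>+e. H i (\<omega>, e) \<partial>N0 \<omega>) \<in> borel_measurable M"
    "(\<integral>\<^sup>+\<omega>. \<integral>\<^sup>+e. H i (\<omega>, e) \<partial>N0 \<omega> \<partial>M) = (\<integral>\<^sup>+\<omega>. \<integral>\<^sup>+e. H i (\<omega>, e) \<partial>\<mu> \<partial>M)" for i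
    using c by (auto simp: compensated_def)
  have inc': "incseq (\<lambda>i \<omega>. \<integral>\<^sup>+e. H i (\<omega>, e) \<partial>\<nu> \<omega>)" for \<nu>
    using inc by (auto simp: incseq_def le_fun_def intro!: nn_integral_mono)
  show ?thesis unfolding compensated_def
  proof
    show "(\<lambda>\<omega>. \<integral>\<^sup>+e. (SUP i. H i (\<omega>, e)) \<partial>N0 \<omega>) \<in> borel_measurable M"
      using IH(1) by (subst measurable_cong[OF 1]) auto
    show "(\<integral>\<^sup>+\<omega>. \<integral>\<^sup>+e. (SUP i. H i (\<omega>, e)) \<partial>N0 \<omega> \<partial>M) = (\<integral>\<^sup>+\<omega>. \<integral>\<^sup>+e. (SUP i. H i (\<omega>, e)) \<partial>\<mu> \<partial>M)"
    proof -
      have "(\<integral>\<^sup>+\<omega>. \<integral>\<^sup>+e. (SUP i. H i (\<omega>, e)) \<partial>N0 \<omega> \<partial>M) = (\<integral>\<^sup>+\<omega>. (SUP i. \<integral>\<^sup>+e. H i (\<omega>, e) \<partial>N0 \<omega>) \<partial>M)"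
        by (rule nn_integral_cong) (rule 1)
      also have "\<dots> = (SUP i. \<integral>\<^sup>+\<omega>. \<integral>\<^sup>+e. H i (\<omega>, e) \<partial>\<mu> \<partial>M)"
        unfolding IH(2)[symmetric] by (rule nn_integral_monotone_convergence_SUP[OF inc' IH(1)])
      also have "\<dots> = (\<integral>\<^sup>+\<omega>. (SUP i. \<integral>\<^sup>+e. H i (\<omega>, e) \<partial>\<mu>) \<partial>M)"
        by (rule nn_integral_monotone_convergence_SUP[OF inc' meas_int_\<mu>[OF m], symmetric])
      also have "\<dots> = (\<integral>\<^sup>+\<omega>. \<integral>\<^sup>+e. (SUP i. H i (\<omega>, e)) \<partial>\<mu> \<partial>M)"
        by (rule nn_integral_cong) (rule 2[symmetric])
      finally show ?thesis .
    qed
  qed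
qed

lemma compensation:
  assumes "H \<in> borel_measurable \<P>"
  shows "compensated H"
  using assms
proof (induction rule: borel_measurable_induct)
  case (cong f g)
  have "f (\<omega>, e) = g (\<omega>, e)" if "\<omega> \<in> space M" for \<omega> e using cong(3) that by simp
  then have "(\<integral>\<^sup>+e. f (\<omega>, e) \<partial>\<nu>) = (\<integral>\<^sup>+e. g (\<omega>, e) \<partial>\<nu>)" if "\<omega> \<in> space M" for \<omega> \<nu>
    using that by (intro nn_integral_cong) auto
  then show ?case using cong(4) by (simp add: compensated_def cong: measurable_cong nn_integral_cong)
next
  case (set D)
  \<comment> \<open>The sets \<open>A n\<close> increase to the whole mark space, so the truncation
    disappears in a monotone limit.\<close>
  have "compensated (\<lambda>x. SUP n. indicator D x * indicator (A n) (snd x))"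
  proof (rule compensated_incseq)
    show "(\<lambda>x. indicator D x * indicator (A n) (snd x) :: ennreal) \<in> borel_measurable \<P>" for n
      by (rule measurable_indicator_A[OF set])
    show "incseq (\<lambda>n x. indicator D x * indicator (A n) (snd x) :: ennreal)"
      using A(2) by (auto simp: incseq_def le_fun_def split: split_indicator)
    show "compensated (\<lambda>x. indicator D x * indicator (A n) (snd x))" for n
      by (rule compensated_indicator_A[OF set])
  qed
  moreover have "(SUP n. indicator D x * indicator (A n) (snd x)) = (indicator D x :: ennreal)" for x
  proof -
    obtain n where n: "snd x \<in> A n" using A(3) by blast
    show ?thesis
      by (rule antisym[OF SUP_least SUP_upper2[of n]]) (auto simp: n split: split_indicator)
  qed
  ultimately show ?case by simp
next
  case (mult u c)
  then show ?case using section_N0[OF mult(2)] meas_int_\<mu>[OF mult(2)]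
    by (auto simp: compensated_def nn_integral_cmult cong: measurable_cong nn_integral_cong)
next
  case (add u v)
  then show ?case using section_N0[OF add(1)] section_N0[OF add(3)] meas_int_\<mu>[OF add(1)] meas_int_\<mu>[OF add(3)]
    by (auto simp: compensated_def nn_integral_add cong: measurable_cong nn_integral_cong)
next
  case (seq U)
  have "(SUP i. U i) = (\<lambda>x. SUP i. U i x)" by (rule ext) (simp add: image_comp)
  then show ?case using compensated_incseq[of U] seq by simp
qed

text \<open>Positive and negative parts are compensated separately and subtracted once they are
  finite. The result is kept in split form because the integrals against the intensity are later
  computed for nonnegative integrands.\<close>

lemma compensation_signed:
  fixes H :: "'a \<times> ev \<Rightarrow> real"
  assumes H[measurable]: "H \<in> borel_measurable \<P>"
    and fin: "(\<integral>\<^sup>+\<omega>. \<integral>\<^sup>+e. ennreal \<bar>H (\<omega>, e)\<bar> \<partial>\<mu> \<partial>M) < \<infinity>"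
  shows "AE \<omega> in M. integrable (N0 \<omega>) (\<lambda>e. H (\<omega>, e))"
    and "integrable M (\<lambda>\<omega>. \<integral>e. H (\<omega>, e) \<partial>N0 \<omega>)"
    and "(\<integral>\<omega>. \<integral>e. H (\<omega>, e) \<partial>N0 \<omega> \<partial>M) =
      enn2real (\<integral>\<^sup>+\<omega>. \<integral>\<^sup>+e. ennreal (H (\<omega>, e)) \<partial>\<mu> \<partial>M) - enn2real (\<integral>\<^sup>+\<omega>. \<integral>\<^sup>+e. ennreal (- H (\<omega>, e)) \<partial>\<mu> \<partial>M)"
proof -
  define pos where "pos \<omega> = (\<integral>\<^sup>+e. ennreal (H (\<omega>, e)) \<partial>N0 \<omega>)" for \<omega>
  define neg where "neg \<omega> = (\<integral>\<^sup>+e. ennreal (- H (\<omega>, e)) \<partial>N0 \<omega>)" for \<omega>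
  have cp: "compensated (\<lambda>x. ennreal (H x))" and cn: "compensated (\<lambda>x. ennreal (- H x))"
    and ca: "compensated (\<lambda>x. ennreal \<bar>H x\<bar>)"
    by (intro compensation; measurable)+
  have m[measurable]: "pos \<in> borel_measurable M" "neg \<in> borel_measurable M"
    and ma: "(\<lambda>\<omega>. \<integral>\<^sup>+e. ennreal \<bar>H (\<omega>, e)\<bar> \<partial>N0 \<omega>) \<in> borel_measurable M"
    using cp cn ca by (auto simp: compensated_def pos_def[abs_def] neg_def[abs_def])
  have fa: "(\<integral>\<^sup>+\<omega>. \<integral>\<^sup>+e. ennreal \<bar>H (\<omega>, e)\<bar> \<partial>N0 \<omega> \<partial>M) < \<infinity>"
    using ca fin by (simp add: compensated_def)
  have "AE \<omega> in M. (\<integral>\<^sup>+e. ennreal \<bar>H (\<omega>, e)\<bar> \<partial>N0 \<omega>) \<noteq> \<infinity>"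
    using fa by (intro nn_integral_PInf_AE ma) auto
  then show int: "AE \<omega> in M. integrable (N0 \<omega>) (\<lambda>e. H (\<omega>, e))"
    using AE_space by eventually_elim (auto simp: integrable_iff_bounded section_N0(1)[OF H] top.not_eq_extremum)
  have eqP: "(\<integral>\<^sup>+\<omega>. pos \<omega> \<partial>M) = (\<integral>\<^sup>+\<omega>. \<integral>\<^sup>+e. ennreal (H (\<omega>, e)) \<partial>\<mu> \<partial>M)"
    and eqN: "(\<integral>\<^sup>+\<omega>. neg \<omega> \<partial>M) = (\<integral>\<^sup>+\<omega>. \<integral>\<^sup>+e. ennreal (- H (\<omega>, e)) \<partial>\<mu> \<partial>M)"
    using cp cn by (auto simp: compensated_def pos_def neg_def)
  have "(\<integral>\<^sup>+\<omega>. pos \<omega> \<partial>M) \<le> (\<integral>\<^sup>+\<omega>. \<integral>\<^sup>+e. ennreal \<bar>H (\<omega>, e)\<bar> \<partial>N0 \<omega> \<partial>M)"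
    and "(\<integral>\<^sup>+\<omega>. neg \<omega> \<partial>M) \<le> (\<integral>\<^sup>+\<omega>. \<integral>\<^sup>+e. ennreal \<bar>H (\<omega>, e)\<bar> \<partial>N0 \<omega> \<partial>M)"
    unfolding pos_def neg_def by (intro nn_integral_mono ennreal_leI; simp)+
  then have fp: "(\<integral>\<^sup>+\<omega>. pos \<omega> \<partial>M) < \<infinity>" and fn: "(\<integral>\<^sup>+\<omega>. neg \<omega> \<partial>M) < \<infinity>"
    using fa by auto
  have ae: "AE \<omega> in M. pos \<omega> \<noteq> \<infinity>" "AE \<omega> in M. neg \<omega> \<noteq> \<infinity>"
    using fp fn nn_integral_PInf_AE[OF m(1)] nn_integral_PInf_AE[OF m(2)] by auto
  have ip: "integrable M (\<lambda>\<omega>. enn2real (pos \<omega>))" "(\<integral>\<omega>. enn2real (pos \<omega>) \<partial>M) = enn2real (\<integral>\<^sup>+\<omega>. pos \<omega> \<partial>M)"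
    and "integrable M (\<lambda>\<omega>. enn2real (neg \<omega>))" "(\<integral>\<omega>. enn2real (neg \<omega>) \<partial>M) = enn2real (\<integral>\<^sup>+\<omega>. neg \<omega> \<partial>M)"
  proof -
    have *: "(\<integral>\<^sup>+\<omega>. ennreal (enn2real (g \<omega>)) \<partial>M) = (\<integral>\<^sup>+\<omega>. g \<omega> \<partial>M)" if "AE \<omega> in M. g \<omega> \<noteq> \<infinity>" for g
      using that by (intro nn_integral_cong_AE) (auto simp: top.not_eq_extremum)
    show "integrable M (\<lambda>\<omega>. enn2real (pos \<omega>))" "integrable M (\<lambda>\<omega>. enn2real (neg \<omega>))"
      using *[OF ae(1)] *[OF ae(2)] fp fn by (auto intro!: integrableI_bounded)
    show "(\<integral>\<omega>. enn2real (pos \<omega>) \<partial>M) = enn2real (\<integral>\<^sup>+\<omega>. pos \<omega> \<partial>M)"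
      "(\<integral>\<omega>. enn2real (neg \<omega>) \<partial>M) = enn2real (\<integral>\<^sup>+\<omega>. neg \<omega> \<partial>M)"
      using *[OF ae(1)] *[OF ae(2)] by (simp_all add: integral_eq_nn_integral)
  qed
  note ip = this
  have J: "AE \<omega> in M. (\<integral>e. H (\<omega>, e) \<partial>N0 \<omega>) = enn2real (pos \<omega>) - enn2real (neg \<omega>)"
    using int by eventually_elim (simp add: real_lebesgue_integral_def pos_def neg_def)
  \<comment> \<open>This holds for every outcome, with the default value 0 of the Bochner integral
    where H is not integrable, and thereby exhibits the inner integral as a measurable function of
    the outcome.\<close>
  have fib: "(\<integral>e. H (\<omega>, e) \<partial>N0 \<omega>) = (if (\<integral>\<^sup>+e. ennreal \<bar>H (\<omega>, e)\<bar> \<partial>N0 \<omega>) < \<infinity> then enn2real (pos \<omega>) - enn2real (neg \<omega>) else 0)"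
    if "\<omega> \<in> space M" for \<omega>
  proof (cases "integrable (N0 \<omega>) (\<lambda>e. H (\<omega>, e))")
    case True
    then show ?thesis by (simp add: real_lebesgue_integral_def pos_def neg_def integrable_iff_bounded)
  next
    case False
    then show ?thesis using section_N0(1)[OF H that] by (simp add: not_integrable_integral_eq integrable_iff_bounded)
  qed
  have mJ: "(\<lambda>\<omega>. \<integral>e. H (\<omega>, e) \<partial>N0 \<omega>) \<in> borel_measurable M"
    using ma by (subst measurable_cong[OF fib]) measurable
  have md: "(\<lambda>\<omega>. enn2real (pos \<omega>) - enn2real (neg \<omega>)) \<in> borel_measurable M" by measurable
  have id: "integrable M (\<lambda>\<omega>. enn2real (pos \<omega>) - enn2real (neg \<omega>))" using ip by simp
  show "integrable M (\<lambda>\<omega>. \<integral>e. H (\<omega>, e) \<partial>N0 \<omega>)"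
    by (subst integrable_cong_AE[OF mJ md J]) (rule id)
  show "(\<integral>\<omega>. \<integral>e. H (\<omega>, e) \<partial>N0 \<omega> \<partial>M) =
      enn2real (\<integral>\<^sup>+\<omega>. \<integral>\<^sup>+e. ennreal (H (\<omega>, e)) \<partial>\<mu> \<partial>M) - enn2real (\<integral>\<^sup>+\<omega>. \<integral>\<^sup>+e. ennreal (- H (\<omega>, e)) \<partial>\<mu> \<partial>M)"
    unfolding integral_cong_AE[OF mJ md J] using ip by (simp add: eqP eqN)
qed

text \<open>The left limit is the pointwise limit of step processes that hold the value at the left
  endpoint of each cell. Such a value is known at the start of the cell and used only at later
  times, which is what a predictable rectangle asks for. Outside (0,T] the process is set to
  zero.\<close>

lemma measurable_left_lim:
  fixes Y :: "real \<Rightarrow> 'a \<Rightarrow> 'b::euclidean_space"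
  assumes Y: "\<And>s. s \<in> {0..T} \<Longrightarrow> Y s \<in> borel_measurable (F s)"
    and lim: "\<And>\<omega> s. \<omega> \<in> space M \<Longrightarrow> s \<in> {0<..T} \<Longrightarrow> ((\<lambda>u. Y u \<omega>) \<longlongrightarrow> left_lim (\<lambda>u. Y u \<omega>) s) (at_left s)"
  shows "(\<lambda>(\<omega>, e). indicator {0<..T} (ev_time e) *\<^sub>R left_lim (\<lambda>u. Y u \<omega>) (ev_time e)) \<in> borel_measurable \<P>"
proof (rule borel_measurable_LIMSEQ_metric)
  define G where "G m x = (\<Sum>k<Suc m. indicator {gridpt T m k<..gridpt T m (Suc k)} (ev_time (snd x)) *\<^sub>R Y (gridpt T m k) (fst x))"
    for m and x :: "'a \<times> ev"
  show "G m \<in> borel_measurable \<P>" for m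
    unfolding G_def
  proof (rule borel_measurable_sum)
    fix k assume k: "k \<in> {..<Suc m}"
    let ?a = "gridpt T m k" and ?b = "gridpt T m (Suc k)"
    have a: "?a \<in> {0..T}" using k T gridpt_nonneg[of T] gridpt_le[of T k m] by auto
    show "(\<lambda>x. indicator {?a<..?b} (ev_time (snd x)) *\<^sub>R Y ?a (fst x)) \<in> borel_measurable \<P>"
    proof (rule borel_measurableI)
      fix S :: "'b set" assume S: "open S"
      let ?E = "Y ?a -` S \<inter> space M"
      have E: "?E \<in> sets (F ?a)"
        using measurable_sets[OF Y[OF a] borel_open[OF S]] F_sub(2)[OF a] by simp
      let ?C = "{e. ?a < ev_time e \<and> ev_time e \<le> ?b}"
      have C: "?C \<in> sets borel" by measurable
      have 1: "?E \<times> ?C \<in> sets \<P>" using E a C by (intro predictable_genI) auto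
      have 2: "space M \<times> - ?C \<in> sets \<P>" using C by (intro predictable_genI) auto
      \<comment> \<open>Off the cell the function is 0, so the complement of the cell belongs to the
        preimage exactly when 0 lies in S.\<close>
      have "(\<lambda>x. indicator {?a<..?b} (ev_time (snd x)) *\<^sub>R Y ?a (fst x)) -` S \<inter> space \<P> =
          ?E \<times> ?C \<union> (if 0 \<in> S then space M \<times> - ?C else {})"
      proof (rule set_eqI)
        fix x :: "'a \<times> ev"
        show "x \<in> (\<lambda>x. indicator {?a<..?b} (ev_time (snd x)) *\<^sub>R Y ?a (fst x)) -` S \<inter> space \<P> \<longleftrightarrow>
            x \<in> ?E \<times> ?C \<union> (if 0 \<in> S then space M \<times> - ?C else {})"
          by (cases x; cases "?a < ev_time (snd x) \<and> ev_time (snd x) \<le> ?b") (auto simp: indicator_def)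
      qed
      then show "(\<lambda>x. indicator {?a<..?b} (ev_time (snd x)) *\<^sub>R Y ?a (fst x)) -` S \<inter> space \<P> \<in> sets \<P>"
        using 1 2 by auto
    qed
  qed
  have G: "G m x = indicator {0<..T} (ev_time (snd x)) *\<^sub>R Y (gridpt T m (cell T m (ev_time (snd x)))) (fst x)" for m x
    unfolding G_def by (rule sum_cells[OF T])
  fix x assume x: "x \<in> space \<P>"
  show "(\<lambda>m. G m x) \<longlonglongrightarrow> (case x of (\<omega>, e) \<Rightarrow> indicator {0<..T} (ev_time e) *\<^sub>R left_lim (\<lambda>u. Y u \<omega>) (ev_time e))"
  proof (cases "ev_time (snd x) \<in> {0<..T}")
    case True
    then have s: "0 < ev_time (snd x)" "ev_time (snd x) \<le> T" by auto
    show ?thesis unfolding G split_beta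
      using x True
      by (intro tendsto_scaleR tendsto_const tendsto_at_left_seq[OF lim] gridpt_cell_tendsto s cell_bounds) auto
  qed (simp add: G split_beta)
qed

end

section \<open>Test functions and collision geometry\<close>

lemma C2c_has_derivative: "C2c \<psi> \<Longrightarrow> (\<psi> has_derivative frechet_derivative \<psi> (at p)) (at p)"
  unfolding C2c_def using frechet_derivative_works by blast

text \<open>Differentiability of the directional derivatives gives their continuity, which is the
  form in which the second order of smoothness enters Ito's formula here.\<close>

lemma C2c_continuous_derivative: "C2c \<psi> \<Longrightarrow> continuous_on UNIV (\<lambda>p. frechet_derivative \<psi> (at p) h)"
  unfolding C2c_def by (intro continuous_at_imp_continuous_on ballI differentiable_imp_continuous_within) blast

lemma C2c_continuous: "C2c \<psi> \<Longrightarrow> continuous_on UNIV \<psi>"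
  by (intro continuous_at_imp_continuous_on ballI has_derivative_continuous[OF C2c_has_derivative])

lemma C2c_derivative_outside:
  assumes "C2c \<psi>" "p \<notin> closure {p. \<psi> p \<noteq> 0}"
  shows "frechet_derivative \<psi> (at p) h = 0"
proof -
  have "(\<psi> has_derivative (\<lambda>_. 0)) (at p)"
  proof (rule has_derivative_transform_within_open[of "\<lambda>_. 0" _ _ _ "- closure {p. \<psi> p \<noteq> 0}"])
    fix q assume "q \<in> - closure {p. \<psi> p \<noteq> 0}"
    then have "q \<notin> {p. \<psi> p \<noteq> 0}" using closure_subset[of "{p. \<psi> p \<noteq> 0}"] by auto
    then show "0 = \<psi> q" by simp
  qed (use assms in auto)
  then show ?thesis using has_derivative_unique[OF C2c_has_derivative[OF assms(1)]] by metis
qed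

lemma C2c_bounded:
  assumes "C2c \<psi>" shows "\<exists>C. \<forall>p. \<bar>\<psi> p\<bar> \<le> C"
proof -
  let ?S = "closure {p. \<psi> p \<noteq> 0}"
  have "compact (\<psi> ` ?S)"
    using assms C2c_continuous[OF assms] by (intro compact_continuous_image) (auto simp: C2c_def intro: continuous_on_subset)
  then have "\<exists>C. \<forall>y\<in>\<psi> ` ?S. norm y \<le> C" using compact_imp_bounded bounded_iff by metis
  then obtain C where C: "\<And>p. p \<in> ?S \<Longrightarrow> \<bar>\<psi> p\<bar> \<le> C" by (metis imageI real_norm_def)
  have "\<bar>\<psi> p\<bar> \<le> max C 0" for p
  proof (cases "p \<in> ?S")
    case True then show ?thesis using C[of p] by auto
  next
    case False
    then have "p \<notin> {p. \<psi> p \<noteq> 0}" using closure_subset[of "{p. \<psi> p \<noteq> 0}"] by auto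
    then show ?thesis by simp
  qed
  then show ?thesis by blast
qed

text \<open>Each partial derivative is continuous on the compact support, hence bounded there, and
  vanishes outside. Expanding h in the basis gives L as the sum of these bounds.\<close>

lemma C2c_derivative_bounded:
  assumes "C2c \<psi>" shows "\<exists>L\<ge>0. \<forall>p h. \<bar>frechet_derivative \<psi> (at p) h\<bar> \<le> L * norm h"
proof -
  let ?S = "closure {p. \<psi> p \<noteq> 0}" and ?D = "\<lambda>p. frechet_derivative \<psi> (at p)"
  have "\<exists>C. \<forall>p. \<bar>?D p b\<bar> \<le> C" for b
  proof -
    have "compact ((\<lambda>p. ?D p b) ` ?S)"
      using assms continuous_on_subset[OF C2c_continuous_derivative[OF assms], of ?S b]
      by (intro compact_continuous_image) (simp_all add: C2c_def)
    then have "\<exists>C. \<forall>y\<in>(\<lambda>p. ?D p b) ` ?S. norm y \<le> C" using compact_imp_bounded bounded_iff by metis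
    then obtain C where C: "\<And>p. p \<in> ?S \<Longrightarrow> \<bar>?D p b\<bar> \<le> C" by (metis (no_types, lifting) imageI real_norm_def)
    have "\<bar>?D p b\<bar> \<le> max C 0" for p
      using C[of p] C2c_derivative_outside[OF assms, of p b] by (cases "p \<in> ?S") auto
    then show ?thesis by blast
  qed
  then obtain K where K: "\<And>p b. \<bar>?D p b\<bar> \<le> K b" by metis
  have K0: "0 \<le> K b" for b using K[of undefined b] by linarith
  have "\<bar>?D p h\<bar> \<le> (\<Sum>b\<in>Basis. K b) * norm h" for p h
  proof -
    have lin: "linear (?D p)" using C2c_has_derivative[OF assms] has_derivative_linear by blast
    have "?D p h = ?D p (\<Sum>b\<in>Basis. (h \<bullet> b) *\<^sub>R b)" by (simp add: euclidean_representation)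
    also have "\<dots> = (\<Sum>b\<in>Basis. (h \<bullet> b) * ?D p b)"
      using lin by (simp add: linear_sum linear_cmul)
    also have "\<bar>\<dots>\<bar> \<le> (\<Sum>b\<in>Basis. \<bar>(h \<bullet> b) * ?D p b\<bar>)" by (rule sum_abs)
    also have "\<dots> \<le> (\<Sum>b\<in>Basis. norm h * K b)"
      unfolding abs_mult by (intro sum_mono mult_mono K Basis_le_norm) auto
    finally show ?thesis by (simp add: sum_distrib_left mult.commute)
  qed
  then show ?thesis using K0 by (intro exI[of _ "\<Sum>b\<in>Basis. K b"]) (auto intro: sum_nonneg)
qed

lemma C2c_lipschitz:
  assumes "C2c \<psi>" and "\<And>p h. \<bar>frechet_derivative \<psi> (at p) h\<bar> \<le> L * norm h"
  shows "\<bar>\<psi> p - \<psi> q\<bar> \<le> L * norm (p - q)"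
proof -
  obtain u where "\<psi> (q + (p - q)) - \<psi> q = frechet_derivative \<psi> (at (q + u *\<^sub>R (p - q))) (p - q)"
    using mvt_segment[OF C2c_has_derivative[OF assms(1)], of q "p - q"] by blast
  then show ?thesis using assms(2)[of "q + u *\<^sub>R (p - q)" "p - q"] by (simp del: split_paired_All)
qed

text \<open>The direction z of transport is unbounded, but the derivative vanishes outside a compact
  set, on which z is bounded.\<close>

lemma C2c_transport_bounded:
  assumes "C2c \<psi>" shows "\<exists>K. \<forall>p. \<bar>frechet_derivative \<psi> (at p) (snd p, 0)\<bar> \<le> K"
proof -
  let ?S = "closure {p. \<psi> p \<noteq> 0}"
  obtain L where L: "0 \<le> L" "\<And>p h. \<bar>frechet_derivative \<psi> (at p) h\<bar> \<le> L * norm h"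
    using C2c_derivative_bounded[OF assms] by blast
  have "bounded ?S" using assms by (auto simp: C2c_def compact_imp_bounded)
  then obtain R where R: "\<And>p. p \<in> ?S \<Longrightarrow> norm p \<le> R" by (auto simp: bounded_iff)
  have "\<bar>frechet_derivative \<psi> (at p) (snd p, 0)\<bar> \<le> L * \<bar>R\<bar>" for p
  proof (cases "p \<in> ?S")
    case True
    have "norm (snd p) \<le> norm p" by (cases p) (simp add: norm_Pair real_le_rsqrt)
    then have "norm (snd p) \<le> \<bar>R\<bar>" using R[OF True] by linarith
    then have "L * norm (snd p) \<le> L * \<bar>R\<bar>" using L(1) by (intro mult_left_mono)
    then show ?thesis using L(2)[of p "(snd p, 0)"] by (simp add: norm_Pair)
  next
    case False then show ?thesis using C2c_derivative_outside[OF assms] L(1) by simp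
  qed
  then show ?thesis by blast
qed

text \<open>The direction varies with p, so continuity in p for each fixed direction is used after
  expansion in the basis.\<close>

lemma C2c_transport_measurable:
  assumes "C2c \<psi>"
  shows "(\<lambda>p. frechet_derivative \<psi> (at p) (snd p, 0)) \<in> borel_measurable borel"
proof -
  let ?D = "\<lambda>p. frechet_derivative \<psi> (at p)"
  have m[measurable]: "(\<lambda>p. ?D p h) \<in> borel_measurable borel" for h
    by (rule borel_measurable_continuous_onI[OF C2c_continuous_derivative[OF assms]])
  have eq: "?D p (snd p, 0) = (\<Sum>b\<in>Basis. ((snd p, 0) \<bullet> b) * ?D p b)" for p
  proof -
    have lin: "linear (?D p)" using C2c_has_derivative[OF assms] has_derivative_linear by blast
    have "?D p (snd p, 0) = ?D p (\<Sum>b\<in>Basis. ((snd p, 0) \<bullet> b) *\<^sub>R b)" by (simp only: euclidean_representation)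
    also have "\<dots> = (\<Sum>b\<in>Basis. ((snd p, 0) \<bullet> b) * ?D p b)"
      using lin by (simp add: linear_sum linear_cmul del: euclidean_representation)
    finally show ?thesis .
  qed
  have "(\<lambda>p. ((snd p, 0) :: R3 \<times> R3) \<bullet> b) \<in> borel_measurable borel" for b :: "R3 \<times> R3"
    by (intro borel_measurable_continuous_onI continuous_intros)
  then show "(\<lambda>p. ?D p (snd p, 0)) \<in> borel_measurable borel"
    unfolding eq by (intro borel_measurable_sum borel_measurable_times m)
qed

text \<open>The constant comes from \<open>(sin (\<theta> / 2))\<^sup>2 \<le> \<theta> / 2\<close>,
  \<open>\<bar>sin \<theta> / 2\<bar> \<le> \<theta> / 2\<close> and the triangle bound
  \<open>2 * norm (v - z)\<close> for \<open>Gamma\<close>: in total 3/2, rounded up to 2. The frame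
  says nothing about the zero vector, hence v \<noteq> z.\<close>

lemma norm_alpha_le:
  assumes "collision_frame I J" "v \<noteq> z" "0 \<le> \<theta>"
  shows "norm (alpha I J z v \<theta> \<phi>) \<le> 2 * \<theta> * norm (z - v)"
proof -
  let ?w = "v - z"
  have "let e1 = ?w /\<^sub>R norm ?w; e2 = I ?w /\<^sub>R norm ?w; e3 = J ?w /\<^sub>R norm ?w in
         e1 \<bullet> e1 = 1 \<and> e2 \<bullet> e2 = 1 \<and> e3 \<bullet> e3 = 1 \<and> e1 \<bullet> e2 = 0 \<and> e1 \<bullet> e3 = 0 \<and> e2 \<bullet> e3 = 0"
    using assms(1,2) unfolding collision_frame_def by auto
  then have "norm (I ?w /\<^sub>R norm ?w) = 1" "norm (J ?w /\<^sub>R norm ?w) = 1"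
    unfolding Let_def norm_eq_1 by blast+
  then have IJ: "norm (I ?w) = norm ?w" "norm (J ?w) = norm ?w" using assms(2) by (auto simp: field_simps)
  have G: "norm (Gamma I J ?w \<phi>) \<le> 2 * norm ?w"
  proof -
    have "norm (Gamma I J ?w \<phi>) \<le> \<bar>cos \<phi>\<bar> * norm ?w + \<bar>sin \<phi>\<bar> * norm ?w"
      unfolding Gamma_def using norm_triangle_ineq[of "cos \<phi> *\<^sub>R I ?w" "sin \<phi> *\<^sub>R J ?w"] by (simp add: IJ)
    also have "\<dots> \<le> 1 * norm ?w + 1 * norm ?w" by (intro add_mono mult_right_mono) auto
    finally show ?thesis by simp
  qed
  have s1: "(sin (\<theta> / 2))\<^sup>2 \<le> \<theta> / 2"
  proof -
    have "(sin (\<theta> / 2))\<^sup>2 = \<bar>sin (\<theta> / 2)\<bar> * \<bar>sin (\<theta> / 2)\<bar>" by (simp add: power2_eq_square)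
    also have "\<dots> \<le> 1 * (\<theta> / 2)" using abs_sin_x_le_abs_x[of "\<theta> / 2"] assms(3) by (intro mult_mono) auto
    finally show ?thesis by simp
  qed
  have s2: "\<bar>sin \<theta> / 2\<bar> \<le> \<theta> / 2" using abs_sin_x_le_abs_x[of \<theta>] assms(3) by simp
  have "norm (alpha I J z v \<theta> \<phi>) \<le> (sin (\<theta> / 2))\<^sup>2 * norm ?w + \<bar>sin \<theta> / 2\<bar> * norm (Gamma I J ?w \<phi>)"
    unfolding alpha_def using norm_triangle_ineq[of "(sin (\<theta>/2))\<^sup>2 *\<^sub>R ?w" "(sin \<theta> / 2) *\<^sub>R Gamma I J ?w \<phi>"] by simp
  also have "\<dots> \<le> \<theta> / 2 * norm ?w + \<theta> / 2 * (2 * norm ?w)"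
    using s1 s2 G assms(3) by (intro add_mono mult_mono) auto
  also have "\<dots> \<le> 2 * \<theta> * norm ?w"
  proof -
    have "0 \<le> \<theta> * norm ?w" using assms(3) by simp
    then show ?thesis by (simp add: algebra_simps)
  qed
  finally show ?thesis by (simp add: norm_minus_commute)
qed

lemma measurable_alpha:
  assumes "collision_frame I J"
  shows "(\<lambda>(z, v, \<theta>, \<phi>). alpha I J z v \<theta> \<phi>) \<in> borel_measurable borel"
proof -
  have [measurable]: "I \<in> borel_measurable borel" "J \<in> borel_measurable borel"
    using assms by (auto simp: collision_frame_def)
  have "(\<lambda>p. alpha I J (fst p) (fst (snd p)) (fst (snd (snd p))) (snd (snd (snd p)))) \<in> borel_measurable
      (borel \<Otimes>\<^sub>M (borel \<Otimes>\<^sub>M (borel \<Otimes>\<^sub>M borel)))"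
    unfolding alpha_def Gamma_def by measurable
  then show ?thesis by (simp add: split_beta borel_prod)
qed

text \<open>The density is measurable at each fixed time and differentiable in time. Joint
  measurability follows by rounding the time down to a grid inside [0,\<infinity>), where continuity
  is known.\<close>

lemma measurable_continuous_in_time:
  fixes f :: "real \<Rightarrow> 'b::{second_countable_topology,metric_space} \<Rightarrow> real"
  assumes "\<And>s. 0 \<le> s \<Longrightarrow> f s \<in> borel_measurable borel"
    and "\<And>x s. 0 \<le> s \<Longrightarrow> continuous (at s within {0..}) (\<lambda>s. f s x)"
  shows "(\<lambda>(s, x). f (max 0 s) x) \<in> borel_measurable borel"
proof -
  let ?r = "\<lambda>m (k::nat). real k / real (Suc m)"
  let ?k = "\<lambda>m (s::real). nat \<lfloor>real (Suc m) * max 0 s\<rfloor>"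
  have "(\<lambda>(s, x). f (max 0 s) x) \<in> borel_measurable (borel \<Otimes>\<^sub>M borel)"
  proof (rule borel_measurable_LIMSEQ_real)
    fix p :: "real \<times> 'b"
    let ?s = "max 0 (fst p)"
    have "(\<lambda>m. ?r m (?k m (fst p))) \<longlonglongrightarrow> ?s"
    proof (rule tendsto_sandwich[of "\<lambda>m. ?s - 1 / real (Suc m)" _ _ "\<lambda>_. ?s"])
      have k: "real (?k m (fst p)) \<le> real (Suc m) * ?s" "real (Suc m) * ?s - 1 \<le> real (?k m (fst p))" for m
        by (simp_all add: of_nat_nat)
      show "\<forall>\<^sub>F m in sequentially. ?s - 1 / real (Suc m) \<le> ?r m (?k m (fst p))"
      proof (intro always_eventually allI)
        fix m
        have "?s - 1 / real (Suc m) = (real (Suc m) * ?s - 1) / real (Suc m)" by (simp add: diff_divide_distrib)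
        also have "\<dots> \<le> ?r m (?k m (fst p))" using k(2)[of m] by (intro divide_right_mono) auto
        finally show "?s - 1 / real (Suc m) \<le> ?r m (?k m (fst p))" .
      qed
      show "\<forall>\<^sub>F m in sequentially. ?r m (?k m (fst p)) \<le> ?s"
        using k(1) by (intro always_eventually allI) (simp add: divide_le_eq mult.commute del: of_nat_Suc)
      show "(\<lambda>m. ?s - 1 / real (Suc m)) \<longlonglongrightarrow> ?s"
        using tendsto_diff[OF tendsto_const LIMSEQ_Suc[OF lim_const_over_n[of 1]], of ?s] by simp
    qed simp
    moreover have "continuous (at ?s within {0..}) (\<lambda>s. f s (snd p))" by (rule assms(2)) simp
    ultimately show "(\<lambda>m. f (?r m (?k m (fst p))) (snd p)) \<longlonglongrightarrow> (case p of (s, x) \<Rightarrow> f (max 0 s) x)"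
      unfolding continuous_within_sequentially comp_def split_beta by auto
  next
    fix m
    have "(\<lambda>p. f (?r m k) (snd p)) \<in> borel_measurable (borel \<Otimes>\<^sub>M borel)" for k
      using assms(1)[of "?r m k"] by (intro measurable_compose[OF measurable_snd]) auto
    moreover have "(\<lambda>p. ?k m (fst p)) \<in> measurable (borel \<Otimes>\<^sub>M borel) (count_space UNIV)"
      by measurable
    ultimately show "(\<lambda>p. f (?r m (?k m (fst p))) (snd p)) \<in> borel_measurable (borel \<Otimes>\<^sub>M borel)"
      by (rule measurable_compose_countable)
  qed
  then show ?thesis by (simp add: borel_prod)
qed

section \<open>Collision rates\<close>

lemma sigma_finite_P6: "sigma_finite_measure (P6 :: (R3 \<times> R3) measure)"
  by (intro sigma_finite_pair_measure) (simp_all add: lborel.sigma_finite_measure_axioms)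

lemma sets_P6: "sets (P6 :: (R3 \<times> R3) measure) = sets borel"
  by (simp only: lborel_prod sets_lborel)

lemma borel_measurable_fst: "fst \<in> borel_measurable borel"
  by (intro borel_measurable_continuous_onI continuous_on_fst continuous_on_id)

lemma borel_measurable_snd: "snd \<in> borel_measurable borel"
  by (intro borel_measurable_continuous_onI continuous_on_snd continuous_on_id)

lemma AE_pair_fst:
  assumes "sigma_finite_measure N" "AE x in M. P x"
  shows "AE p in M \<Otimes>\<^sub>M N. P (fst p)"
proof -
  interpret sigma_finite_measure N by fact
  obtain S where S: "{x\<in>space M. \<not> P x} \<subseteq> S" "emeasure M S = 0" "S \<in> sets M" using AE_E[OF assms(2)] .
  have "S \<times> space N \<in> null_sets (M \<Otimes>\<^sub>M N)"
    using S(2,3) by (intro null_setsI) (simp_all add: emeasure_pair_measure_Times)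
  then show ?thesis
    by (rule AE_I') (use S(1) in \<open>auto simp: space_pair_measure\<close>)
qed

locale kinetic =
  fixes I J :: "R3 \<Rightarrow> R3" and Q :: "real measure" and c \<gamma> :: real
    and f df :: "real \<Rightarrow> R3 \<Rightarrow> R3 \<Rightarrow> real" and T :: real
  assumes frame: "collision_frame I J" and hypA: "hypA Q c \<gamma>"
    and dens: "\<forall>t\<ge>0. prob_density6 (f t)" and hypB: "hypB f df \<gamma>" and T: "T > 0"
begin

lemma sets_Q[measurable_cong]: "sets Q = sets borel"
  using hypA by (simp add: hypA_def)

sublocale Q: sigma_finite_measure Q
  using hypA by (simp add: hypA_def)

abbreviation W :: "(R3 \<times> real \<times> real) measure" where
  "W \<equiv> lborel \<Otimes>\<^sub>M (Q \<Otimes>\<^sub>M lborel)"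

lemma sets_W[measurable_cong]: "sets W = sets borel"
proof -
  have "sets W = sets (borel \<Otimes>\<^sub>M (borel \<Otimes>\<^sub>M borel))"
    by (intro sets_pair_measure_cong sets_Q sets_lborel)
  then show ?thesis by (simp only: borel_prod)
qed

lemma sigma_finite_W: "sigma_finite_measure W"
  by (intro sigma_finite_pair_measure Q.sigma_finite_measure_axioms lborel.sigma_finite_measure_axioms)

sublocale W: sigma_finite_measure W by (rule sigma_finite_W)

sublocale P6: sigma_finite_measure "P6 :: (R3 \<times> R3) measure" by (rule sigma_finite_P6)

lemma c_pos: "0 < c" using hypA by (simp add: hypA_def)

lemma gamma_bounds: "-1 < \<gamma>" "\<gamma> \<le> 1" using hypA by (auto simp: hypA_def)

lemma f_nonneg: "0 \<le> t \<Longrightarrow> 0 \<le> f t x z"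
  using dens by (simp add: prob_density6_def)

lemma f_measurable_slice: "0 \<le> t \<Longrightarrow> (\<lambda>p. f t (fst p) (snd p)) \<in> borel_measurable borel"
  using dens measurable_cong_sets[OF sets_P6 refl] unfolding prob_density6_def case_prod_unfold by blast

lemma f_total: "0 \<le> t \<Longrightarrow> (\<integral>\<^sup>+p. ennreal (f t (fst p) (snd p)) \<partial>P6) = 1"
  using dens by (simp add: prob_density6_def case_prod_unfold)

text \<open>Nothing is assumed about \<open>f\<close> at negative times, hence the \<open>max\<close>.\<close>

lemma f_measurable[measurable]: "(\<lambda>(s, x, v). f (max 0 s) x v) \<in> borel_measurable borel"
proof -
  have "(\<lambda>(s, p). (\<lambda>s p. f s (fst p) (snd p)) (max 0 s) p) \<in> borel_measurable (borel :: (real \<times> R3 \<times> R3) measure)"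
  proof (rule measurable_continuous_in_time)
    show "continuous (at s within {0..}) (\<lambda>s. f s (fst p) (snd p))" if "0 \<le> s" for s and p :: "R3 \<times> R3"
      using hypB[unfolded hypB_def, THEN conjunct1, rule_format, OF that] by (rule DERIV_continuous)
  qed (rule f_measurable_slice)
  then show ?thesis by (simp add: case_prod_unfold)
qed

lemma f_measurable'[measurable (raw)]:
  assumes "a \<in> borel_measurable L" "b \<in> borel_measurable L" "d \<in> borel_measurable L"
  shows "(\<lambda>x. f (max 0 (a x)) (b x) (d x)) \<in> borel_measurable L"
proof -
  have "(\<lambda>x. (a x, b x, d x)) \<in> borel_measurable L" using assms by measurable
  from measurable_compose[OF this f_measurable] show ?thesis by simp
qed

lemma marg_measurable'[measurable (raw)]:
  assumes "a \<in> borel_measurable L" "d \<in> borel_measurable L"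
  shows "(\<lambda>x. marg f (max 0 (a x)) (d x)) \<in> borel_measurable L"
proof -
  have "(\<lambda>p. marg f (max 0 (fst p)) (snd p)) \<in> borel_measurable (borel \<Otimes>\<^sub>M borel)"
    unfolding marg_def by measurable
  then have m: "(\<lambda>p. marg f (max 0 (fst p)) (snd p)) \<in> borel_measurable borel" by (simp add: borel_prod)
  have "(\<lambda>x. (a x, d x)) \<in> borel_measurable L" using assms by measurable
  from measurable_compose[OF this m] show ?thesis by simp
qed

lemma cond_measurable'[measurable (raw)]:
  assumes [measurable]: "a \<in> borel_measurable L" "b \<in> borel_measurable L" "d \<in> borel_measurable L"
  shows "(\<lambda>x. cond f (max 0 (a x)) (b x) (d x)) \<in> borel_measurable L"
  unfolding cond_def by measurable

lemma sigma_cs_measurable[measurable]: "sigma_cs c \<gamma> \<in> borel_measurable borel"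
  unfolding sigma_cs_def by measurable

lemma marg_nonneg: "0 \<le> s \<Longrightarrow> 0 \<le> marg f s v"
  by (simp add: marg_def f_nonneg)

lemma cond_nonneg: "0 \<le> s \<Longrightarrow> 0 \<le> cond f s x v"
  by (simp add: cond_def f_nonneg marg_nonneg)

lemma sigma_nonneg: "0 \<le> sigma_cs c \<gamma> r"
  using c_pos by (simp add: sigma_cs_def)

text \<open>The quotient \<open>cond\<close> has the default value 0 where the marginal vanishes,
  and the marginal is itself 0 by default where f is not integrable in x. The latter concerns a null
  set of v, because f has total mass one; for the remaining v with zero marginal, f vanishes for
  almost every x.\<close>

lemma AE_marg_cond:
  assumes s: "0 \<le> s"
  shows "AE x in lborel. AE v in lborel. marg f s v * cond f s x v = f s x v"
proof -
  have ms: "max 0 s = s" using s by simp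
  have fm[measurable]: "(\<lambda>p. f s (fst p) (snd p)) \<in> borel_measurable (lborel \<Otimes>\<^sub>M lborel)"
    using f_measurable_slice[OF s] measurable_cong_sets[OF sets_P6 refl] by blast
  have fs[measurable (raw)]: "(\<lambda>x. f s (b x) (d x)) \<in> borel_measurable L"
    if "b \<in> borel_measurable L" "d \<in> borel_measurable L" for b d and L :: "'l measure"
    using f_measurable'[of "\<lambda>_. s" L b d] that by (simp add: ms)
  have fi[measurable]: "(\<lambda>v. \<integral>\<^sup>+x. ennreal (f s x v) \<partial>lborel) \<in> borel_measurable lborel"
    by (rule lborel.borel_measurable_nn_integral) (unfold case_prod_unfold, measurable)
  have mm[measurable]: "marg f s \<in> borel_measurable borel"
    using marg_measurable'[of "\<lambda>_. s" borel "\<lambda>x. x"] by (simp add: ms)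
  have "(\<integral>\<^sup>+v. \<integral>\<^sup>+x. ennreal (f s x v) \<partial>lborel \<partial>lborel) = 1"
    using f_total[OF s] by (subst (asm) lborel_pair.nn_integral_snd[symmetric]) (simp_all add: split_beta)
  then have "AE v in lborel. (\<integral>\<^sup>+x. ennreal (f s x v) \<partial>lborel) \<noteq> \<infinity>"
    by (intro nn_integral_PInf_AE) auto
  then have "AE v in lborel. AE x in lborel. marg f s v * cond f s x v = f s x v"
  proof eventually_elim
    case (elim v)
    have [measurable]: "(\<lambda>x. f s x v) \<in> borel_measurable lborel"
      using measurable_compose[OF measurable_Pair2'[of v lborel lborel] fm] by simp
    have int: "integrable lborel (\<lambda>x. f s x v)"
      using elim f_nonneg[OF s] by (intro integrableI_nonneg) (auto simp: top.not_eq_extremum)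
    show ?case
    proof (cases "marg f s v = 0")
      case True
      then have "AE x in lborel. f s x v = 0"
        using integral_nonneg_eq_0_iff_AE[OF int] f_nonneg[OF s] by (simp add: marg_def)
      then show ?thesis by eventually_elim (simp add: cond_def)
    qed (simp add: cond_def)
  qed
  \<comment> \<open>The argument runs at fixed v, whereas the process supplies the position; the two
    almost everywhere quantifiers have to be exchanged, which takes measurability of this
    set.\<close>
  moreover have "{x \<in> space P6. marg f s (snd x) * cond f s (fst x) (snd x) = f s (fst x) (snd x)} \<in> sets P6"
    unfolding cond_def by measurable
  ultimately show ?thesis
    by (subst lborel_pair.AE_commute)
qed

text \<open>The order is the one in which the integrals are used: r innermost, because integrating
  it out evaluates the acceptance test, and time outermost, as in the weak formulation.\<close>

lemma nn_integral_PRM_base: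
  assumes "h \<in> borel_measurable (borel :: ev measure)"
  shows "(\<integral>\<^sup>+e. h e \<partial>PRM_base Q) =
    (\<integral>\<^sup>+s. \<integral>\<^sup>+w. \<integral>\<^sup>+r. h (fst w, fst (snd w), snd (snd w), r, s) \<partial>lborel \<partial>W \<partial>lborel)"
proof -
  have hm[measurable]: "h \<in> borel_measurable (borel \<Otimes>\<^sub>M (borel \<Otimes>\<^sub>M (borel \<Otimes>\<^sub>M (borel \<Otimes>\<^sub>M borel))))"
    using assms by (simp add: borel_prod)
  have R: "sigma_finite_measure (lborel \<Otimes>\<^sub>M lborel :: (real \<times> real) measure)"
    by (intro sigma_finite_pair_measure lborel.sigma_finite_measure_axioms)
  have PR: "sigma_finite_measure (lborel \<Otimes>\<^sub>M (lborel \<Otimes>\<^sub>M lborel) :: (real \<times> real \<times> real) measure)"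
    by (intro sigma_finite_pair_measure lborel.sigma_finite_measure_axioms R)
  have QR: "sigma_finite_measure (Q \<Otimes>\<^sub>M (lborel \<Otimes>\<^sub>M (lborel \<Otimes>\<^sub>M lborel)) :: (real \<times> real \<times> real \<times> real) measure)"
    by (intro sigma_finite_pair_measure Q.sigma_finite_measure_axioms PR)
  have Qp: "sigma_finite_measure (Q \<Otimes>\<^sub>M lborel :: (real \<times> real) measure)"
    by (intro sigma_finite_pair_measure Q.sigma_finite_measure_axioms lborel.sigma_finite_measure_axioms)
  note QR_fst = sigma_finite_measure.nn_integral_fst[OF QR, symmetric]
    and PR_fst = sigma_finite_measure.nn_integral_fst[OF PR, symmetric]
    and R_fst = sigma_finite_measure.nn_integral_fst[OF R, symmetric]
    and Qp_fst = sigma_finite_measure.nn_integral_fst[OF Qp, symmetric]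
  interpret WL: pair_sigma_finite W "lborel :: real measure"
    by (intro pair_sigma_finite.intro W.sigma_finite_measure_axioms lborel.sigma_finite_measure_axioms)
  have "(\<integral>\<^sup>+e. h e \<partial>PRM_base Q) = (\<integral>\<^sup>+v. \<integral>\<^sup>+y. h (v, y) \<partial>(Q \<Otimes>\<^sub>M (lborel \<Otimes>\<^sub>M (lborel \<Otimes>\<^sub>M lborel))) \<partial>lborel)"
    unfolding PRM_base_def by (rule QR_fst) measurable
  also have "\<dots> = (\<integral>\<^sup>+v. \<integral>\<^sup>+\<theta>. \<integral>\<^sup>+y. h (v, \<theta>, y) \<partial>(lborel \<Otimes>\<^sub>M (lborel \<Otimes>\<^sub>M lborel)) \<partial>Q \<partial>lborel)"
    by (intro nn_integral_cong PR_fst) measurable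
  also have "\<dots> = (\<integral>\<^sup>+v. \<integral>\<^sup>+\<theta>. \<integral>\<^sup>+\<phi>. \<integral>\<^sup>+y. h (v, \<theta>, \<phi>, y) \<partial>(lborel \<Otimes>\<^sub>M lborel) \<partial>lborel \<partial>Q \<partial>lborel)"
    by (intro nn_integral_cong R_fst) measurable
  also have "\<dots> = (\<integral>\<^sup>+v. \<integral>\<^sup>+\<theta>. \<integral>\<^sup>+\<phi>. \<integral>\<^sup>+s. \<integral>\<^sup>+r. h (v, \<theta>, \<phi>, r, s) \<partial>lborel \<partial>lborel \<partial>lborel \<partial>Q \<partial>lborel)"
    by (intro nn_integral_cong lborel_pair.nn_integral_snd[symmetric]) measurable
  also have "\<dots> = (\<integral>\<^sup>+v. \<integral>\<^sup>+y. \<integral>\<^sup>+s. \<integral>\<^sup>+r. h (v, fst y, snd y, r, s) \<partial>lborel \<partial>lborel \<partial>(Q \<Otimes>\<^sub>M lborel) \<partial>lborel)"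
    by (intro nn_integral_cong) (subst lborel.nn_integral_fst[symmetric], measurable)
  also have "\<dots> = (\<integral>\<^sup>+w. \<integral>\<^sup>+s. \<integral>\<^sup>+r. h (fst w, fst (snd w), snd (snd w), r, s) \<partial>lborel \<partial>lborel \<partial>W)"
  proof (subst Qp_fst)
    have "(\<lambda>w. \<integral>\<^sup>+s. \<integral>\<^sup>+r. h (fst w, fst (snd w), snd (snd w), r, s) \<partial>lborel \<partial>lborel)
        \<in> borel_measurable (borel \<Otimes>\<^sub>M (borel \<Otimes>\<^sub>M borel))" by measurable
    then show "(\<lambda>w. \<integral>\<^sup>+s. \<integral>\<^sup>+r. h (fst w, fst (snd w), snd (snd w), r, s) \<partial>lborel \<partial>lborel) \<in> borel_measurable W"
      using measurable_cong_sets[OF sets_pair_measure_cong[OF sets_lborel sets_pair_measure_cong[OF sets_Q sets_lborel]] refl]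
      by blast
  qed simp
  also have "\<dots> = (\<integral>\<^sup>+s. \<integral>\<^sup>+w. \<integral>\<^sup>+r. h (fst w, fst (snd w), snd (snd w), r, s) \<partial>lborel \<partial>W \<partial>lborel)"
  proof (rule WL.Fubini'[symmetric])
    have "(\<lambda>(p, r). h (fst (fst p), fst (snd (fst p)), snd (snd (fst p)), r, snd p))
        \<in> borel_measurable (((borel \<Otimes>\<^sub>M (borel \<Otimes>\<^sub>M borel)) \<Otimes>\<^sub>M borel) \<Otimes>\<^sub>M borel)" by measurable
    moreover have "sets ((W \<Otimes>\<^sub>M lborel) \<Otimes>\<^sub>M lborel :: (((R3 \<times> real \<times> real) \<times> real) \<times> real) measure) =
        sets (((borel \<Otimes>\<^sub>M (borel \<Otimes>\<^sub>M borel)) \<Otimes>\<^sub>M borel) \<Otimes>\<^sub>M borel)"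
      by (intro sets_pair_measure_cong sets_Q sets_lborel)
    ultimately have "(\<lambda>(p, r). h (fst (fst p), fst (snd (fst p)), snd (snd (fst p)), r, snd p))
        \<in> borel_measurable ((W \<Otimes>\<^sub>M lborel) \<Otimes>\<^sub>M lborel)"
      using measurable_cong_sets by blast
    from lborel.borel_measurable_nn_integral[OF this]
    show "(\<lambda>(w, s). \<integral>\<^sup>+r. h (fst w, fst (snd w), snd (snd w), r, s) \<partial>lborel) \<in> borel_measurable (W \<Otimes>\<^sub>M lborel)"
      by (simp add: case_prod_unfold)
  qed
  finally show ?thesis .
qed

text \<open>Expected rate of collisions at time s, weighted by h: the state y has density
  \<open>f s\<close> and the velocity of the partner is weighted by \<open>f s\<close> at the same
  position. Taking the two signs of the change of \<psi> as weights gives the two parts of the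
  collision operator tested against f.\<close>

definition rate :: "(R3 \<times> R3 \<Rightarrow> R3 \<times> real \<times> real \<Rightarrow> ennreal) \<Rightarrow> real \<Rightarrow> ennreal" where
  "rate h s = (\<integral>\<^sup>+y. ennreal (f s (fst y) (snd y)) *
     (\<integral>\<^sup>+w. indicator (UNIV \<times> Xi) w * h y w * ennreal (f s (fst y) (fst w) * sigma_cs c \<gamma> (norm (snd y - fst w))) \<partial>W) \<partial>P6)"

text \<open>The thinning indicator of the equation, with the state as an argument so that it can be
  evaluated at left limits.\<close>

definition accepted :: "real \<Rightarrow> R3 \<times> R3 \<Rightarrow> ev \<Rightarrow> real" where
  "accepted t y e = (case e of (v, \<theta>, \<phi>, r, s) \<Rightarrow> indicator {0<..t} s * indicator Xi (\<theta>, \<phi>) *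
     indicator {0..sigma_cs c \<gamma> (norm (snd y - v)) * cond f s (fst y) v} r)"

definition mark :: "ev \<Rightarrow> R3 \<times> real \<times> real" where
  "mark e = (fst e, fst (snd e), fst (snd (snd e)))"

lemma Xi_borel[measurable]: "Xi \<in> sets borel"
proof -
  have "Xi \<in> sets (borel \<Otimes>\<^sub>M borel)" unfolding Xi_def by measurable
  then show ?thesis by (simp only: borel_prod)
qed

lemma accepted_measurable:
  "(\<lambda>(y, e). accepted t y e) \<in> borel_measurable (borel :: ((R3 \<times> R3) \<times> ev) measure)"
proof -
  have Xi': "Xi \<in> sets (borel \<Otimes>\<^sub>M borel)" using Xi_borel by (simp only: borel_prod)
  \<comment> \<open>Replacing s by \<open>max 0 s\<close> is harmless because the first indicator
    forces s > 0; it makes the jointly measurable extension of f applicable.\<close>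
  have eq: "(\<lambda>(y, e). accepted t y e) = (\<lambda>(y, (v, \<theta>, \<phi>, r, s)). indicator {0<..t} s * indicator Xi (\<theta>, \<phi>) *
     (if 0 \<le> r \<and> r \<le> sigma_cs c \<gamma> (norm (snd y - v)) * cond f (max 0 s) (fst y) v then 1 else 0 :: real))"
    by (auto simp: accepted_def indicator_def max_def fun_eq_iff)
  show ?thesis unfolding eq borel_prod[symmetric] using Xi' by measurable
qed

lemma measurable_mark: "mark \<in> measurable borel borel"
  unfolding mark_def by (intro borel_measurable_continuous_onI continuous_intros)

lemma UNIV_Times_Xi_borel: "UNIV \<times> Xi \<in> sets (borel :: (R3 \<times> real \<times> real) measure)"
proof -
  have "UNIV \<times> Xi \<in> sets (borel \<Otimes>\<^sub>M borel :: (R3 \<times> real \<times> real) measure)"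
    using Xi_borel by (intro pair_measureI) auto
  then show ?thesis by (simp only: borel_prod)
qed

lemma PRM_region_borel: "PRM_region T \<in> sets borel"
proof -
  have "PRM_region T \<in> sets (borel \<Otimes>\<^sub>M (borel \<Otimes>\<^sub>M (borel \<Otimes>\<^sub>M (borel \<Otimes>\<^sub>M borel))))"
    unfolding PRM_region_def by (intro pair_measureI) auto
  then show ?thesis by (simp only: borel_prod)
qed

lemma sets_PRM_base: "sets (PRM_base Q) = sets borel"
proof -
  have "sets (PRM_base Q) = sets (borel \<Otimes>\<^sub>M (borel \<Otimes>\<^sub>M (borel \<Otimes>\<^sub>M (borel \<Otimes>\<^sub>M borel))))"
    unfolding PRM_base_def by (intro sets_pair_measure_cong sets_Q sets_lborel)
  then show ?thesis by (simp only: borel_prod)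
qed

lemma intensity_eq: "intensity Q f T =
    density (PRM_base Q) (\<lambda>e. ennreal (marg f (max 0 (ev_time e)) (fst e)) * indicator (PRM_region T) e)"
  unfolding intensity_def
  by (intro arg_cong[where f="density (PRM_base Q)"] ext)
     (auto simp: PRM_region_def ev_time_def max_def split: split_indicator)

lemma intensity_density_measurable:
  "(\<lambda>e. ennreal (marg f (max 0 (ev_time e)) (fst e)) * indicator (PRM_region T) e) \<in> borel_measurable borel"
proof -
  show ?thesis
    by (intro borel_measurable_times_ennreal measurable_compose[OF _ measurable_ennreal] marg_measurable'
        measurable_ev_time borel_measurable_fst borel_measurable_indicator PRM_region_borel)
qed

text \<open>This is why thinning yields the right intensity. Integrating r over the acceptance
  interval gives its length \<open>sigma_cs\<close> times \<open>cond\<close>; the density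
  \<open>marg\<close> of the intensity multiplies it, and \<open>marg\<close> times
  \<open>cond\<close> is f almost everywhere. The law of Y at each time then turns the expectation
  into an integral against \<open>f s\<close>.\<close>

lemma expected_intensity:
  fixes h :: "R3 \<times> R3 \<Rightarrow> R3 \<times> real \<times> real \<Rightarrow> ennreal" and M :: "'a measure" and Y :: "real \<Rightarrow> 'a \<Rightarrow> R3 \<times> R3"
  assumes M: "prob_space M" and t: "0 < t" "t \<le> T"
    and h: "(\<lambda>(y, w). h y w) \<in> borel_measurable borel"
    and Y: "(\<lambda>(\<omega>, s). Y s \<omega>) \<in> borel_measurable (M \<Otimes>\<^sub>M borel)"
    and law: "\<And>s. s \<in> {0<..t} \<Longrightarrow> distr M P6 (Y s) = density P6 (\<lambda>(x,z). ennreal (f s x z))"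
  shows "(\<integral>\<^sup>+\<omega>. \<integral>\<^sup>+e. ennreal (accepted t (Y (ev_time e) \<omega>) e) * h (Y (ev_time e) \<omega>) (mark e) \<partial>intensity Q f T \<partial>M)
       = (\<integral>\<^sup>+s. indicator {0<..t} s * rate h s \<partial>lborel)"
proof -
  interpret prob_space M by (rule M)
  interpret MT: pair_sigma_finite M "lborel :: real measure"
    by (intro pair_sigma_finite.intro sigma_finite_measure_axioms lborel.sigma_finite_measure_axioms)
  let ?e = "\<lambda>w r s. (fst w, fst (snd w), snd (snd w), r, s) :: ev"
  define G where "G y e = ennreal (marg f (max 0 (ev_time e)) (fst e)) * indicator (PRM_region T) e *
      (ennreal (accepted t y e) * h y (mark e))" for y e
  have hm: "(\<lambda>x. h (a x) (b x)) \<in> borel_measurable L"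
    if "a \<in> measurable L borel" "b \<in> measurable L borel" for a b and L :: "'l measure"
    using measurable_compose[OF borel_measurable_Pair[OF that] h] by simp
  have am: "(\<lambda>x. accepted t (a x) (b x)) \<in> borel_measurable L"
    if "a \<in> measurable L borel" "b \<in> measurable L borel" for a b and L :: "'l measure"
    using measurable_compose[OF borel_measurable_Pair[OF that] accepted_measurable] by simp
  have Gm: "(\<lambda>x. G (a x) (b x)) \<in> borel_measurable L"
    if [measurable]: "a \<in> measurable L borel" "b \<in> measurable L borel" for a b and L :: "'l measure"
  proof -
    have [measurable]: "(\<lambda>x. mark (b x)) \<in> measurable L borel"
      using measurable_compose[OF that(2) measurable_mark] .
    have [measurable]: "(\<lambda>x. ev_time (b x)) \<in> measurable L borel"
      using measurable_compose[OF that(2) measurable_ev_time] .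
    have [measurable]: "(\<lambda>x. fst (b x)) \<in> measurable L borel"
      by (rule measurable_compose[OF that(2) borel_measurable_fst])
    have [measurable]: "(\<lambda>x. indicator (PRM_region T) (b x) :: ennreal) \<in> borel_measurable L"
      using measurable_compose[OF that(2) borel_measurable_indicator[OF PRM_region_borel]] .
    show ?thesis unfolding G_def
      by (intro borel_measurable_times_ennreal measurable_compose[OF _ measurable_ennreal] marg_measurable' hm am) measurable
  qed
  have Ym: "(\<lambda>x. Y (b x) (a x)) \<in> measurable L borel"
    if "a \<in> measurable L M" "b \<in> measurable L borel" for a b and L :: "'l measure"
    using measurable_compose[OF measurable_Pair[OF that] Y] by simp
  \<comment> \<open>What remains of the integral of \<open>G\<close> over the marks at time s once r
    has been integrated out.\<close>
  define K where "K y s = indicator {0<..t} s * (\<integral>\<^sup>+w. indicator (UNIV \<times> Xi) w * h y w *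
      ennreal (marg f (max 0 s) (fst w) * (sigma_cs c \<gamma> (norm (snd y - fst w)) * cond f (max 0 s) (fst y) (fst w))) \<partial>W)" for y s
  have inner: "(\<integral>\<^sup>+r. G y (?e w r s) \<partial>lborel) = indicator {0<..t} s * (indicator (UNIV \<times> Xi) w * h y w *
      ennreal (marg f (max 0 s) (fst w) * (sigma_cs c \<gamma> (norm (snd y - fst w)) * cond f (max 0 s) (fst y) (fst w))))" for y w s
  proof -
    let ?a = "sigma_cs c \<gamma> (norm (snd y - fst w)) * cond f (max 0 s) (fst y) (fst w)"
    have a: "0 \<le> ?a" using sigma_nonneg cond_nonneg by simp
    have "G y (?e w r s) = indicator {0<..t} s * indicator (UNIV \<times> Xi) w * h y w * ennreal (marg f (max 0 s) (fst w)) * indicator {0..?a} r" for r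
      using t by (cases w) (auto simp: G_def accepted_def PRM_region_def mark_def ev_time_def Xi_def max_def indicator_def mult_ac)
    then have "(\<integral>\<^sup>+r. G y (?e w r s) \<partial>lborel) = indicator {0<..t} s * indicator (UNIV \<times> Xi) w * h y w * ennreal (marg f (max 0 s) (fst w)) * ennreal ?a"
      using a by (simp add: nn_integral_cmult_indicator)
    then show ?thesis using a marg_nonneg[of "max 0 s" "fst w"] by (simp add: ennreal_mult mult_ac)
  qed
  have jm: "(\<lambda>(p, w). indicator (UNIV \<times> Xi) w * h (a p) w *
      ennreal (marg f (max 0 (b p)) (fst w) * (sigma_cs c \<gamma> (norm (snd (a p) - fst w)) * cond f (max 0 (b p)) (fst (a p)) (fst w))))
      \<in> borel_measurable (L \<Otimes>\<^sub>M W)" if [measurable]: "a \<in> measurable L borel" "b \<in> measurable L borel" for a b and L :: "'l measure"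
  proof -
    let ?R = "L \<Otimes>\<^sub>M W"
    have W: "measurable ?R W = measurable ?R borel" by (rule measurable_cong_sets[OF refl sets_W])
    have w: "snd \<in> measurable ?R borel" unfolding W[symmetric] by (rule measurable_snd)
    have a: "(\<lambda>p. a (fst p)) \<in> measurable ?R borel" by (rule measurable_compose[OF measurable_fst that(1)])
    have [measurable]: "(\<lambda>p. b (fst p)) \<in> measurable ?R borel" by (rule measurable_compose[OF measurable_fst that(2)])
    have [measurable]: "(\<lambda>p. fst (snd p)) \<in> measurable ?R borel" by (rule measurable_compose[OF w borel_measurable_fst])
    have [measurable]: "(\<lambda>p. fst (a (fst p))) \<in> measurable ?R borel" by (rule measurable_compose[OF a borel_measurable_fst])
    have [measurable]: "(\<lambda>p. snd (a (fst p))) \<in> measurable ?R borel" by (rule measurable_compose[OF a borel_measurable_snd])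
    have "(\<lambda>p. indicator (UNIV \<times> Xi) (snd p) :: ennreal) \<in> borel_measurable ?R"
      by (rule measurable_compose[OF w borel_measurable_indicator[OF UNIV_Times_Xi_borel]])
    moreover have "(\<lambda>p. marg f (max 0 (b (fst p))) (fst (snd p)) * (sigma_cs c \<gamma> (norm (snd (a (fst p)) - fst (snd p))) *
         cond f (max 0 (b (fst p))) (fst (a (fst p))) (fst (snd p)))) \<in> borel_measurable ?R"
      by (intro borel_measurable_times marg_measurable' cond_measurable' measurable_compose[OF _ sigma_cs_measurable]
          borel_measurable_norm borel_measurable_diff) measurable
    ultimately show ?thesis unfolding case_prod_unfold
      by (intro borel_measurable_times_ennreal measurable_compose[OF _ measurable_ennreal] hm[OF a w])
  qed
  have Kb: "(\<lambda>x. K (a x) (b x)) \<in> borel_measurable L"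
    if [measurable]: "a \<in> measurable L borel" "b \<in> measurable L borel" for a b and L :: "'l measure"
    unfolding K_def using W.borel_measurable_nn_integral[OF jm[OF that]] by measurable
  have K: "(\<integral>\<^sup>+w. \<integral>\<^sup>+r. G y (?e w r s) \<partial>lborel \<partial>W) = K y s" for y s
    unfolding inner K_def
    using measurable_compose[OF measurable_Pair1' jm[of "\<lambda>_. y" "count_space UNIV" "\<lambda>_. s"], of undefined]
    by (intro nn_integral_cmult) simp
  have "(\<integral>\<^sup>+\<omega>. \<integral>\<^sup>+e. ennreal (accepted t (Y (ev_time e) \<omega>) e) * h (Y (ev_time e) \<omega>) (mark e) \<partial>intensity Q f T \<partial>M)
      = (\<integral>\<^sup>+\<omega>. \<integral>\<^sup>+e. G (Y (ev_time e) \<omega>) e \<partial>PRM_base Q \<partial>M)"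
  proof (rule nn_integral_cong)
    fix \<omega> assume \<omega>: "\<omega> \<in> space M"
    have Y\<omega>: "(\<lambda>e. Y (ev_time e) \<omega>) \<in> measurable borel borel"
      by (rule Ym[OF measurable_const[OF \<omega>] measurable_ev_time])
    have "(\<lambda>e. ennreal (accepted t (Y (ev_time e) \<omega>) e) * h (Y (ev_time e) \<omega>) (mark e)) \<in> borel_measurable (borel :: ev measure)"
      by (intro borel_measurable_times_ennreal measurable_compose[OF _ measurable_ennreal] hm am Y\<omega> measurable_mark measurable_ident_sets[OF refl])
    then show "(\<integral>\<^sup>+e. ennreal (accepted t (Y (ev_time e) \<omega>) e) * h (Y (ev_time e) \<omega>) (mark e) \<partial>intensity Q f T)
      = (\<integral>\<^sup>+e. G (Y (ev_time e) \<omega>) e \<partial>PRM_base Q)"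
      unfolding G_def intensity_eq
      by (intro nn_integral_density) (simp_all add: intensity_density_measurable measurable_cong_sets[OF sets_PRM_base refl])
  qed
  also have "\<dots> = (\<integral>\<^sup>+\<omega>. \<integral>\<^sup>+s. K (Y s \<omega>) s \<partial>lborel \<partial>M)"
  proof (rule nn_integral_cong)
    fix \<omega> assume \<omega>: "\<omega> \<in> space M"
    have Y\<omega>: "(\<lambda>e. Y (ev_time e) \<omega>) \<in> measurable borel borel"
      by (rule Ym[OF measurable_const[OF \<omega>] measurable_ev_time])
    show "(\<integral>\<^sup>+e. G (Y (ev_time e) \<omega>) e \<partial>PRM_base Q) = (\<integral>\<^sup>+s. K (Y s \<omega>) s \<partial>lborel)"
      by (subst nn_integral_PRM_base) (use Gm[OF Y\<omega> measurable_ident_sets[OF refl]] in \<open>simp_all add: K ev_time_def\<close>)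
  qed
  also have "\<dots> = (\<integral>\<^sup>+s. \<integral>\<^sup>+\<omega>. K (Y s \<omega>) s \<partial>M \<partial>lborel)"
    by (rule MT.Fubini'[symmetric]) (unfold case_prod_unfold, intro Kb Ym measurable_fst measurable_snd[of M lborel, unfolded measurable_lborel1])
  also have "\<dots> = (\<integral>\<^sup>+s. indicator {0<..t} s * rate h s \<partial>lborel)"
  proof (rule nn_integral_cong)
    fix s :: real
    show "(\<integral>\<^sup>+\<omega>. K (Y s \<omega>) s \<partial>M) = indicator {0<..t} s * rate h s"
    proof (cases "s \<in> {0<..t}")
      case True
      then have s: "0 \<le> s" "max 0 s = s" by auto
      have Ys: "Y s \<in> measurable M P6"
        unfolding measurable_cong_sets[OF refl sets_P6] by (rule Ym[OF measurable_ident_sets[OF refl] measurable_const]) simp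
      have Ks: "(\<lambda>y. K y s) \<in> borel_measurable P6"
        unfolding measurable_cong_sets[OF sets_P6 refl] by (rule Kb[OF measurable_ident_sets[OF refl] measurable_const]) simp
      have fs: "(\<lambda>(x, z). ennreal (f s x z)) \<in> borel_measurable P6"
        unfolding measurable_cong_sets[OF sets_P6 refl] case_prod_unfold
        by (rule measurable_compose[OF f_measurable_slice[OF s(1)] measurable_ennreal])
      have "(\<integral>\<^sup>+\<omega>. K (Y s \<omega>) s \<partial>M) = (\<integral>\<^sup>+y. K y s \<partial>distr M P6 (Y s))"
      proof (rule nn_integral_distr[OF Ys, symmetric])
        show "(\<lambda>y. K y s) \<in> borel_measurable (distr M P6 (Y s))" unfolding measurable_distr_eq1 by (rule Ks)
      qed
      also have "\<dots> = (\<integral>\<^sup>+y. ennreal (f s (fst y) (snd y)) * K y s \<partial>P6)"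
        unfolding law[OF True] using nn_integral_density[OF fs Ks] by (simp add: case_prod_unfold)
      also have "\<dots> = rate h s"
        unfolding rate_def
      proof (rule nn_integral_cong_AE)
        \<comment> \<open>The identity for the conditional density may fail on a null set of states,
          which the law of Y does not charge because it has a density.\<close>
        have "AE y in P6. AE v in lborel. marg f s v * cond f s (fst y) v = f s (fst y) v"
          by (rule AE_pair_fst[OF lborel.sigma_finite_measure_axioms AE_marg_cond[OF s(1)]])
        then show "AE y in P6. ennreal (f s (fst y) (snd y)) * K y s = ennreal (f s (fst y) (snd y)) *
            (\<integral>\<^sup>+w. indicator (UNIV \<times> Xi) w * h y w * ennreal (f s (fst y) (fst w) * sigma_cs c \<gamma> (norm (snd y - fst w))) \<partial>W)"
        proof eventually_elim
          case (elim y)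
          have "sigma_finite_measure (Q \<Otimes>\<^sub>M lborel :: (real \<times> real) measure)"
            by (intro sigma_finite_pair_measure Q.sigma_finite_measure_axioms lborel.sigma_finite_measure_axioms)
          from AE_pair_fst[OF this elim]
          have "(\<integral>\<^sup>+w. indicator (UNIV \<times> Xi) w * h y w *
              ennreal (marg f s (fst w) * (sigma_cs c \<gamma> (norm (snd y - fst w)) * cond f s (fst y) (fst w))) \<partial>W)
            = (\<integral>\<^sup>+w. indicator (UNIV \<times> Xi) w * h y w * ennreal (f s (fst y) (fst w) * sigma_cs c \<gamma> (norm (snd y - fst w))) \<partial>W)"
          proof (intro nn_integral_cong_AE, elim eventually_mono)
            fix w :: "R3 \<times> real \<times> real" assume eq: "marg f s (fst w) * cond f s (fst y) (fst w) = f s (fst y) (fst w)"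
            have "marg f s (fst w) * (sigma_cs c \<gamma> (norm (snd y - fst w)) * cond f s (fst y) (fst w))
                = f s (fst y) (fst w) * sigma_cs c \<gamma> (norm (snd y - fst w))"
              by (simp add: eq[symmetric] mult_ac)
            then show "indicator (UNIV \<times> Xi) w * h y w *
              ennreal (marg f s (fst w) * (sigma_cs c \<gamma> (norm (snd y - fst w)) * cond f s (fst y) (fst w)))
              = indicator (UNIV \<times> Xi) w * h y w * ennreal (f s (fst y) (fst w) * sigma_cs c \<gamma> (norm (snd y - fst w)))" by (simp only:)
          qed
          then have "K y s = (\<integral>\<^sup>+w. indicator (UNIV \<times> Xi) w * h y w * ennreal (f s (fst y) (fst w) * sigma_cs c \<gamma> (norm (snd y - fst w))) \<partial>W)"
            unfolding K_def s(2) using True by simp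
          then show ?case by simp
        qed
      qed
      finally show ?thesis using True by simp
    qed (simp add: K_def)
  qed
  finally show ?thesis .
qed

end

text \<open>Follows from d \<le> 2 max(a,b), with 4 as the value of 2 to the largest admissible
  power. It is applied with \<open>p = 1 + \<gamma>\<close>, which lies in (0,2].\<close>

lemma powr_diff_le:
  fixes a b p :: real
  assumes "0 \<le> a" "0 \<le> b" "d \<le> a + b" "0 \<le> d" "0 < p" "p \<le> 2"
  shows "d powr p \<le> 4 * (a powr p + b powr p)"
proof -
  have "d powr p \<le> (2 * max a b) powr p"
    using assms by (intro powr_mono2) auto
  also have "\<dots> = 2 powr p * max a b powr p" by (rule powr_mult)
  also have "\<dots> \<le> 2 powr 2 * (a powr p + b powr p)"
    using assms by (intro mult_mono powr_mono) (auto simp: max_def)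
  finally show ?thesis by simp
qed

section \<open>Finiteness of the collision rates from the moment bound\<close>

context kinetic
begin

lemma measurable_W: "measurable W L = measurable borel L"
  by (rule measurable_cong_sets[OF sets_W refl])

lemma nn_integral_W_prod:
  assumes [measurable]: "a \<in> borel_measurable borel" "b \<in> borel_measurable borel" "d \<in> borel_measurable borel"
  shows "(\<integral>\<^sup>+w. a (fst w) * (b (fst (snd w)) * d (snd (snd w))) \<partial>W) =
    (\<integral>\<^sup>+v. a v \<partial>lborel) * ((\<integral>\<^sup>+\<theta>. b \<theta> \<partial>Q) * (\<integral>\<^sup>+\<phi>. d \<phi> \<partial>lborel))"
proof -
  have Qp: "sigma_finite_measure (Q \<Otimes>\<^sub>M lborel :: (real \<times> real) measure)"
    by (intro sigma_finite_pair_measure Q.sigma_finite_measure_axioms lborel.sigma_finite_measure_axioms)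
  have bQ[measurable]: "b \<in> borel_measurable Q"
    unfolding measurable_cong_sets[OF sets_Q refl] by (rule assms(2))
  have "(\<integral>\<^sup>+w. a (fst w) * (b (fst (snd w)) * d (snd (snd w))) \<partial>W) =
      (\<integral>\<^sup>+v. \<integral>\<^sup>+y. a v * (b (fst y) * d (snd y)) \<partial>(Q \<Otimes>\<^sub>M lborel) \<partial>lborel)"
  proof (subst sigma_finite_measure.nn_integral_fst[OF Qp, symmetric])
    show "(\<lambda>w. a (fst w) * (b (fst (snd w)) * d (snd (snd w)))) \<in> borel_measurable W"
      unfolding measurable_W
      by (intro borel_measurable_times_ennreal measurable_compose[OF borel_measurable_fst assms(1)]
          measurable_compose[OF measurable_compose[OF borel_measurable_snd borel_measurable_fst] assms(2)]
          measurable_compose[OF measurable_compose[OF borel_measurable_snd borel_measurable_snd] assms(3)])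
  qed simp
  also have "\<dots> = (\<integral>\<^sup>+v. a v * (\<integral>\<^sup>+y. b (fst y) * d (snd y) \<partial>(Q \<Otimes>\<^sub>M lborel)) \<partial>lborel)"
    by (intro nn_integral_cong nn_integral_cmult) measurable
  also have "\<dots> = (\<integral>\<^sup>+v. a v \<partial>lborel) * (\<integral>\<^sup>+y. b (fst y) * d (snd y) \<partial>(Q \<Otimes>\<^sub>M lborel))"
    by (rule nn_integral_multc) simp
  also have "(\<integral>\<^sup>+y. b (fst y) * d (snd y) \<partial>(Q \<Otimes>\<^sub>M lborel)) = (\<integral>\<^sup>+\<theta>. b \<theta> \<partial>Q) * (\<integral>\<^sup>+\<phi>. d \<phi> \<partial>lborel)"
  proof -
    have "(\<integral>\<^sup>+y. b (fst y) * d (snd y) \<partial>(Q \<Otimes>\<^sub>M lborel)) = (\<integral>\<^sup>+\<theta>. \<integral>\<^sup>+\<phi>. b \<theta> * d \<phi> \<partial>lborel \<partial>Q)"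
      by (subst lborel.nn_integral_fst[symmetric]) simp_all
    also have "\<dots> = (\<integral>\<^sup>+\<theta>. b \<theta> * (\<integral>\<^sup>+\<phi>. d \<phi> \<partial>lborel) \<partial>Q)"
      by (intro nn_integral_cong nn_integral_cmult) simp
    also have "\<dots> = (\<integral>\<^sup>+\<theta>. b \<theta> \<partial>Q) * (\<integral>\<^sup>+\<phi>. d \<phi> \<partial>lborel)"
      by (rule nn_integral_multc) simp
    finally show ?thesis .
  qed
  finally show ?thesis .
qed

lemma theta_integral_finite: "(\<integral>\<^sup>+\<theta>. ennreal \<theta> * indicator {0<..pi} \<theta> \<partial>Q) < \<infinity>"
  using hypA unfolding hypA_def by simp

text \<open>The factor 8 is 2 from the bound on \<alpha> times 4 from \<open>powr_diff_le\<close>; c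
  belongs to the cross section, the integral over \<theta> is finite by hypothesis A, and
  \<open>2 * pi\<close> is the length of the range of \<phi>.\<close>

definition rate_const :: "real \<Rightarrow> ennreal" where
  "rate_const L = ennreal (8 * L * c) * ((\<integral>\<^sup>+\<theta>. ennreal \<theta> * indicator {0<..pi} \<theta> \<partial>Q) * ennreal (2 * pi))"

text \<open>The relative speed enters as \<open>\<bar>z - v\<bar> powr (1 + \<gamma>)\<close>, one power from \<open>\<bar>\<alpha>\<bar>\<close> and \<open>\<gamma>\<close> from
  the cross section.  Putting the moment on either particle and integrating the other one out leaves
  the spatial density, whose total mass is one.\<close>

lemma rate_le:
  assumes s: "0 \<le> s" and L: "0 \<le> L"
    and h: "\<And>y v \<theta> \<phi>. v \<noteq> snd y \<Longrightarrow> 0 < \<theta> \<Longrightarrow> h y (v, \<theta>, \<phi>) \<le> ennreal (L * (2 * \<theta> * norm (snd y - v)))"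
  shows "rate h s \<le> rate_const L * (2 * moment_sup f \<gamma> s)"
proof -
  let ?p = "1 + \<gamma>"
  let ?C = "\<integral>\<^sup>+\<theta>. ennreal \<theta> * indicator {0<..pi} \<theta> \<partial>Q"
  have ms: "max 0 s = s" using s by simp
  have fs[measurable (raw)]: "(\<lambda>x. f s (b x) (d x)) \<in> borel_measurable L"
    if "b \<in> borel_measurable L" "d \<in> borel_measurable L" for b d and L :: "'l measure"
    using f_measurable'[of "\<lambda>_. s" L b d] that by (simp add: ms)
  have inner: "(\<integral>\<^sup>+w. indicator (UNIV \<times> Xi) w * h (x, z) w * ennreal (f s x (fst w) * sigma_cs c \<gamma> (norm (z - fst w))) \<partial>W)
     \<le> rate_const L * (\<integral>\<^sup>+v. (ennreal (norm z powr ?p) + ennreal (norm v powr ?p)) * ennreal (f s x v) \<partial>lborel)" for x z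
  proof -
    \<comment> \<open>The bound is a product of functions of v, \<theta> and \<phi>, so that its
      integral over \<open>W\<close> factorizes.\<close>
    have pt: "indicator (UNIV \<times> Xi) w * h (x, z) w * ennreal (f s x (fst w) * sigma_cs c \<gamma> (norm (z - fst w)))
      \<le> (ennreal (8 * L * c) * ((ennreal (norm z powr ?p) + ennreal (norm (fst w) powr ?p)) * ennreal (f s x (fst w)))) *
         ((ennreal (fst (snd w)) * indicator {0<..pi} (fst (snd w))) * indicator {0..2*pi} (snd (snd w)))" for w
    proof -
      obtain v \<theta> \<phi> where w: "w = (v, \<theta>, \<phi>)" by (cases w)
      show ?thesis
      proof (cases "(\<theta>, \<phi>) \<in> Xi \<and> v \<noteq> z")
        \<comment> \<open>For v = z no bound on h is available, but the cross section is 0 there,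
          also for negative \<gamma>, by the convention \<open>0 powr \<gamma> = 0\<close>.\<close>
        case False
        then show ?thesis by (auto simp: w sigma_cs_def indicator_def)
      next
        case True
        then have \<theta>: "0 < \<theta>" "\<theta> \<le> pi" "0 \<le> \<phi>" "\<phi> < 2 * pi" and vz: "v \<noteq> z" by (auto simp: Xi_def)
        let ?d = "norm (z - v)" and ?F = "f s x v"
        have F: "0 \<le> ?F" using f_nonneg[OF s] .
        have d: "0 < ?d" using vz by simp
        have dp: "?d * ?d powr \<gamma> = ?d powr ?p" using d by (simp add: powr_add)
        have dle: "?d powr ?p \<le> 4 * (norm z powr ?p + norm v powr ?p)"
          using gamma_bounds norm_triangle_ineq4[of z v] by (intro powr_diff_le) auto
        have "h (x, z) w * ennreal (?F * sigma_cs c \<gamma> ?d) \<le> ennreal (L * (2 * \<theta> * ?d)) * ennreal (?F * sigma_cs c \<gamma> ?d)"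
          unfolding w using h[of v "(x, z)" \<theta> \<phi>] vz \<theta> by (intro mult_right_mono) auto
        also have "\<dots> = ennreal (L * (2 * \<theta> * ?d) * (?F * sigma_cs c \<gamma> ?d))"
          using L \<theta> F sigma_nonneg by (intro ennreal_mult[symmetric]) auto
        also have "L * (2 * \<theta> * ?d) * (?F * sigma_cs c \<gamma> ?d) = (2 * L * c * \<theta> * ?F) * (?d * ?d powr \<gamma>)"
          by (simp add: sigma_cs_def mult_ac)
        also have "\<dots> \<le> (2 * L * c * \<theta> * ?F) * (4 * (norm z powr ?p + norm v powr ?p))"
          unfolding dp using dle L c_pos \<theta> F by (intro mult_left_mono) auto
        also have "\<dots> = (8 * L * c) * ((norm z powr ?p + norm v powr ?p) * ?F) * \<theta>" by (simp add: algebra_simps)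
        finally have "h (x, z) w * ennreal (?F * sigma_cs c \<gamma> ?d) \<le> ennreal ((8 * L * c) * ((norm z powr ?p + norm v powr ?p) * ?F) * \<theta>)"
          by (simp add: ennreal_leI)
        also have "\<dots> = (ennreal (8 * L * c) * ((ennreal (norm z powr ?p) + ennreal (norm v powr ?p)) * ennreal ?F)) * ennreal \<theta>"
          using L c_pos F \<theta> by (simp add: ennreal_mult ennreal_plus)
        finally show ?thesis using True \<theta> by (simp add: w)
      qed
    qed
    have "(\<integral>\<^sup>+w. indicator (UNIV \<times> Xi) w * h (x, z) w * ennreal (f s x (fst w) * sigma_cs c \<gamma> (norm (z - fst w))) \<partial>W)
      \<le> (\<integral>\<^sup>+w. (ennreal (8 * L * c) * ((ennreal (norm z powr ?p) + ennreal (norm (fst w) powr ?p)) * ennreal (f s x (fst w)))) *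
         ((ennreal (fst (snd w)) * indicator {0<..pi} (fst (snd w))) * indicator {0..2*pi} (snd (snd w))) \<partial>W)"
      by (intro nn_integral_mono pt)
    also have "\<dots> = (\<integral>\<^sup>+v. ennreal (8 * L * c) * ((ennreal (norm z powr ?p) + ennreal (norm v powr ?p)) * ennreal (f s x v)) \<partial>lborel) *
        (?C * (\<integral>\<^sup>+\<phi>. indicator {0..2*pi} \<phi> \<partial>lborel))"
      by (rule nn_integral_W_prod) measurable
    also have "\<dots> = rate_const L * (\<integral>\<^sup>+v. (ennreal (norm z powr ?p) + ennreal (norm v powr ?p)) * ennreal (f s x v) \<partial>lborel)"
      unfolding rate_const_def by (subst nn_integral_cmult) (measurable, simp add: mult_ac)
    finally show ?thesis .
  qed
  \<comment> \<open>R is the spatial density and B the velocity moment at position x. Each of the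
    two terms of the bound integrates over both velocities to the product of B and R, hence the
    factor 2.\<close>
  define R where "R x = (\<integral>\<^sup>+v. ennreal (f s x v) \<partial>lborel)" for x
  define B where "B x = (\<integral>\<^sup>+v. ennreal (norm v powr ?p) * ennreal (f s x v) \<partial>lborel)" for x
  have Rm[measurable]: "R \<in> borel_measurable borel"
  proof -
    have "R \<in> borel_measurable lborel"
      unfolding R_def by (rule lborel.borel_measurable_nn_integral) (unfold case_prod_unfold, measurable)
    then show ?thesis by simp
  qed
  have Bm[measurable]: "B \<in> borel_measurable borel"
  proof -
    have "B \<in> borel_measurable lborel"
      unfolding B_def by (rule lborel.borel_measurable_nn_integral) (unfold case_prod_unfold, measurable)
    then show ?thesis by simp
  qed
  have BM: "B x \<le> moment_sup f \<gamma> s" for x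
    unfolding B_def moment_sup_def using f_nonneg[OF s]
    by (intro SUP_upper2[of x]) (auto simp: ennreal_mult)
  have two: "(\<integral>\<^sup>+v. (ennreal (norm z powr ?p) + ennreal (norm v powr ?p)) * ennreal (f s x v) \<partial>lborel)
      = ennreal (norm z powr ?p) * R x + B x" for x z
    unfolding R_def B_def distrib_right by (subst nn_integral_add) (auto simp: nn_integral_cmult)
  have "rate h s \<le> (\<integral>\<^sup>+y. ennreal (f s (fst y) (snd y)) * (rate_const L * (ennreal (norm (snd y) powr ?p) * R (fst y) + B (fst y))) \<partial>P6)"
    unfolding rate_def
  proof (intro nn_integral_mono mult_left_mono)
    fix y :: "R3 \<times> R3"
    show "(\<integral>\<^sup>+w. indicator (UNIV \<times> Xi) w * h y w * ennreal (f s (fst y) (fst w) * sigma_cs c \<gamma> (norm (snd y - fst w))) \<partial>W)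
        \<le> rate_const L * (ennreal (norm (snd y) powr ?p) * R (fst y) + B (fst y))"
      using inner[of "fst y" "snd y"] unfolding two by simp
  qed simp
  also have "\<dots> = (\<integral>\<^sup>+x. \<integral>\<^sup>+z. rate_const L * (R x * (ennreal (norm z powr ?p) * ennreal (f s x z)) + B x * ennreal (f s x z)) \<partial>lborel \<partial>lborel)"
    by (subst lborel.nn_integral_fst[symmetric]) (measurable, simp add: algebra_simps)
  also have "\<dots> = (\<integral>\<^sup>+x. rate_const L * (2 * (B x * R x)) \<partial>lborel)"
  proof (rule nn_integral_cong)
    fix x :: R3
    have "(\<integral>\<^sup>+z. rate_const L * (R x * (ennreal (norm z powr ?p) * ennreal (f s x z)) + B x * ennreal (f s x z)) \<partial>lborel)
      = rate_const L * (R x * B x + B x * R x)"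
      by (simp add: nn_integral_cmult nn_integral_add B_def[symmetric] R_def[symmetric])
    then show "(\<integral>\<^sup>+z. rate_const L * (R x * (ennreal (norm z powr ?p) * ennreal (f s x z)) + B x * ennreal (f s x z)) \<partial>lborel)
      = rate_const L * (2 * (B x * R x))" by (simp add: mult.commute mult_2)
  qed
  also have "\<dots> \<le> (\<integral>\<^sup>+x. rate_const L * (2 * moment_sup f \<gamma> s) * R x \<partial>lborel)"
    using BM by (intro nn_integral_mono) (auto simp: mult.assoc intro!: mult_mono)
  also have "\<dots> = rate_const L * (2 * moment_sup f \<gamma> s) * (\<integral>\<^sup>+x. R x \<partial>lborel)"
    by (rule nn_integral_cmult) simp
  also have "(\<integral>\<^sup>+x. R x \<partial>lborel) = 1"
  proof -
    have "(\<lambda>p. ennreal (f s (fst p) (snd p))) \<in> borel_measurable P6"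
      unfolding measurable_cong_sets[OF sets_P6 refl]
      by (rule measurable_compose[OF f_measurable_slice[OF s] measurable_ennreal])
    from lborel.nn_integral_fst[OF this] show ?thesis using f_total[OF s] by (simp add: R_def)
  qed
  finally show ?thesis by simp
qed

lemma moment_sup_bounded: "\<exists>K. \<forall>s\<in>{0..T}. moment_sup f \<gamma> s \<le> ennreal K"
proof -
  have *: "\<forall>t\<in>{0..T}. moment_sup f \<gamma> t < \<infinity>" "continuous_on {0..T} (\<lambda>t. enn2real (moment_sup f \<gamma> t))"
    using hypB T unfolding hypB_def by blast+
  have "compact ((\<lambda>t. enn2real (moment_sup f \<gamma> t)) ` {0..T})"
    by (rule compact_continuous_image[OF *(2)]) simp
  then have "bounded ((\<lambda>t. enn2real (moment_sup f \<gamma> t)) ` {0..T})" by (rule compact_imp_bounded)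
  then obtain K where "\<forall>x\<in>(\<lambda>t. enn2real (moment_sup f \<gamma> t)) ` {0..T}. norm x \<le> K"
    unfolding bounded_iff by blast
  then have K: "enn2real (moment_sup f \<gamma> t) \<le> K" if "t \<in> {0..T}" for t using that by auto
  show ?thesis
  proof (intro exI ballI)
    fix s assume s: "s \<in> {0..T}"
    have "moment_sup f \<gamma> s = ennreal (enn2real (moment_sup f \<gamma> s))" using *(1) s by auto
    then show "moment_sup f \<gamma> s \<le> ennreal K" using K[OF s] by (metis ennreal_leI)
  qed
qed

lemma rate_integral_finite:
  assumes t: "0 < t" "t \<le> T" and L: "0 \<le> L"
    and h: "\<And>y v \<theta> \<phi>. v \<noteq> snd y \<Longrightarrow> 0 < \<theta> \<Longrightarrow> h y (v, \<theta>, \<phi>) \<le> ennreal (L * (2 * \<theta> * norm (snd y - v)))"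
  shows "(\<integral>\<^sup>+s. indicator {0<..t} s * rate h s \<partial>lborel) < \<infinity>"
proof -
  obtain K where K: "\<And>s. s \<in> {0..T} \<Longrightarrow> moment_sup f \<gamma> s \<le> ennreal K" using moment_sup_bounded by blast
  have "(\<integral>\<^sup>+s. indicator {0<..t} s * rate h s \<partial>lborel) \<le> (\<integral>\<^sup>+s. rate_const L * (2 * ennreal K) * indicator {0<..t} s \<partial>lborel)"
  proof (rule nn_integral_mono)
    fix s :: real
    show "indicator {0<..t} s * rate h s \<le> rate_const L * (2 * ennreal K) * indicator {0<..t} s"
    proof (cases "s \<in> {0<..t}")
      case True
      then have "rate h s \<le> rate_const L * (2 * moment_sup f \<gamma> s)" using rate_le[OF _ L h] by auto
      also have "\<dots> \<le> rate_const L * (2 * ennreal K)" using K[of s] True t by (intro mult_left_mono) auto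
      finally show ?thesis using True by simp
    qed simp
  qed
  also have "\<dots> = rate_const L * (2 * ennreal K) * ennreal t" using t by (simp add: nn_integral_cmult_indicator)
  also have "\<dots> < \<infinity>"
    using theta_integral_finite unfolding rate_const_def by (auto simp: ennreal_mult_less_top)
  finally show ?thesis .
qed

text \<open>Connects the nested signed integrals of the weak formulation with the nonnegative rates.
  Finiteness of the absolute rate makes the integrand integrable on the product of time, state and
  mark; Fubini then holds for almost every time, and the default values of the inner integrals at
  exceptional times do not matter.\<close>

lemma generator_integral:
  fixes g :: "R3 \<times> R3 \<Rightarrow> R3 \<times> real \<times> real \<Rightarrow> real"
  assumes g: "(\<lambda>(y, w). g y w) \<in> borel_measurable borel"
    and t: "0 < t" "t \<le> T"
    and fin: "(\<integral>\<^sup>+s. indicator {0<..t} s * rate (\<lambda>y w. ennreal \<bar>g y w\<bar>) s \<partial>lborel) < \<infinity>"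
  shows "set_lebesgue_integral lborel {0..t} (\<lambda>s. \<integral>y. f s (fst y) (snd y) *
        (\<integral>w. indicator (UNIV \<times> Xi) w * (g y w * f s (fst y) (fst w) * sigma_cs c \<gamma> (norm (snd y - fst w))) \<partial>W) \<partial>P6)
    = enn2real (\<integral>\<^sup>+s. indicator {0<..t} s * rate (\<lambda>y w. ennreal (g y w)) s \<partial>lborel)
    - enn2real (\<integral>\<^sup>+s. indicator {0<..t} s * rate (\<lambda>y w. ennreal (- g y w)) s \<partial>lborel)"
proof -
  interpret PW: pair_sigma_finite "P6 :: (R3 \<times> R3) measure" W
    by (intro pair_sigma_finite.intro P6.sigma_finite_measure_axioms W.sigma_finite_measure_axioms)
  have PWs: "sigma_finite_measure (P6 \<Otimes>\<^sub>M W)"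
    by (intro sigma_finite_pair_measure P6.sigma_finite_measure_axioms W.sigma_finite_measure_axioms)
  interpret LPW: pair_sigma_finite "lborel :: real measure" "P6 \<Otimes>\<^sub>M W"
    by (intro pair_sigma_finite.intro PWs lborel.sigma_finite_measure_axioms)
  have setsPW: "sets (P6 \<Otimes>\<^sub>M W) = sets (borel :: ((R3 \<times> R3) \<times> R3 \<times> real \<times> real) measure)"
  proof -
    have "sets (P6 \<Otimes>\<^sub>M W) = sets (borel \<Otimes>\<^sub>M borel :: ((R3 \<times> R3) \<times> R3 \<times> real \<times> real) measure)"
      by (rule sets_pair_measure_cong[OF sets_P6 sets_W])
    then show ?thesis by (simp only: borel_prod)
  qed
  have setsL: "sets (lborel \<Otimes>\<^sub>M (P6 \<Otimes>\<^sub>M W)) = sets (borel :: (real \<times> (R3 \<times> R3) \<times> R3 \<times> real \<times> real) measure)"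
  proof -
    have "sets (lborel \<Otimes>\<^sub>M (P6 \<Otimes>\<^sub>M W)) = sets (borel \<Otimes>\<^sub>M borel :: (real \<times> (R3 \<times> R3) \<times> R3 \<times> real \<times> real) measure)"
      by (rule sets_pair_measure_cong[OF sets_lborel setsPW])
    then show ?thesis by (simp only: borel_prod)
  qed
  \<comment> \<open>The extension of f by \<open>max 0\<close> makes \<open>k0\<close> jointly
    measurable on the whole line; on (0,t] it is the integrand of the claim.\<close>
  define k0 where "k0 g x = f (max 0 (fst x)) (fst (fst (snd x))) (snd (fst (snd x))) * (indicator (UNIV \<times> Xi) (snd (snd x)) *
     (g (fst (snd x)) (snd (snd x)) * f (max 0 (fst x)) (fst (fst (snd x))) (fst (snd (snd x))) *
      sigma_cs c \<gamma> (norm (snd (fst (snd x)) - fst (snd (snd x))))))"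
    for g :: "R3 \<times> R3 \<Rightarrow> R3 \<times> real \<times> real \<Rightarrow> real" and x :: "real \<times> (R3 \<times> R3) \<times> R3 \<times> real \<times> real"
  define k where "k g x = indicator {0<..t} (fst x) * k0 g x" for g x
  have k0m: "k0 g \<in> borel_measurable borel" if g: "(\<lambda>(y, w). g y w) \<in> borel_measurable borel" for g
  proof -
    note fb = borel_measurable_fst and sb = borel_measurable_snd
    have f1: "(\<lambda>x. fst (b x)) \<in> borel_measurable borel" and s1: "(\<lambda>x. snd (b x)) \<in> borel_measurable borel"
      if "b \<in> borel_measurable borel"
      for b :: "real \<times> (R3 \<times> R3) \<times> R3 \<times> real \<times> real \<Rightarrow> ('b::topological_space \<times> 'd::topological_space)"
      using measurable_compose[OF that fb] measurable_compose[OF that sb] by auto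
    have gm: "(\<lambda>x. g (fst (snd x)) (snd (snd x))) \<in> borel_measurable (borel :: (real \<times> (R3 \<times> R3) \<times> R3 \<times> real \<times> real) measure)"
      using measurable_compose[OF sb g] by (simp add: case_prod_unfold)
    show ?thesis unfolding k0_def
      by (intro borel_measurable_times f_measurable' gm measurable_compose[OF _ sigma_cs_measurable]
          measurable_compose[OF _ borel_measurable_norm] borel_measurable_diff
          measurable_compose[OF _ borel_measurable_indicator[OF UNIV_Times_Xi_borel]] f1 s1 fb sb measurable_ident_sets[OF refl])
  qed
  have km: "k g \<in> borel_measurable (lborel \<Otimes>\<^sub>M (P6 \<Otimes>\<^sub>M W))" if "(\<lambda>(y, w). g y w) \<in> borel_measurable borel" for g
    unfolding measurable_cong_sets[OF setsL refl] k_def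
    by (intro borel_measurable_times k0m[OF that] measurable_compose[OF borel_measurable_fst borel_measurable_indicator]) simp
  have nn: "(\<integral>\<^sup>+x. ennreal (k g x) \<partial>(lborel \<Otimes>\<^sub>M (P6 \<Otimes>\<^sub>M W))) = (\<integral>\<^sup>+s. indicator {0<..t} s * rate (\<lambda>y w. ennreal (g y w)) s \<partial>lborel)"
    if g: "(\<lambda>(y, w). g y w) \<in> borel_measurable borel" for g
  proof -
    have kme: "(\<lambda>x. ennreal (k g x)) \<in> borel_measurable (lborel \<Otimes>\<^sub>M (P6 \<Otimes>\<^sub>M W))"
      by (rule measurable_compose[OF km[OF g] measurable_ennreal])
    have "(\<integral>\<^sup>+x. ennreal (k g x) \<partial>(lborel \<Otimes>\<^sub>M (P6 \<Otimes>\<^sub>M W))) = (\<integral>\<^sup>+s. \<integral>\<^sup>+p. ennreal (k g (s, p)) \<partial>(P6 \<Otimes>\<^sub>M W) \<partial>lborel)"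
      by (rule sigma_finite_measure.nn_integral_fst[OF PWs kme, symmetric])
    also have "\<dots> = (\<integral>\<^sup>+s. \<integral>\<^sup>+y. \<integral>\<^sup>+w. ennreal (k g (s, y, w)) \<partial>W \<partial>P6 \<partial>lborel)"
      by (intro nn_integral_cong W.nn_integral_fst[symmetric] measurable_compose[OF measurable_Pair1' kme]) simp
    also have "\<dots> = (\<integral>\<^sup>+s. indicator {0<..t} s * rate (\<lambda>y w. ennreal (g y w)) s \<partial>lborel)"
    proof (rule nn_integral_cong)
      fix s :: real
      show "(\<integral>\<^sup>+y. \<integral>\<^sup>+w. ennreal (k g (s, y, w)) \<partial>W \<partial>P6) = indicator {0<..t} s * rate (\<lambda>y w. ennreal (g y w)) s"
      proof (cases "s \<in> {0<..t}")
        case True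
        then have s: "0 \<le> s" "max 0 s = s" by auto
        have "(\<integral>\<^sup>+w. ennreal (k g (s, y, w)) \<partial>W) = ennreal (f s (fst y) (snd y)) *
           (\<integral>\<^sup>+w. indicator (UNIV \<times> Xi) w * ennreal (g y w) * ennreal (f s (fst y) (fst w) * sigma_cs c \<gamma> (norm (snd y - fst w))) \<partial>W)" for y
        proof -
          have "ennreal (k g (s, y, w)) = ennreal (f s (fst y) (snd y)) * (indicator (UNIV \<times> Xi) w * ennreal (g y w) *
              ennreal (f s (fst y) (fst w) * sigma_cs c \<gamma> (norm (snd y - fst w))))" for w
          proof -
            have a: "0 \<le> f s (fst y) (snd y)" "0 \<le> f s (fst y) (fst w) * sigma_cs c \<gamma> (norm (snd y - fst w))"
              using f_nonneg[OF s(1)] sigma_nonneg by auto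
            have "k g (s, y, w) = f s (fst y) (snd y) * (indicator (UNIV \<times> Xi) w * (g y w * (f s (fst y) (fst w) * sigma_cs c \<gamma> (norm (snd y - fst w)))))"
              using True by (simp add: k_def k0_def s(2) mult.assoc)
            also have "ennreal \<dots> = ennreal (f s (fst y) (snd y)) * ennreal (indicator (UNIV \<times> Xi) w * (g y w * (f s (fst y) (fst w) * sigma_cs c \<gamma> (norm (snd y - fst w)))))"
              by (rule ennreal_mult'[OF a(1)])
            also have "ennreal (indicator (UNIV \<times> Xi) w * (g y w * (f s (fst y) (fst w) * sigma_cs c \<gamma> (norm (snd y - fst w)))))
              = indicator (UNIV \<times> Xi) w * (ennreal (g y w) * ennreal (f s (fst y) (fst w) * sigma_cs c \<gamma> (norm (snd y - fst w))))"
              using ennreal_mult''[OF a(2)] by (simp add: indicator_def)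
            finally show ?thesis by (simp only: mult.assoc)
          qed
          then show ?thesis
            by (simp only:) (rule nn_integral_cmult, unfold measurable_W,
               intro borel_measurable_times_ennreal measurable_compose[OF _ measurable_ennreal]
                 borel_measurable_indicator UNIV_Times_Xi_borel
                 measurable_compose[OF borel_measurable_Pair[OF measurable_const measurable_ident_sets[OF refl]] g, simplified]
                 borel_measurable_times
                 measurable_compose[OF _ sigma_cs_measurable] measurable_compose[OF _ borel_measurable_norm] borel_measurable_diff borel_measurable_fst
                 measurable_const f_measurable'[where a="\<lambda>_. s", unfolded s(2)], simp_all)
        qed
        then show ?thesis using True by (simp add: rate_def)
      qed (simp add: k_def)
    qed
    finally show ?thesis .
  qed
  have gm: "(\<lambda>(y, w). - g y w) \<in> borel_measurable borel" "(\<lambda>(y, w). \<bar>g y w\<bar>) \<in> borel_measurable borel"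
    using borel_measurable_uminus[OF g] borel_measurable_abs[OF g] by (simp_all add: case_prod_unfold)
  have kabs: "\<bar>k g x\<bar> = k (\<lambda>y w. \<bar>g y w\<bar>) x" for x
    unfolding k_def k0_def using f_nonneg sigma_nonneg by (simp add: abs_mult)
  have kneg: "k (\<lambda>y w. - g y w) x = - k g x" for x
    unfolding k_def k0_def by simp
  have int: "integrable (lborel \<Otimes>\<^sub>M (P6 \<Otimes>\<^sub>M W)) (k g)"
    using nn[OF gm(2)] fin by (intro integrableI_bounded km[OF g]) (simp add: kabs)
  have "integral\<^sup>L (lborel \<Otimes>\<^sub>M (P6 \<Otimes>\<^sub>M W)) (k g) =
      enn2real (\<integral>\<^sup>+s. indicator {0<..t} s * rate (\<lambda>y w. ennreal (g y w)) s \<partial>lborel)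
    - enn2real (\<integral>\<^sup>+s. indicator {0<..t} s * rate (\<lambda>y w. ennreal (- g y w)) s \<partial>lborel)"
    unfolding real_lebesgue_integral_def[OF int] nn[OF g, symmetric] nn[OF gm(1), symmetric] kneg ..
  also have "integral\<^sup>L (lborel \<Otimes>\<^sub>M (P6 \<Otimes>\<^sub>M W)) (k g) = (\<integral>s. \<integral>p. k g (s, p) \<partial>(P6 \<Otimes>\<^sub>M W) \<partial>lborel)"
    by (rule LPW.integral_fst'[OF int, symmetric])
  finally have eq1: "(\<integral>s. \<integral>p. k g (s, p) \<partial>(P6 \<Otimes>\<^sub>M W) \<partial>lborel) =
      enn2real (\<integral>\<^sup>+s. indicator {0<..t} s * rate (\<lambda>y w. ennreal (g y w)) s \<partial>lborel)
    - enn2real (\<integral>\<^sup>+s. indicator {0<..t} s * rate (\<lambda>y w. ennreal (- g y w)) s \<partial>lborel)" .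
  have k03m: "(\<lambda>((s, y), w). k0 g (s, y, w)) \<in> borel_measurable ((lborel \<Otimes>\<^sub>M P6) \<Otimes>\<^sub>M W)"
  proof -
    have m: "(\<lambda>x. (fst (fst x), snd (fst x), snd x)) \<in> measurable ((lborel \<Otimes>\<^sub>M P6) \<Otimes>\<^sub>M W) (lborel \<Otimes>\<^sub>M (P6 \<Otimes>\<^sub>M W))"
      by (intro measurable_Pair measurable_compose[OF measurable_fst measurable_fst] measurable_compose[OF measurable_fst measurable_snd] measurable_snd)
    have "k0 g \<in> borel_measurable (lborel \<Otimes>\<^sub>M (P6 \<Otimes>\<^sub>M W))"
      unfolding measurable_cong_sets[OF setsL refl] by (rule k0m[OF g])
    from measurable_compose[OF m this]
    show "(\<lambda>((s, y), w). k0 g (s, y, w)) \<in> borel_measurable ((lborel \<Otimes>\<^sub>M P6) \<Otimes>\<^sub>M W)"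
      by (simp add: case_prod_unfold)
  qed
  have R_eq: "(\<integral>y. \<integral>w. k g (s, y, w) \<partial>W \<partial>P6) = indicator {0<..t} s * (\<integral>y. \<integral>w. k0 g (s, y, w) \<partial>W \<partial>P6)" for s
    by (simp add: k_def)
  have Rm: "(\<lambda>s. \<integral>y. \<integral>w. k0 g (s, y, w) \<partial>W \<partial>P6) \<in> borel_measurable lborel"
  proof -
    have "(\<lambda>(p, w). k0 g (fst p, snd p, w)) \<in> borel_measurable ((lborel \<Otimes>\<^sub>M P6) \<Otimes>\<^sub>M W)"
      using k03m by (simp add: case_prod_unfold)
    from W.borel_measurable_lebesgue_integral[OF this]
    have "(\<lambda>(s, y). \<integral>w. k0 g (s, y, w) \<partial>W) \<in> borel_measurable (lborel \<Otimes>\<^sub>M P6)"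
      by (simp add: case_prod_unfold)
    from P6.borel_measurable_lebesgue_integral[OF this] show ?thesis .
  qed
  have "(\<integral>s. \<integral>p. k g (s, p) \<partial>(P6 \<Otimes>\<^sub>M W) \<partial>lborel) = (\<integral>s. indicator {0..t} s *\<^sub>R (\<integral>y. \<integral>w. k0 g (s, y, w) \<partial>W \<partial>P6) \<partial>lborel)"
  proof (rule integral_cong_AE)
    show "(\<lambda>s. \<integral>p. k g (s, p) \<partial>(P6 \<Otimes>\<^sub>M W)) \<in> borel_measurable lborel"
      using sigma_finite_measure.borel_measurable_lebesgue_integral[OF PWs, of "\<lambda>s p. k g (s, p)" lborel] km[OF g] by simp
    show "(\<lambda>s. indicator {0..t} s *\<^sub>R (\<integral>y. \<integral>w. k0 g (s, y, w) \<partial>W \<partial>P6)) \<in> borel_measurable lborel"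
      using Rm by measurable
    show "AE s in lborel. (\<integral>p. k g (s, p) \<partial>(P6 \<Otimes>\<^sub>M W)) = indicator {0..t} s *\<^sub>R (\<integral>y. \<integral>w. k0 g (s, y, w) \<partial>W \<partial>P6)"
      using LPW.AE_integrable_fst'[OF int] AE_lborel_singleton[of 0]
    proof eventually_elim
      case (elim s)
      have "(\<integral>p. k g (s, p) \<partial>(P6 \<Otimes>\<^sub>M W)) = (\<integral>y. \<integral>w. k g (s, y, w) \<partial>W \<partial>P6)"
        by (rule PW.integral_fst'[OF elim(1), symmetric])
      then show ?case unfolding R_eq using elim(2) by (auto simp: indicator_def)
    qed
  qed
  also have "\<dots> = set_lebesgue_integral lborel {0..t} (\<lambda>s. \<integral>y. f s (fst y) (snd y) *
        (\<integral>w. indicator (UNIV \<times> Xi) w * (g y w * f s (fst y) (fst w) * sigma_cs c \<gamma> (norm (snd y - fst w))) \<partial>W) \<partial>P6)"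
    unfolding set_lebesgue_integral_def
  proof (rule Bochner_Integration.integral_cong[OF refl])
    fix s :: real
    show "indicator {0..t} s *\<^sub>R (\<integral>y. \<integral>w. k0 g (s, y, w) \<partial>W \<partial>P6) = indicator {0..t} s *\<^sub>R (\<integral>y. f s (fst y) (snd y) *
        (\<integral>w. indicator (UNIV \<times> Xi) w * (g y w * f s (fst y) (fst w) * sigma_cs c \<gamma> (norm (snd y - fst w))) \<partial>W) \<partial>P6)"
      by (cases "0 \<le> s") (simp_all add: k0_def max_def)
  qed
  finally show ?thesis using eq1 by simp
qed

end

section \<open>The jump process\<close>

lemma left_lim_eq: "(g \<longlongrightarrow> l) (at_left (s::real)) \<Longrightarrow> left_lim g s = l"
  unfolding left_lim_def by (intro tendsto_Lim) auto

lemma cadlag_pair_left_lim: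
  assumes "cadlag_on T (\<lambda>t. (x t, z t))" "s \<in> {0<..T}"
  shows "(x \<longlongrightarrow> left_lim x s) (at_left s)" "(z \<longlongrightarrow> left_lim z s) (at_left s)"
proof -
  obtain l where l: "((\<lambda>t. (x t, z t)) \<longlongrightarrow> l) (at_left s)" using assms unfolding cadlag_on_def by blast
  have "(x \<longlongrightarrow> fst l) (at_left s)" "(z \<longlongrightarrow> snd l) (at_left s)"
    using tendsto_fst[OF l] tendsto_snd[OF l] by simp_all
  then show "(x \<longlongrightarrow> left_lim x s) (at_left s)" "(z \<longlongrightarrow> left_lim z s) (at_left s)"
    using left_lim_eq by metis+
qed

lemma cadlag_pair_right:
  assumes "cadlag_on T (\<lambda>t. (x t, z t))" "s \<in> {0..<T}"
  shows "(x \<longlongrightarrow> x s) (at_right s)" "(z \<longlongrightarrow> z s) (at_right s)"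
proof -
  have l: "((\<lambda>t. (x t, z t)) \<longlongrightarrow> (x s, z s)) (at_right s)" using assms by (auto simp: cadlag_on_def)
  show "(x \<longlongrightarrow> x s) (at_right s)" "(z \<longlongrightarrow> z s) (at_right s)"
    using tendsto_fst[OF l] tendsto_snd[OF l] by simp_all
qed

text \<open>Sampling at right endpoints looks ahead in time, so this gives joint measurability with
  respect to M and not predictability.\<close>

lemma measurable_right_continuous:
  fixes Y :: "real \<Rightarrow> 'a \<Rightarrow> 'b::euclidean_space"
  assumes t: "0 < t" and Y: "\<And>s. s \<in> {0..t} \<Longrightarrow> Y s \<in> borel_measurable M"
    and rc: "\<And>\<omega> s. \<omega> \<in> space M \<Longrightarrow> s \<in> {0..<t} \<Longrightarrow> ((\<lambda>u. Y u \<omega>) \<longlongrightarrow> Y s \<omega>) (at_right s)"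
  shows "(\<lambda>(\<omega>, s). indicator {0<..t} s *\<^sub>R Y s \<omega>) \<in> borel_measurable (M \<Otimes>\<^sub>M borel)"
proof (rule borel_measurable_LIMSEQ_metric)
  define G where "G m x = (\<Sum>k<Suc m. indicator {gridpt t m k<..gridpt t m (Suc k)} (snd x) *\<^sub>R Y (gridpt t m (Suc k)) (fst x))"
    for m and x :: "'a \<times> real"
  show "G m \<in> borel_measurable (M \<Otimes>\<^sub>M borel)" for m
    unfolding G_def
  proof (rule borel_measurable_sum)
    fix k assume k: "k \<in> {..<Suc m}"
    have [measurable]: "Y (gridpt t m (Suc k)) \<in> borel_measurable M"
      using k t gridpt_nonneg[of t m "Suc k"] gridpt_le[of t "Suc k" m] by (intro Y) auto
    show "(\<lambda>x. indicator {gridpt t m k<..gridpt t m (Suc k)} (snd x) *\<^sub>R Y (gridpt t m (Suc k)) (fst x)) \<in> borel_measurable (M \<Otimes>\<^sub>M borel)"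
      by measurable
  qed
  have G: "G m x = indicator {0<..t} (snd x) *\<^sub>R Y (gridpt t m (Suc (cell t m (snd x)))) (fst x)" for m x
    unfolding G_def by (rule sum_cells[OF t])
  fix x assume x: "x \<in> space (M \<Otimes>\<^sub>M (borel :: real measure))"
  show "(\<lambda>m. G m x) \<longlonglongrightarrow> (case x of (\<omega>, s) \<Rightarrow> indicator {0<..t} s *\<^sub>R Y s \<omega>)"
  proof (cases "snd x \<in> {0<..t}")
    case True
    then have s: "0 < snd x" "snd x \<le> t" by auto
    have "(\<lambda>m. Y (gridpt t m (Suc (cell t m (snd x)))) (fst x)) \<longlonglongrightarrow> Y (snd x) (fst x)"
    \<comment> \<open>Right continuity is assumed on [0,t) only. At the final time the right
      endpoint of the cell is t itself.\<close>
    proof (cases "snd x = t")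
      case True
      have "gridpt t m (Suc (cell t m t)) = t" for m
        using cell_bounds[OF t order_refl, of m] gridpt_le[of t "Suc (cell t m t)" m] t by simp
      then show ?thesis using True by simp
    next
      case False
      then show ?thesis using s x
        by (intro tendsto_at_right_seq[of "\<lambda>u. Y u (fst x)"] rc gridpt_cell_tendsto cell_bounds) (auto simp: space_pair_measure)
    qed
    then show ?thesis unfolding G split_beta by (intro tendsto_scaleR tendsto_const)
  qed (simp add: G split_beta)
qed

section \<open>The intensity of the driving noise\<close>

context kinetic
begin

lemma sigma_finite_PRM_base: "sigma_finite_measure (PRM_base Q)"
  unfolding PRM_base_def
  by (intro sigma_finite_pair_measure Q.sigma_finite_measure_axioms lborel.sigma_finite_measure_axioms)

lemma sets_intensity: "sets (intensity Q f T) = sets borel"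
  by (simp add: intensity_def sets_PRM_base)

text \<open>A density with finite values preserves sigma-finiteness, and the marginal is real valued
  by its definition.\<close>

lemma sigma_finite_intensity: "sigma_finite_measure (intensity Q f T)"
proof -
  interpret B: sigma_finite_measure "PRM_base Q" by (rule sigma_finite_PRM_base)
  have "(\<lambda>e. ennreal (marg f (max 0 (ev_time e)) (fst e)) * indicator (PRM_region T) e) \<in> borel_measurable (PRM_base Q)"
    unfolding measurable_cong_sets[OF sets_PRM_base refl] by (rule intensity_density_measurable)
  then show ?thesis unfolding intensity_eq
    by (subst B.sigma_finite_iff_density_finite) (auto simp: ennreal_mult_eq_top_iff indicator_def)
qed

lemma intensity_no_atoms: "emeasure (intensity Q f T) {e. ev_time e = s} = 0"
proof -
  let ?S = "{e. ev_time e = s}"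
  have S: "?S \<in> sets borel" using measurable_sets_borel[OF measurable_ev_time, of "{s}"] by (simp add: vimage_def)
  have "emeasure (PRM_base Q) ?S = (\<integral>\<^sup>+e. indicator ?S e \<partial>PRM_base Q)"
    using S by (simp add: sets_PRM_base)
  also have "\<dots> = (\<integral>\<^sup>+u. \<integral>\<^sup>+w. \<integral>\<^sup>+r. indicator ?S (fst w, fst (snd w), snd (snd w), r, u) \<partial>lborel \<partial>W \<partial>lborel)"
    by (rule nn_integral_PRM_base) (use S in simp)
  also have "\<dots> = (\<integral>\<^sup>+(u::real). 0 \<partial>lborel)"
  proof (rule nn_integral_cong_AE)
    show "AE u in lborel. (\<integral>\<^sup>+w. \<integral>\<^sup>+r. indicator ?S (fst w, fst (snd w), snd (snd w), r, u) \<partial>lborel \<partial>W) = 0"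
      using AE_lborel_singleton[of s] by eventually_elim (simp add: ev_time_def)
  qed
  finally have "?S \<in> null_sets (PRM_base Q)" using S by (auto simp: null_sets_def sets_PRM_base)
  then have ae: "AE e in PRM_base Q. e \<notin> ?S" by (rule AE_not_in)
  have "emeasure (intensity Q f T) ?S = (\<integral>\<^sup>+e. ennreal (marg f (max 0 (ev_time e)) (fst e)) * indicator (PRM_region T) e * indicator ?S e \<partial>PRM_base Q)"
    unfolding intensity_eq
  proof (rule emeasure_density)
    show "(\<lambda>e. ennreal (marg f (max 0 (ev_time e)) (fst e)) * indicator (PRM_region T) e) \<in> borel_measurable (PRM_base Q)"
      unfolding measurable_cong_sets[OF sets_PRM_base refl] by (rule intensity_density_measurable)
  qed (use S in \<open>simp add: sets_PRM_base\<close>)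
  also have "\<dots> = (\<integral>\<^sup>+e. 0 \<partial>PRM_base Q)"
    using ae by (intro nn_integral_cong_AE) (auto elim!: eventually_mono)
  finally show ?thesis by simp
qed

end

lemma integral_density_law:
  fixes \<phi> :: "R3 \<times> R3 \<Rightarrow> real"
  assumes law: "distr M P6 Y = density P6 (\<lambda>(x,z). ennreal (g x z))"
    and Y: "Y \<in> borel_measurable M" and g: "prob_density6 g" and \<phi>: "\<phi> \<in> borel_measurable borel"
  shows "(\<integral>\<omega>. \<phi> (Y \<omega>) \<partial>M) = (\<integral>(x,z). g x z * \<phi> (x, z) \<partial>P6)"
proof -
  have Y': "Y \<in> measurable M P6" unfolding measurable_cong_sets[OF refl sets_P6] by (rule Y)
  have \<phi>': "\<phi> \<in> borel_measurable P6" unfolding measurable_cong_sets[OF sets_P6 refl] by (rule \<phi>)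
  have g': "(\<lambda>p. g (fst p) (snd p)) \<in> borel_measurable P6" "\<And>x z. 0 \<le> g x z"
    using g by (auto simp: prob_density6_def case_prod_unfold)
  have "(\<integral>\<omega>. \<phi> (Y \<omega>) \<partial>M) = integral\<^sup>L (distr M P6 Y) \<phi>"
    by (rule integral_distr[OF Y' \<phi>', symmetric])
  also have "\<dots> = (\<integral>p. g (fst p) (snd p) *\<^sub>R \<phi> p \<partial>P6)"
    unfolding law case_prod_unfold using g' by (intro integral_density \<phi>') auto
  finally show ?thesis by (simp add: case_prod_unfold)
qed

locale jump_sde = kinetic I J Q c \<gamma> f df T + poisson_setup M F T "intensity Q f T" N A
  for I J Q c \<gamma> f df T and M :: "'a measure" and F N A +
  fixes X Z :: "real \<Rightarrow> 'a \<Rightarrow> R3"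
  assumes adapted: "\<forall>t\<in>{0..T}. X t \<in> borel_measurable (F t) \<and> Z t \<in> borel_measurable (F t)"
    and cadlag: "\<forall>\<omega>\<in>space M. cadlag_on T (\<lambda>t. (X t \<omega>, Z t \<omega>))"
    and law: "\<forall>t\<in>{0..T}. distr M P6 (\<lambda>\<omega>. (X t \<omega>, Z t \<omega>)) = density P6 (\<lambda>(x,z). ennreal (f t x z))"
    and SDE: "AE \<omega> in M. \<forall>t\<in>{0..T}.
                X t \<omega> = X 0 \<omega> + integral {0..t} (\<lambda>s. Z s \<omega>) \<and>
                integrable (N \<omega>) (jump_integrand I J c \<gamma> f X Z \<omega> t) \<and>
                Z t \<omega> = Z 0 \<omega> + (\<integral> e. jump_integrand I J c \<gamma> f X Z \<omega> t e \<partial>N \<omega>)"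
begin

lemma T_pos: "0 < T" by (rule T)

lemma X_measurable: "s \<in> {0..T} \<Longrightarrow> X s \<in> borel_measurable M"
  and Z_measurable: "s \<in> {0..T} \<Longrightarrow> Z s \<in> borel_measurable M"
proof -
  have "borel_measurable (F s) \<subseteq> borel_measurable M" if "s \<in> {0..T}"
    using F_sub[OF that] by (auto simp: measurable_def)
  then show "s \<in> {0..T} \<Longrightarrow> X s \<in> borel_measurable M" "s \<in> {0..T} \<Longrightarrow> Z s \<in> borel_measurable M"
    using adapted by blast+
qed

text \<open>Left limits are taken in both components, also in the continuous one, since this makes
  the pair predictable. Outside (0,T], where left limits are not controlled, the value is 0.\<close>

definition pre :: "real \<Rightarrow> 'a \<Rightarrow> R3 \<times> R3" where
  "pre s \<omega> = (indicator {0<..T} s *\<^sub>R left_lim (\<lambda>u. X u \<omega>) s, indicator {0<..T} s *\<^sub>R left_lim (\<lambda>u. Z u \<omega>) s)"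

lemma pre_predictable: "(\<lambda>x. pre (ev_time (snd x)) (fst x)) \<in> borel_measurable \<P>"
proof -
  have "(\<lambda>(\<omega>, e). indicator {0<..T} (ev_time e) *\<^sub>R left_lim (\<lambda>u. X u \<omega>) (ev_time e)) \<in> borel_measurable \<P>"
  proof (rule measurable_left_lim)
    show "((\<lambda>u. X u \<omega>) \<longlongrightarrow> left_lim (\<lambda>u. X u \<omega>) s) (at_left s)" if "\<omega> \<in> space M" "s \<in> {0<..T}" for \<omega> s
      using cadlag that by (intro cadlag_pair_left_lim(1)[of T "\<lambda>u. X u \<omega>" "\<lambda>u. Z u \<omega>"]) auto
  qed (use adapted in blast)
  moreover have "(\<lambda>(\<omega>, e). indicator {0<..T} (ev_time e) *\<^sub>R left_lim (\<lambda>u. Z u \<omega>) (ev_time e)) \<in> borel_measurable \<P>"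
  proof (rule measurable_left_lim)
    show "((\<lambda>u. Z u \<omega>) \<longlongrightarrow> left_lim (\<lambda>u. Z u \<omega>) s) (at_left s)" if "\<omega> \<in> space M" "s \<in> {0<..T}" for \<omega> s
      using cadlag that by (intro cadlag_pair_left_lim(2)[of T "\<lambda>u. X u \<omega>" "\<lambda>u. Z u \<omega>"]) auto
  qed (use adapted in blast)
  ultimately show ?thesis unfolding pre_def case_prod_unfold by (rule borel_measurable_Pair)
qed

lemma pre_measurable: "(\<lambda>(\<omega>, s). pre s \<omega>) \<in> borel_measurable (M \<Otimes>\<^sub>M borel)"
proof -
  have m: "(\<lambda>x. pre (ev_time (snd x)) (fst x)) \<in> borel_measurable (M \<Otimes>\<^sub>M borel)"
    by (rule measurable_predictableD[OF pre_predictable])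
  \<comment> \<open>A time is viewed as an event with dummy marks, so that joint measurability in
    outcome and time is read off from predictability.\<close>
  have "(\<lambda>s. (0, 0, 0, 0, s) :: ev) \<in> borel_measurable borel"
    by (intro borel_measurable_continuous_onI continuous_intros)
  then have "(\<lambda>p. (fst p, (0, 0, 0, 0, snd p) :: ev)) \<in> measurable (M \<Otimes>\<^sub>M borel) (M \<Otimes>\<^sub>M borel)"
    by (intro measurable_Pair measurable_fst measurable_compose[OF measurable_snd])
  from measurable_compose[OF this m] show ?thesis by (simp add: case_prod_unfold ev_time_def)
qed

lemma jump_integrand_split:
  assumes "u \<le> T"
  shows "jump_integrand I J c \<gamma> f X Z \<omega> u e = indicator {0<..u} (ev_time e) *\<^sub>R jump_integrand I J c \<gamma> f X Z \<omega> T e"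
proof -
  obtain v \<theta> \<phi> r s where "e = (v, \<theta>, \<phi>, r, s)" by (cases e)
  then show ?thesis using assms by (auto simp: jump_integrand_def ev_time_def indicator_def)
qed

text \<open>Path properties at an outcome where the equation holds. They rest on the integrability
  of the jump integrand against \<open>N \<omega>\<close>: it bounds Z by its initial size plus the
  total size of the jumps, and bounded velocity makes X continuous.\<close>

lemma
  assumes sde: "\<forall>t\<in>{0..T}. X t \<omega> = X 0 \<omega> + integral {0..t} (\<lambda>s. Z s \<omega>) \<and>
                integrable (N \<omega>) (jump_integrand I J c \<gamma> f X Z \<omega> t) \<and>
                Z t \<omega> = Z 0 \<omega> + (\<integral> e. jump_integrand I J c \<gamma> f X Z \<omega> t e \<partial>N \<omega>)"
    and \<omega>: "\<omega> \<in> space M"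
  defines "\<beta> \<equiv> jump_integrand I J c \<gamma> f X Z \<omega> T"
  shows path_integrable: "integrable (N \<omega>) \<beta>"
    and path_Z: "u \<in> {0..T} \<Longrightarrow> Z u \<omega> = Z 0 \<omega> + (\<integral>e. indicator {0<..u} (ev_time e) *\<^sub>R \<beta> e \<partial>N \<omega>)"
    and path_Z_left: "u \<in> {0<..T} \<Longrightarrow> left_lim (\<lambda>u. Z u \<omega>) u = Z 0 \<omega> + (\<integral>e. indicator {0<..<u} (ev_time e) *\<^sub>R \<beta> e \<partial>N \<omega>)"
    and path_Z_bounded: "\<exists>K. \<forall>u\<in>{0..T}. norm (Z u \<omega>) \<le> K"
    and path_U_measurable: "0 < t \<Longrightarrow> t \<le> T \<Longrightarrow> (\<lambda>s. indicator {0<..t} s *\<^sub>R Z s \<omega>) \<in> borel_measurable borel"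
    and path_X: "0 < t \<Longrightarrow> t \<le> T \<Longrightarrow> 0 \<le> a \<Longrightarrow> a \<le> b \<Longrightarrow> b \<le> t \<Longrightarrow>
       X b \<omega> - X a \<omega> = (\<integral>s. indicator {a<..b} s *\<^sub>R (indicator {0<..t} s *\<^sub>R Z s \<omega>) \<partial>lborel)"
    and path_X_left: "u \<in> {0<..T} \<Longrightarrow> left_lim (\<lambda>u. X u \<omega>) u = X u \<omega>"
proof -
  have sN: "sets (N \<omega>) = sets borel" by (rule sets_N[OF \<omega>])
  have tm: "ev_time \<in> borel_measurable (N \<omega>)" unfolding measurable_cong_sets[OF sN refl] by (rule measurable_ev_time)
  show int: "integrable (N \<omega>) \<beta>" using sde T_pos by (auto simp: \<beta>_def)
  have \<beta>m: "\<beta> \<in> borel_measurable (N \<omega>)" using int by auto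
  show Zu: "Z u \<omega> = Z 0 \<omega> + (\<integral>e. indicator {0<..u} (ev_time e) *\<^sub>R \<beta> e \<partial>N \<omega>)" if "u \<in> {0..T}" for u
  proof -
    have "(\<integral>e. jump_integrand I J c \<gamma> f X Z \<omega> u e \<partial>N \<omega>) = (\<integral>e. indicator {0<..u} (ev_time e) *\<^sub>R \<beta> e \<partial>N \<omega>)"
      unfolding \<beta>_def using that by (intro Bochner_Integration.integral_cong refl jump_integrand_split) auto
    then show ?thesis using sde that by metis
  qed
  show "left_lim (\<lambda>u. Z u \<omega>) u = Z 0 \<omega> + (\<integral>e. indicator {0<..<u} (ev_time e) *\<^sub>R \<beta> e \<partial>N \<omega>)" if u: "u \<in> {0<..T}" for u
  proof -
    define a where "a m = gridpt u m (cell u m u)" for m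
    have a: "a \<longlonglongrightarrow> u" "a m < u" "0 \<le> a m" for m
      using u gridpt_cell_tendsto(1)[of u u] cell_bounds(2)[of u u m] gridpt_nonneg[of u m]
      by (auto simp: a_def[abs_def])
    have 1: "(\<lambda>m. Z (a m) \<omega>) \<longlonglongrightarrow> left_lim (\<lambda>u. Z u \<omega>) u"
      using cadlag \<omega> u by (intro tendsto_at_left_seq[OF cadlag_pair_left_lim(2)] a) auto
    have "Z (a m) \<omega> = Z 0 \<omega> + (\<integral>e. indicator {0<..a m} (ev_time e) *\<^sub>R \<beta> e \<partial>N \<omega>)" for m
      using a(2,3)[of m] u by (intro Zu) auto
    then have "(\<lambda>m. Z (a m) \<omega>) \<longlonglongrightarrow> Z 0 \<omega> + (\<integral>e. indicator {0<..<u} (ev_time e) *\<^sub>R \<beta> e \<partial>N \<omega>)"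
      using cumulative_tendsto_left[OF tm int a(1) a(2)] by (simp add: tendsto_add)
    from LIMSEQ_unique[OF 1 this] show ?thesis .
  qed
  have Zb: "norm (Z u \<omega>) \<le> norm (Z 0 \<omega>) + (\<integral>e. norm (\<beta> e) \<partial>N \<omega>)" if "u \<in> {0..T}" for u
  proof -
    have "norm (\<integral>e. indicator {0<..u} (ev_time e) *\<^sub>R \<beta> e \<partial>N \<omega>) \<le> (\<integral>e. norm (\<beta> e) \<partial>N \<omega>)"
    proof (rule Bochner_Integration.integral_norm_bound_integral)
      show "integrable (N \<omega>) (\<lambda>e. norm (\<beta> e))" using int by simp
      show "integrable (N \<omega>) (\<lambda>e. indicator {0<..u} (ev_time e) *\<^sub>R \<beta> e)"
        by (rule Bochner_Integration.integrable_bound[OF int])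
           (use tm \<beta>m in \<open>measurable, auto simp: indicator_def\<close>)
    qed (simp add: indicator_def)
    then show ?thesis unfolding Zu[OF that] using norm_triangle_ineq[of "Z 0 \<omega>"] by (meson add_left_mono order_trans)
  qed
  then show "\<exists>K. \<forall>u\<in>{0..T}. norm (Z u \<omega>) \<le> K" by blast
  define K where "K = norm (Z 0 \<omega>) + (\<integral>e. norm (\<beta> e) \<partial>N \<omega>)"
  have um: "(\<lambda>s. indicator {0<..t} s *\<^sub>R Z s \<omega>) \<in> borel_measurable borel" if t: "0 < t" "t \<le> T" for t
  proof -
    have "(\<lambda>(\<omega>, s). indicator {0<..t} s *\<^sub>R Z s \<omega>) \<in> borel_measurable (M \<Otimes>\<^sub>M borel)"
      using t cadlag by (intro measurable_right_continuous Z_measurable cadlag_pair_right(2)[where T=T and x="\<lambda>u. X u _"]) auto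
    from measurable_compose[OF measurable_Pair1'[OF \<omega>] this] show ?thesis by simp
  qed
  then show "0 < t \<Longrightarrow> t \<le> T \<Longrightarrow> (\<lambda>s. indicator {0<..t} s *\<^sub>R Z s \<omega>) \<in> borel_measurable borel" .
  have Zint: "set_integrable lborel {0..T} (\<lambda>s. Z s \<omega>)"
  proof -
    have eq: "indicator {0..T} s *\<^sub>R Z s \<omega> = indicator {0<..T} s *\<^sub>R Z s \<omega> + indicator {0} s *\<^sub>R Z 0 \<omega>" for s
      using T_pos by (auto simp: indicator_def)
    have m: "(\<lambda>s. indicator {0..T} s *\<^sub>R Z s \<omega>) \<in> borel_measurable lborel"
      unfolding eq using um[OF T_pos order_refl] by measurable
    have b: "integrable lborel (\<lambda>s. indicator {0..T} s * K :: real)"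
      using T_pos by (intro integrable_mult_left integrable_real_indicator) auto
    show ?thesis unfolding set_integrable_def
      by (rule Bochner_Integration.integrable_bound[OF b m])
         (use Zb in \<open>auto simp: indicator_def K_def intro: order_trans[OF _ abs_ge_self]\<close>)
  qed
  have Xinc: "X b \<omega> - X a \<omega> = (\<integral>s. indicator {a<..b} s *\<^sub>R Z s \<omega> \<partial>lborel)"
    if ab: "0 \<le> a" "a \<le> b" "b \<le> T" for a b
  proof -
    \<comment> \<open>The equation for X is stated with the gauge integral; it agrees with the
      Lebesgue integral because Z is bounded and measurable on [0,T].\<close>
    have X: "X u \<omega> = X 0 \<omega> + set_lebesgue_integral lborel {0..u} (\<lambda>s. Z s \<omega>)" if "u \<in> {0..T}" for u
    proof -
      have "set_integrable lborel {0..u} (\<lambda>s. Z s \<omega>)" by (rule set_integrable_subset[OF Zint]) (use that in auto)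
      from set_borel_integral_eq_integral(2)[OF this] show ?thesis using sde that by metis
    qed
    have "{0..b} = {0..a} \<union> {a<..b}" using ab by auto
    then have "set_lebesgue_integral lborel {0..b} (\<lambda>s. Z s \<omega>) =
       set_lebesgue_integral lborel {0..a} (\<lambda>s. Z s \<omega>) + set_lebesgue_integral lborel {a<..b} (\<lambda>s. Z s \<omega>)"
      using ab by (simp only:) (rule set_integral_Un; auto intro: set_integrable_subset[OF Zint])
    then show ?thesis using X[of a] X[of b] ab by (simp add: set_lebesgue_integral_def)
  qed
  show PX: "X b \<omega> - X a \<omega> = (\<integral>s. indicator {a<..b} s *\<^sub>R (indicator {0<..t} s *\<^sub>R Z s \<omega>) \<partial>lborel)"
    if "0 < t" "t \<le> T" "0 \<le> a" "a \<le> b" "b \<le> t" for t a b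
  proof -
    have "X b \<omega> - X a \<omega> = (\<integral>s. indicator {a<..b} s *\<^sub>R Z s \<omega> \<partial>lborel)" using that by (intro Xinc) auto
    also have "\<dots> = (\<integral>s. indicator {a<..b} s *\<^sub>R (indicator {0<..t} s *\<^sub>R Z s \<omega>) \<partial>lborel)"
      using that by (intro Bochner_Integration.integral_cong) (auto simp: indicator_def)
    finally show ?thesis .
  qed
  have Xc: "continuous_on {0..T} (\<lambda>u. X u \<omega>)"
    by (rule continuous_on_indefinite_integral[OF um[OF T_pos order_refl], of T K])
       (use Zb PX[OF T_pos order_refl] in \<open>auto simp: K_def indicator_def\<close>)
  show "left_lim (\<lambda>u. X u \<omega>) u = X u \<omega>" if u: "u \<in> {0<..T}" for u
  proof -
    define a where "a m = gridpt u m (cell u m u)" for m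
    have a: "a \<longlonglongrightarrow> u" "a m < u" "0 \<le> a m" for m
      using u gridpt_cell_tendsto(1)[of u u] cell_bounds(2)[of u u m] gridpt_nonneg[of u m]
      by (auto simp: a_def[abs_def])
    have 1: "(\<lambda>m. X (a m) \<omega>) \<longlonglongrightarrow> left_lim (\<lambda>u. X u \<omega>) u"
      using cadlag \<omega> u by (intro tendsto_at_left_seq[OF cadlag_pair_left_lim(1)] a) auto
    have 2: "(\<lambda>m. X (a m) \<omega>) \<longlonglongrightarrow> X u \<omega>"
    proof (rule continuous_on_tendsto_compose[OF Xc a(1)])
      show "\<forall>\<^sub>F m in sequentially. a m \<in> {0..T}"
      proof (intro always_eventually allI)
        show "a m \<in> {0..T}" for m using a(2,3)[of m] u by auto
      qed
    qed (use u in auto)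
    from LIMSEQ_unique[OF 1 2] show ?thesis .
  qed
qed

text \<open>Almost surely the noise has no point at the fixed time s, so Z does not jump there, and
  X is continuous. The exceptional set depends on s, which is enough for equality of the laws at
  each time.\<close>

lemma pre_eq:
  assumes s: "s \<in> {0<..T}"
  shows "AE \<omega> in M. pre s \<omega> = (X s \<omega>, Z s \<omega>)"
proof -
  let ?S = "{e. ev_time e = s}"
  have S: "?S \<in> sets borel" using measurable_sets_borel[OF measurable_ev_time, of "{s}"] by (simp add: vimage_def)
  show ?thesis using SDE AE_N_null[OF S no_atoms] AE_space
  proof eventually_elim
    case (elim \<omega>)
    have "?S \<in> null_sets (N \<omega>)" using elim(2) S sets_N[OF elim(3)] by (auto simp: null_sets_def)
    then have ae: "AE e in N \<omega>. e \<notin> ?S" by (rule AE_not_in)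
    have tm: "ev_time \<in> borel_measurable (N \<omega>)"
      unfolding measurable_cong_sets[OF sets_N[OF elim(3)] refl] by (rule measurable_ev_time)
    note [measurable] = tm borel_measurable_integrable[OF path_integrable[OF elim(1) elim(3)]]
    have "(\<integral>e. indicator {0<..<s} (ev_time e) *\<^sub>R jump_integrand I J c \<gamma> f X Z \<omega> T e \<partial>N \<omega>)
        = (\<integral>e. indicator {0<..s} (ev_time e) *\<^sub>R jump_integrand I J c \<gamma> f X Z \<omega> T e \<partial>N \<omega>)"
    proof (rule integral_cong_AE)
      show "AE e in N \<omega>. indicator {0<..<s} (ev_time e) *\<^sub>R jump_integrand I J c \<gamma> f X Z \<omega> T e
          = indicator {0<..s} (ev_time e) *\<^sub>R jump_integrand I J c \<gamma> f X Z \<omega> T e"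
        using ae by eventually_elim (auto simp: indicator_def)
    qed measurable
    then have "left_lim (\<lambda>u. Z u \<omega>) s = Z s \<omega>"
      using path_Z_left[OF elim(1,3) s] path_Z[OF elim(1,3), of s] s by simp
    then show ?case using s path_X_left[OF elim(1,3) s] by (simp add: pre_def)
  qed
qed

lemma pre_law:
  assumes s: "s \<in> {0<..T}"
  shows "distr M P6 (pre s) = density P6 (\<lambda>(x,z). ennreal (f s x z))"
proof -
  have m1: "pre s \<in> measurable M P6"
    unfolding measurable_cong_sets[OF refl sets_P6]
    using measurable_compose[OF measurable_Pair2'[of s borel] pre_measurable] by simp
  have m2: "(\<lambda>\<omega>. (X s \<omega>, Z s \<omega>)) \<in> measurable M P6"
    unfolding measurable_cong_sets[OF refl sets_P6]
    using s by (intro borel_measurable_Pair X_measurable Z_measurable) auto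
  have "distr M P6 (pre s) = distr M P6 (\<lambda>\<omega>. (X s \<omega>, Z s \<omega>))"
    by (rule distr_cong_AE[OF refl refl pre_eq[OF s] m1 m2])
  then show ?thesis using law s by simp
qed

end

section \<open>Change of a test function in a collision\<close>

context kinetic
begin

definition gain :: "(R3 \<times> R3 \<Rightarrow> real) \<Rightarrow> R3 \<times> R3 \<Rightarrow> R3 \<times> real \<times> real \<Rightarrow> real" where
  "gain \<psi> y w = \<psi> (fst y, zstar I J (snd y) (fst w) (fst (snd w)) (snd (snd w))) - \<psi> y"

lemma gain_measurable:
  assumes "\<psi> \<in> borel_measurable borel"
  shows "(\<lambda>(y, w). gain \<psi> y w) \<in> borel_measurable borel"
proof -
  let ?q = "\<lambda>p :: (R3 \<times> R3) \<times> R3 \<times> real \<times> real. (snd (fst p), fst (snd p), fst (snd (snd p)), snd (snd (snd p)))"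
  have q: "?q \<in> borel_measurable borel" by (intro borel_measurable_continuous_onI continuous_intros)
  have a: "(\<lambda>p :: (R3 \<times> R3) \<times> R3 \<times> real \<times> real. alpha I J (snd (fst p)) (fst (snd p)) (fst (snd (snd p))) (snd (snd (snd p)))) \<in> borel_measurable borel"
    using measurable_compose[OF q measurable_alpha[OF frame]] by (simp add: case_prod_unfold)
  have fs: "(\<lambda>p :: (R3 \<times> R3) \<times> R3 \<times> real \<times> real. snd (fst p)) \<in> borel_measurable borel"
    "(\<lambda>p :: (R3 \<times> R3) \<times> R3 \<times> real \<times> real. fst (fst p)) \<in> borel_measurable borel"
    by (intro borel_measurable_continuous_onI continuous_intros)+
  have "(\<lambda>p :: (R3 \<times> R3) \<times> R3 \<times> real \<times> real. (fst (fst p), zstar I J (snd (fst p)) (fst (snd p)) (fst (snd (snd p))) (snd (snd (snd p))))) \<in> borel_measurable borel"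
    unfolding zstar_def by (intro borel_measurable_Pair borel_measurable_add a fs)
  from measurable_compose[OF this assms] measurable_compose[OF borel_measurable_fst assms]
  show ?thesis unfolding gain_def case_prod_unfold by (rule borel_measurable_diff)
qed

lemma gain_le:
  assumes "\<And>p q. \<bar>\<psi> p - \<psi> q\<bar> \<le> L * norm (p - q)" "0 \<le> L" "v \<noteq> snd y" "0 < \<theta>"
  shows "\<bar>gain \<psi> y (v, \<theta>, \<phi>)\<bar> \<le> L * (2 * \<theta> * norm (snd y - v))"
proof -
  have "\<bar>gain \<psi> y (v, \<theta>, \<phi>)\<bar> \<le> L * norm ((fst y, zstar I J (snd y) v \<theta> \<phi>) - y)"
    unfolding gain_def using assms(1) by simp
  also have "(fst y, zstar I J (snd y) v \<theta> \<phi>) - y = (0, alpha I J (snd y) v \<theta> \<phi>)"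
    by (cases y) (simp add: zstar_def)
  also have "norm \<dots> = norm (alpha I J (snd y) v \<theta> \<phi>)" by (simp add: norm_Pair)
  also have "L * norm (alpha I J (snd y) v \<theta> \<phi>) \<le> L * (2 * \<theta> * norm (snd y - v))"
    using norm_alpha_le[OF frame assms(3), of \<theta> \<phi>] assms(2,4) by (intro mult_left_mono) auto
  finally show ?thesis .
qed

lemma L_op_eq_gain:
  "L_op I J Q c \<gamma> (f s) \<psi> x z = (\<integral>w. indicator (UNIV \<times> Xi) w *
     (gain \<psi> (x, z) w * f s x (fst w) * sigma_cs c \<gamma> (norm (z - fst w))) \<partial>W)"
  by (simp add: L_op_def gain_def case_prod_unfold)

end

section \<open>Ito's formula for the process and its expectation\<close>

context jump_sde
begin

text \<open>Acceptance and change are both read at the left limits, which makes the product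
  predictable. Because acceptance is 0 or 1, it can be pulled out of the difference of values of
  \<psi> across a jump.\<close>

definition jump_gain :: "(R3 \<times> R3 \<Rightarrow> real) \<Rightarrow> real \<Rightarrow> 'a \<times> ev \<Rightarrow> real" where
  "jump_gain \<psi> t x = accepted t (pre (ev_time (snd x)) (fst x)) (snd x) *
     gain \<psi> (pre (ev_time (snd x)) (fst x)) (mark (snd x))"

lemma jump_gain_predictable:
  assumes "\<psi> \<in> borel_measurable borel"
  shows "jump_gain \<psi> t \<in> borel_measurable \<P>"
proof -
  have "(\<lambda>x. (pre (ev_time (snd x)) (fst x), snd x)) \<in> borel_measurable \<P>"
    by (intro borel_measurable_Pair pre_predictable measurable_snd_predictable)
  from measurable_compose[OF this accepted_measurable[of t]]
  have "(\<lambda>x. accepted t (pre (ev_time (snd x)) (fst x)) (snd x)) \<in> borel_measurable \<P>" by simp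
  moreover have "(\<lambda>x. (pre (ev_time (snd x)) (fst x), mark (snd x))) \<in> borel_measurable \<P>"
    by (intro borel_measurable_Pair pre_predictable measurable_compose[OF measurable_snd_predictable measurable_mark])
  from measurable_compose[OF this gain_measurable[OF assms]]
  have "(\<lambda>x. gain \<psi> (pre (ev_time (snd x)) (fst x)) (mark (snd x))) \<in> borel_measurable \<P>" by simp
  ultimately show ?thesis unfolding jump_gain_def by (rule borel_measurable_times)
qed

definition drift :: "(R3 \<times> R3 \<Rightarrow> real) \<Rightarrow> real \<Rightarrow> 'a \<Rightarrow> real" where
  "drift \<psi> t \<omega> = (\<integral>s. indicator {0<..t} s * frechet_derivative \<psi> (at (X s \<omega>, Z s \<omega>)) (Z s \<omega>, 0) \<partial>lborel)"

lemma ito: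
  assumes \<psi>: "C2c \<psi>" and t: "0 < t" "t \<le> T"
  shows "AE \<omega> in M. \<psi> (X t \<omega>, Z t \<omega>) - \<psi> (X 0 \<omega>, Z 0 \<omega>) =
     drift \<psi> t \<omega> +
     (\<integral>e. jump_gain \<psi> t (\<omega>, e) \<partial>N0 \<omega>)"
proof -
  obtain L where L: "0 \<le> L" "\<And>p h. \<bar>frechet_derivative \<psi> (at p) h\<bar> \<le> L * norm h"
    using C2c_derivative_bounded[OF \<psi>] by blast
  obtain C where C: "\<And>p. \<bar>\<psi> p\<bar> \<le> C" using C2c_bounded[OF \<psi>] by blast
  have "AE \<omega> in M. \<forall>n. \<exists>\<^sub>F m in sequentially. \<forall>k<Suc m.
     one_point (N \<omega>) (A n \<inter> {e. gridpt t m k < ev_time e \<and> ev_time e \<le> gridpt t m (Suc k)})"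
    unfolding AE_all_countable by (intro allI AE_frequently_one_point A(1) A_fin t)
  then show ?thesis using SDE AE_good AE_space
  proof eventually_elim
    case (elim \<omega>)
    note p = elim(2,4)
    define \<beta> where "\<beta> = jump_integrand I J c \<gamma> f X Z \<omega> T"
    \<comment> \<open>V and \<open>Vm\<close> extend the jump sum to all times, as
      \<open>pathwise_ito\<close> requires, while the equation determines Z on [0,T] only; U is cut
      off to be measurable on the whole line.\<close>
    define V where "V u = Z 0 \<omega> + (\<integral>e. indicator {0<..u} (ev_time e) *\<^sub>R \<beta> e \<partial>N \<omega>)" for u
    define Vm where "Vm u = Z 0 \<omega> + (\<integral>e. indicator {0<..<u} (ev_time e) *\<^sub>R \<beta> e \<partial>N \<omega>)" for u
    define U where "U s = indicator {0<..t} s *\<^sub>R Z s \<omega>" for s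
    have VZ: "V u = Z u \<omega>" if "u \<in> {0..T}" for u
      using path_Z[OF p that] by (simp add: V_def \<beta>_def)
    have VmZ: "Vm u = left_lim (\<lambda>u. Z u \<omega>) u" if "u \<in> {0<..T}" for u
      using path_Z_left[OF p that] by (simp add: Vm_def \<beta>_def)
    obtain K where K: "\<And>u. u \<in> {0..T} \<Longrightarrow> norm (Z u \<omega>) \<le> K" using path_Z_bounded[OF p] by blast
    have "\<psi> (X t \<omega>, V t) - \<psi> (X 0 \<omega>, V 0) =
      (\<integral>s. indicator {0<..t} s *\<^sub>R frechet_derivative \<psi> (at (X s \<omega>, V s)) (U s, 0) \<partial>lborel) +
      (\<integral>e. indicator {0<..t} (ev_time e) *\<^sub>R
          (\<psi> (X (ev_time e) \<omega>, Vm (ev_time e) + \<beta> e) - \<psi> (X (ev_time e) \<omega>, Vm (ev_time e))) \<partial>N \<omega>)"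
    proof (rule pathwise_ito[where A=A and K=K and L=L and C=C and X="\<lambda>s. X s \<omega>"
          and D="\<lambda>p. frechet_derivative \<psi> (at p)" and \<Psi>=\<psi> and \<tau>=ev_time])
      show "emeasure (N \<omega>) (A n) < \<infinity>" for n using elim(3) by (simp add: good_def)
      show "integrable (N \<omega>) \<beta>" unfolding \<beta>_def by (rule path_integrable[OF p])
      show "U \<in> borel_measurable borel" unfolding U_def by (rule path_U_measurable[OF p t])
      show "norm (U s) \<le> K" if "s \<in> {0<..t}" for s using K[of s] that t by (simp add: U_def)
      show "X b \<omega> - X a \<omega> = (\<integral>s. indicator {a<..b} s *\<^sub>R U s \<partial>lborel)" if "0 \<le> a" "a \<le> b" "b \<le> t" for a b
        unfolding U_def by (rule path_X[OF p t that])
      show "\<exists>\<^sub>F m in sequentially. \<forall>k<Suc m. one_point (N \<omega>) (A n \<inter> {e. gridpt t m k < ev_time e \<and> ev_time e \<le> gridpt t m (Suc k)})" for n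
        using elim(1) by blast
    qed (use t L C C2c_lipschitz[OF \<psi>] C2c_has_derivative[OF \<psi>] C2c_continuous_derivative[OF \<psi>] sets_N[OF elim(4)] A
          in \<open>simp_all add: V_def Vm_def del: split_paired_All\<close>)
    moreover have "(\<integral>s. indicator {0<..t} s *\<^sub>R frechet_derivative \<psi> (at (X s \<omega>, V s)) (U s, 0) \<partial>lborel)
        = drift \<psi> t \<omega>"
      unfolding drift_def using t VZ by (intro Bochner_Integration.integral_cong) (auto simp: indicator_def U_def)
    moreover have "(\<integral>e. indicator {0<..t} (ev_time e) *\<^sub>R
          (\<psi> (X (ev_time e) \<omega>, Vm (ev_time e) + \<beta> e) - \<psi> (X (ev_time e) \<omega>, Vm (ev_time e))) \<partial>N \<omega>)
        = (\<integral>e. jump_gain \<psi> t (\<omega>, e) \<partial>N0 \<omega>)"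
      unfolding N0_eq[OF elim(3)]
    proof (rule Bochner_Integration.integral_cong[OF refl])
      fix e :: ev
      show "indicator {0<..t} (ev_time e) *\<^sub>R (\<psi> (X (ev_time e) \<omega>, Vm (ev_time e) + \<beta> e) - \<psi> (X (ev_time e) \<omega>, Vm (ev_time e)))
         = jump_gain \<psi> t (\<omega>, e)"
      proof (cases "ev_time e \<in> {0<..t}")
        case True
        obtain v \<theta> \<phi> r s where e: "e = (v, \<theta>, \<phi>, r, s)" by (cases e)
        have s: "0 < s" "s \<le> t" "s \<le> T" using True t by (auto simp: e ev_time_def)
        have pr: "pre s \<omega> = (X s \<omega>, Vm s)"
          using s VmZ[of s] path_X_left[OF p, of s] by (simp add: pre_def)
        have "\<beta> e = accepted t (X s \<omega>, Vm s) e *\<^sub>R alpha I J (Vm s) v \<theta> \<phi>"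
          using s VmZ[of s] by (auto simp: \<beta>_def jump_integrand_def accepted_def e Xi_def indicator_def)
        \<comment> \<open>A rejected event has jump 0 and leaves \<psi> unchanged; an accepted one
          moves the velocity to \<open>zstar\<close>.\<close>
        moreover have "accepted t (X s \<omega>, Vm s) e = 0 \<or> accepted t (X s \<omega>, Vm s) e = 1"
          by (auto simp: accepted_def e indicator_def)
        ultimately show ?thesis
          using s by (auto simp: jump_gain_def e ev_time_def pr gain_def mark_def zstar_def)
      next
        case False
        then show ?thesis by (cases e) (auto simp: jump_gain_def accepted_def ev_time_def)
      qed
    qed
    ultimately show ?case using VZ[of t] VZ[of 0] t T_pos by simp
  qed
qed

text \<open>Compensation replaces N by its intensity, thinning turns this into \<open>rate\<close>,
  and \<open>generator_integral\<close> recognizes the collision operator. Finiteness comes from the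
  Lipschitz bound on \<psi>: Q may have infinite mass near 0, so boundedness of \<psi> alone would
  not do, while the factor \<theta> in the bound on \<alpha> does.\<close>

lemma expected_jumps:
  assumes \<psi>: "C2c \<psi>" and t: "0 < t" "t \<le> T"
  shows "integrable M (\<lambda>\<omega>. \<integral>e. jump_gain \<psi> t (\<omega>, e) \<partial>N0 \<omega>)"
    and "(\<integral>\<omega>. \<integral>e. jump_gain \<psi> t (\<omega>, e) \<partial>N0 \<omega> \<partial>M) =
      set_lebesgue_integral lborel {0..t} (\<lambda>s. \<integral>(x,z). f s x z * L_op I J Q c \<gamma> (f s) \<psi> x z \<partial>P6)"
proof -
  obtain L where L: "0 \<le> L" "\<And>p h. \<bar>frechet_derivative \<psi> (at p) h\<bar> \<le> L * norm h"
    using C2c_derivative_bounded[OF \<psi>] by blast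
  have \<psi>m: "\<psi> \<in> borel_measurable borel"
    by (rule borel_measurable_continuous_onI[OF C2c_continuous[OF \<psi>]])
  note gm = gain_measurable[OF \<psi>m]
  have gl: "\<bar>gain \<psi> y (v, \<theta>, \<phi>)\<bar> \<le> L * (2 * \<theta> * norm (snd y - v))" if "v \<noteq> snd y" "0 < \<theta>" for y v \<theta> \<phi>
    by (rule gain_le[OF C2c_lipschitz[OF \<psi> L(2)] L(1) that])
  have fin: "(\<integral>\<^sup>+s. indicator {0<..t} s * rate (\<lambda>y w. ennreal \<bar>gain \<psi> y w\<bar>) s \<partial>lborel) < \<infinity>"
    by (rule rate_integral_finite[OF t L(1)]) (intro ennreal_leI gl)
  have acc: "0 \<le> accepted t y e" for y e by (auto simp: accepted_def split: prod.split)
  have e: "(\<integral>\<^sup>+\<omega>. \<integral>\<^sup>+e. ennreal (accepted t (pre (ev_time e) \<omega>) e) * ennreal (g (pre (ev_time e) \<omega>) (mark e)) \<partial>intensity Q f T \<partial>M)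
      = (\<integral>\<^sup>+s. indicator {0<..t} s * rate (\<lambda>y w. ennreal (g y w)) s \<partial>lborel)"
    if "(\<lambda>(y, w). g y w) \<in> borel_measurable borel" for g
  proof (rule expected_intensity[OF prob_space_axioms t _ pre_measurable])
    show "(\<lambda>(y, w). ennreal (g y w)) \<in> borel_measurable borel"
      using measurable_compose[OF that measurable_ennreal] by (simp add: case_prod_unfold)
    show "distr M P6 (pre s) = density P6 (\<lambda>(x, z). ennreal (f s x z))" if "s \<in> {0<..t}" for s
      using pre_law[of s] that t by auto
  qed
  have gms: "(\<lambda>(y, w). - gain \<psi> y w) \<in> borel_measurable borel" "(\<lambda>(y, w). \<bar>gain \<psi> y w\<bar>) \<in> borel_measurable borel"
    using borel_measurable_uminus[OF gm] borel_measurable_abs[OF gm] by (simp_all add: case_prod_unfold)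
  have H: "ennreal (jump_gain \<psi> t (\<omega>, e)) = ennreal (accepted t (pre (ev_time e) \<omega>) e) * ennreal (gain \<psi> (pre (ev_time e) \<omega>) (mark e))"
    "ennreal (- jump_gain \<psi> t (\<omega>, e)) = ennreal (accepted t (pre (ev_time e) \<omega>) e) * ennreal (- gain \<psi> (pre (ev_time e) \<omega>) (mark e))"
    "ennreal \<bar>jump_gain \<psi> t (\<omega>, e)\<bar> = ennreal (accepted t (pre (ev_time e) \<omega>) e) * ennreal \<bar>gain \<psi> (pre (ev_time e) \<omega>) (mark e)\<bar>"
    for \<omega> e
    unfolding jump_gain_def fst_conv snd_conv abs_mult abs_of_nonneg[OF acc] mult_minus_right[symmetric]
    by (intro ennreal_mult' acc)+
  have "(\<integral>\<^sup>+\<omega>. \<integral>\<^sup>+e. ennreal \<bar>jump_gain \<psi> t (\<omega>, e)\<bar> \<partial>intensity Q f T \<partial>M) < \<infinity>"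
    unfolding H(3) e[OF gms(2)] by (rule fin)
  note cs = compensation_signed[OF jump_gain_predictable[OF \<psi>m] this]
  show "integrable M (\<lambda>\<omega>. \<integral>e. jump_gain \<psi> t (\<omega>, e) \<partial>N0 \<omega>)" by (rule cs(2))
  show "(\<integral>\<omega>. \<integral>e. jump_gain \<psi> t (\<omega>, e) \<partial>N0 \<omega> \<partial>M) =
      set_lebesgue_integral lborel {0..t} (\<lambda>s. \<integral>(x,z). f s x z * L_op I J Q c \<gamma> (f s) \<psi> x z \<partial>P6)"
    unfolding cs(3) H(1,2) e[OF gm] e[OF gms(1)] generator_integral[OF gm t fin, symmetric] L_op_eq_gain
    by (simp add: case_prod_unfold)
qed

text \<open>The transport term is bounded, so Fubini exchanges time and expectation, and the law at
  each single time gives the integral against f.\<close>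

lemma expected_transport:
  assumes \<psi>: "C2c \<psi>" and t: "0 < t" "t \<le> T"
  shows "integrable M (drift \<psi> t)"
    and "(\<integral>\<omega>. drift \<psi> t \<omega> \<partial>M) =
      set_lebesgue_integral lborel {0..t} (\<lambda>s. \<integral>(x,z). f s x z * frechet_derivative \<psi> (at (x,z)) (z, 0) \<partial>P6)"
proof -
  interpret MT: pair_sigma_finite M "lborel :: real measure"
    by (intro pair_sigma_finite.intro sigma_finite_measure_axioms lborel.sigma_finite_measure_axioms)
  define tr where "tr p = frechet_derivative \<psi> (at p) (snd p, 0)" for p
  define R where "R s = (\<integral>(x,z). f s x z * tr (x, z) \<partial>P6)" for s
  obtain K where K: "\<And>p. \<bar>tr p\<bar> \<le> K" using C2c_transport_bounded[OF \<psi>] by (auto simp: tr_def simp del: split_paired_All)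
  have trm: "tr \<in> borel_measurable borel" unfolding tr_def[abs_def] by (rule C2c_transport_measurable[OF \<psi>])
  define q where "q \<omega> s = indicator {0<..t} s * tr (X s \<omega>, Z s \<omega>)" for \<omega> s
  have qm: "(\<lambda>(\<omega>, s). q \<omega> s) \<in> borel_measurable (M \<Otimes>\<^sub>M lborel)"
  proof -
    have "(\<lambda>(\<omega>, s). indicator {0<..t} s *\<^sub>R X s \<omega>) \<in> borel_measurable (M \<Otimes>\<^sub>M borel)"
      using t cadlag by (intro measurable_right_continuous X_measurable cadlag_pair_right(1)[where T=T and z="\<lambda>u. Z u _"]) auto
    moreover have "(\<lambda>(\<omega>, s). indicator {0<..t} s *\<^sub>R Z s \<omega>) \<in> borel_measurable (M \<Otimes>\<^sub>M borel)"
      using t cadlag by (intro measurable_right_continuous Z_measurable cadlag_pair_right(2)[where T=T and x="\<lambda>u. X u _"]) auto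
    \<comment> \<open>Joint measurability is known for the paths cut off to (0,t]; the outer
      indicator added next makes the cut-off inside \<open>tr\<close> invisible.\<close>
    ultimately have "(\<lambda>p. tr (indicator {0<..t} (snd p) *\<^sub>R X (snd p) (fst p), indicator {0<..t} (snd p) *\<^sub>R Z (snd p) (fst p)))
        \<in> borel_measurable (M \<Otimes>\<^sub>M borel)"
      unfolding case_prod_unfold by (intro measurable_compose[OF _ trm] borel_measurable_Pair)
    then have "(\<lambda>p. indicator {0<..t} (snd p) * tr (indicator {0<..t} (snd p) *\<^sub>R X (snd p) (fst p), indicator {0<..t} (snd p) *\<^sub>R Z (snd p) (fst p)))
        \<in> borel_measurable (M \<Otimes>\<^sub>M borel)"
      by measurable
    moreover have "(\<lambda>p. indicator {0<..t} (snd p) * tr (indicator {0<..t} (snd p) *\<^sub>R X (snd p) (fst p), indicator {0<..t} (snd p) *\<^sub>R Z (snd p) (fst p)))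
        = (\<lambda>(\<omega>, s). q \<omega> s)"
      by (auto simp: q_def indicator_def fun_eq_iff)
    ultimately show ?thesis
      using measurable_cong_sets[OF sets_pair_measure_cong[OF refl sets_lborel] refl] by metis
  qed
  have qi: "integrable (M \<Otimes>\<^sub>M lborel) (\<lambda>(\<omega>, s). q \<omega> s)"
  proof (rule Bochner_Integration.integrable_bound[OF _ qm])
    have "emeasure (M \<Otimes>\<^sub>M lborel) (space M \<times> {0<..t}) < \<infinity>"
      using t by (subst lborel.emeasure_pair_measure_Times) (simp_all add: emeasure_space_1)
    then show "integrable (M \<Otimes>\<^sub>M lborel) (\<lambda>p. indicator (space M \<times> {0<..t}) p * K :: real)"
      by (intro integrable_mult_left integrable_real_indicator) auto
    show "AE p in M \<Otimes>\<^sub>M lborel. norm (case p of (\<omega>, s) \<Rightarrow> q \<omega> s) \<le> norm (indicator (space M \<times> {0<..t}) p * K)"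
      using K by (intro AE_I2) (auto simp: q_def space_pair_measure indicator_def intro: order_trans[OF K abs_ge_self])
  qed
  have drift: "drift \<psi> t = (\<lambda>\<omega>. \<integral>s. q \<omega> s \<partial>lborel)"
    by (simp add: fun_eq_iff drift_def q_def tr_def)
  show "integrable M (drift \<psi> t)"
    using MT.integrable_fst'[OF qi] by (simp add: drift)
  have Eq: "(\<integral>\<omega>. q \<omega> s \<partial>M) = indicator {0<..t} s * R s" for s
  proof (cases "s \<in> {0<..t}")
    case True
    then have s: "s \<in> {0..T}" using t by auto
    have "(\<integral>\<omega>. tr (X s \<omega>, Z s \<omega>) \<partial>M) = R s"
      unfolding R_def using law dens s
      by (intro integral_density_law trm borel_measurable_Pair X_measurable Z_measurable) auto
    then show ?thesis using True by (simp add: q_def)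
  qed (simp add: q_def)
  have Rm: "(\<lambda>s. indicator {0<..t} s * R s) \<in> borel_measurable lborel"
    using borel_measurable_lebesgue_integral[of "\<lambda>s \<omega>. q \<omega> s" lborel] measurable_compose[OF measurable_pair_swap' qm]
    unfolding Eq[symmetric] by (simp add: case_prod_unfold)
  have "(\<integral>\<omega>. \<integral>s. q \<omega> s \<partial>lborel \<partial>M) = (\<integral>s. \<integral>\<omega>. q \<omega> s \<partial>M \<partial>lborel)"
    by (rule MT.Fubini_integral[OF qi, symmetric])
  also have "\<dots> = (\<integral>s. indicator {0<..t} s * R s \<partial>lborel)" unfolding Eq ..
  also have "\<dots> = (\<integral>s. indicator {0..t} s *\<^sub>R R s \<partial>lborel)"
  proof (rule integral_cong_AE[OF Rm])
    have "(\<lambda>s. indicator {0..t} s *\<^sub>R R s) = (\<lambda>s. indicator {0<..t} s * R s + indicator {0} s * R 0)"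
      using t by (auto simp: fun_eq_iff indicator_def)
    then show "(\<lambda>s. indicator {0..t} s *\<^sub>R R s) \<in> borel_measurable lborel" using Rm by simp
    show "AE s in lborel. indicator {0<..t} s * R s = indicator {0..t} s *\<^sub>R R s"
      using AE_lborel_singleton[of 0] by eventually_elim (auto simp: indicator_def)
  qed
  finally show "(\<integral>\<omega>. drift \<psi> t \<omega> \<partial>M) =
      set_lebesgue_integral lborel {0..t} (\<lambda>s. \<integral>(x,z). f s x z * frechet_derivative \<psi> (at (x,z)) (z, 0) \<partial>P6)"
    by (simp add: drift set_lebesgue_integral_def R_def tr_def)
qed

lemma weak_identity:
  assumes \<psi>: "C2c \<psi>" and t: "0 \<le> t" "t \<le> T"
  shows "(\<integral> (x,z). \<psi> (x,z) * f t x z \<partial>P6) =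
          (\<integral> (x,z). \<psi> (x,z) * f 0 x z \<partial>P6)
        + set_lebesgue_integral lborel {0..t}
            (\<lambda>s. \<integral> (x,z). f s x z * frechet_derivative \<psi> (at (x,z)) (z, 0) \<partial>P6)
        + set_lebesgue_integral lborel {0..t}
            (\<lambda>s. \<integral> (x,z). f s x z * L_op I J Q c \<gamma> (f s) \<psi> x z \<partial>P6)"
proof (cases "t = 0")
  \<comment> \<open>Time grids need t > 0; at t = 0 both time integrals extend over a single point
    and vanish.\<close>
  case True
  have "set_lebesgue_integral lborel {0..0} g = 0" for g :: "real \<Rightarrow> real"
    unfolding set_lebesgue_integral_def
    by (rule integral_eq_zero_AE, use AE_lborel_singleton[of 0] in eventually_elim) (simp add: indicator_def)
  then show ?thesis using True by simp
next
  case False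
  then have t': "0 < t" using t by simp
  have \<psi>m: "\<psi> \<in> borel_measurable borel"
    by (rule borel_measurable_continuous_onI[OF C2c_continuous[OF \<psi>]])
  obtain C where C: "\<And>p. \<bar>\<psi> p\<bar> \<le> C" using C2c_bounded[OF \<psi>] by blast
  have E: "(\<integral>\<omega>. \<psi> (X s \<omega>, Z s \<omega>) \<partial>M) = (\<integral> (x,z). \<psi> (x,z) * f s x z \<partial>P6)" if "s \<in> {0..T}" for s
    using integral_density_law[of M "\<lambda>\<omega>. (X s \<omega>, Z s \<omega>)" "f s" \<psi>] law dens \<psi>m that
    by (simp add: borel_measurable_Pair X_measurable Z_measurable mult.commute)
  have i: "integrable M (\<lambda>\<omega>. \<psi> (X s \<omega>, Z s \<omega>))" if "s \<in> {0..T}" for s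
    using C that
    by (intro integrable_const_bound[of _ C] AE_I2 measurable_compose[OF _ \<psi>m] borel_measurable_Pair X_measurable Z_measurable)
       auto
  note d = expected_transport[OF \<psi> t' t(2)] and j = expected_jumps[OF \<psi> t' t(2)]
  have s: "t \<in> {0..T}" "0 \<in> {0..T}" using t by auto
  have "(\<integral>\<omega>. \<psi> (X t \<omega>, Z t \<omega>) \<partial>M) - (\<integral>\<omega>. \<psi> (X 0 \<omega>, Z 0 \<omega>) \<partial>M)
      = (\<integral>\<omega>. \<psi> (X t \<omega>, Z t \<omega>) - \<psi> (X 0 \<omega>, Z 0 \<omega>) \<partial>M)"
    by (rule Bochner_Integration.integral_diff[OF i[OF s(1)] i[OF s(2)], symmetric])
  also have "\<dots> = (\<integral>\<omega>. drift \<psi> t \<omega> +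
     (\<integral>e. jump_gain \<psi> t (\<omega>, e) \<partial>N0 \<omega>) \<partial>M)"
    using i[OF s(1)] i[OF s(2)] d(1) j(1) by (intro integral_cong_AE ito[OF \<psi> t' t(2)]) auto
  also have "\<dots> = (\<integral>\<omega>. drift \<psi> t \<omega> \<partial>M)
     + (\<integral>\<omega>. \<integral>e. jump_gain \<psi> t (\<omega>, e) \<partial>N0 \<omega> \<partial>M)"
    by (rule Bochner_Integration.integral_add[OF d(1) j(1)])
  finally show ?thesis unfolding E[OF s(1)] E[OF s(2)] d(2) j(2) by linarith
qed

end

theorem theorem3p1:
  fixes I J :: "R3 \<Rightarrow> R3" and Q :: "real measure" and c \<gamma> :: real
    and f df :: "real \<Rightarrow> R3 \<Rightarrow> R3 \<Rightarrow> real" and T :: real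
    and M :: "'a measure" and F :: "real \<Rightarrow> 'a measure"
    and N :: "'a \<Rightarrow> ev measure" and X Z :: "real \<Rightarrow> 'a \<Rightarrow> R3"
  assumes frame: "collision_frame I J"
    and A: "hypA Q c \<gamma>"
    and dens: "\<forall>t\<ge>0. prob_density6 (f t)"
    and B: "hypB f df \<gamma>"
    and T: "T > 0"
    and basis: "stochastic_basis M F T"
    and PRM: "poisson_random_measure M F T (intensity Q f T) N"
    and adapted: "\<forall>t\<in>{0..T}. X t \<in> borel_measurable (F t) \<and> Z t \<in> borel_measurable (F t)"
    and cadlag: "\<forall>\<omega>\<in>space M. cadlag_on T (\<lambda>t. (X t \<omega>, Z t \<omega>))"
    and law: "\<forall>t\<in>{0..T}. distr M P6 (\<lambda>\<omega>. (X t \<omega>, Z t \<omega>)) =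
                           density P6 (\<lambda>(x,z). ennreal (f t x z))"
    and SDE: "AE \<omega> in M. \<forall>t\<in>{0..T}.
                X t \<omega> = X 0 \<omega> + integral {0..t} (\<lambda>s. Z s \<omega>) \<and>
                integrable (N \<omega>) (jump_integrand I J c \<gamma> f X Z \<omega> t) \<and>
                Z t \<omega> = Z 0 \<omega> + (\<integral> e. jump_integrand I J c \<gamma> f X Z \<omega> t e \<partial>N \<omega>)"
  shows "weak_solution I J Q c \<gamma> f T \<and> boltzmann_process I J Q c \<gamma> M X Z f T"
proof -
  interpret kinetic I J Q c \<gamma> f df T
    by (rule kinetic.intro[OF frame A dens B T])
  interpret \<mu>: sigma_finite_measure "intensity Q f T" by (rule sigma_finite_intensity)
  \<comment> \<open>Sigma-finiteness of the intensity supplies the exhausting mark sets on which the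
    truncations are based.\<close>
  obtain E :: "nat \<Rightarrow> ev set" where E: "range E \<subseteq> sets (intensity Q f T)" "(\<Union>i. E i) = space (intensity Q f T)"
      "\<And>i. emeasure (intensity Q f T) (E i) \<noteq> \<infinity>" "incseq E"
    using \<mu>.sigma_finite_incseq by metis
  have "poisson_setup M F T (intensity Q f T) N E"
  proof (rule poisson_setup.intro[OF basis T PRM sets_intensity intensity_no_atoms])
    show "E n \<in> sets borel" for n using E(1) sets_intensity by auto
    show "(\<Union>n. E n) = UNIV" using E(2) sets_eq_imp_space_eq[OF sets_intensity] by simp
  qed (use E in auto)
  then interpret jump_sde I J Q c \<gamma> f df T M F N E X Z
    by (intro jump_sde.intro jump_sde_axioms.intro kinetic_axioms adapted cadlag law SDE)
  have "weak_solution I J Q c \<gamma> f T"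
    unfolding weak_solution_def
  proof (intro conjI ballI allI impI)
    show "prob_density6 (f t)" if "t \<in> {0..T}" for t using dens that by simp
  qed (rule weak_identity; simp)
  then show ?thesis unfolding boltzmann_process_def using cadlag law by blast
qed

end
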